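(* Let $(\mathfrak{L},\cdot,[\cdot,\cdot])$ be a nonzero complex $3$-dimensional transposed Poisson algebra (i.e. the operations $\cdot$ and $[\cdot,\cdot]$ are not both zero). Then $(\mathfrak{L},\cdot,[\cdot,\cdot])$ is isomorphic to one and only one transposed Poisson algebra listed below (up to the isomorphisms inside parametric families stated at the end). Each algebra has basis $e_1,e_2,e_3$; here $\alpha,\beta\in\mathbb{C}$ and $\gamma\in\mathbb{C}^*$. - ${\rm T}_{01}$: $[e_1,e_2]=e_3$, $[e_1,e_3]=-e_2$, $[e_2,e_3]=e_1$. - ${\rm T}_{02}$: $e_2\cdot e_2=e_3$; $[e_1,e_2]=e_3$. - ${\rm T}_{03}^{\beta}$: $e_1\cdot e_2=\beta e_3$; $[e_1,e_2]=e_3$. - ${\rm T}_{04}^{\beta}$: $e_1\cdot e_2=\beta e_3$, $e_2\cdot e_2=e_1$; $[e_1,e_2]=e_3$. - ${\rm T}_{05}$: $e_1\cdot e_1=e_3$, $e_1\cdot e_2=e_1$, $e_2\cdot e_2=e_2$, $e_2\cdot e_3=e_3$; $[e_1,e_2]=e_3$. - ${\rm T}_{06}$: $e_1\cdot e_2=e_1$, $e_2\cdot e_2=e_2$, $e_2\cdot e_3=e_3$; $[e_1,e_2]=e_3$. - ${\rm T}_{07}^{\beta}$: $e_1\cdot e_3=\beta e_1$, $e_2\cdot e_3=\beta e_2$, $e_3\cdot e_3=\beta e_3$; $[e_1,e_3]=e_1$, $[e_2,e_3]=e_2$. - ${\rm T}_{08}$: $e_3\cdot e_3=e_1$; $[e_1,e_3]=e_1$,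 $[e_2,e_3]=e_2$. - ${\rm T}_{09}^{\alpha,\beta}$: $e_1\cdot e_3=\beta e_1$, $e_2\cdot e_3=\beta e_2$, $e_3\cdot e_3=\beta e_3$; $[e_1,e_3]=e_1+e_2$, $[e_2,e_3]=\alpha e_2$. - ${\rm T}_{10}^{\alpha}$: $e_3\cdot e_3=e_2$; $[e_1,e_3]=e_1+e_2$, $[e_2,e_3]=\alpha e_2$. - ${\rm T}_{11}^{\alpha}$: $e_3\cdot e_3=e_1$; $[e_1,e_3]=e_1+e_2$, $[e_2,e_3]=\alpha e_2$. - ${\rm T}_{12}^{\beta}$: $e_1\cdot e_1=e_2$, $e_1\cdot e_3=\beta e_1$, $e_2\cdot e_3=\beta e_2$, $e_3\cdot e_3=\beta e_3$; $[e_1,e_3]=e_1+e_2$, $[e_2,e_3]=2e_2$. - ${\rm T}_{13}$: $e_1\cdot e_1=e_2$, $e_3\cdot e_3=e_2$; $[e_1,e_3]=e_1+e_2$, $[e_2,e_3]=2e_2$. - ${\rm T}_{14}$: $e_1\cdot e_3=e_2$, $e_3\cdot e_3=e_1$; $[e_1,e_3]=e_1+e_2$, $[e_2,e_3]=2e_2$. - ${\rm T}_{15}$: $e_1\cdot e_3=e_2$; $[e_1,e_3]=e_1+e_2$, $[e_2,e_3]=2e_2$. - ${\rm T}_{16}$: $e_3\cdot e_3=e_1+e_2$; $[e_1,e_3]=e_1+e_2$. - ${\rm T}_{17}^{\beta}$: $e_1\cdot e_1=e_2$, $e_1\cdot e_2=-e_2$, $e_1\cdot e_3=\beta e_1$,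 $e_2\cdot e_2=e_2$, $e_2\cdot e_3=\beta e_2$, $e_3\cdot e_3=\beta e_3$; $[e_1,e_3]=e_1+e_2$. - ${\rm T}_{18}$: $e_1\cdot e_1=e_2$, $e_1\cdot e_2=-e_2$, $e_2\cdot e_2=e_2$, $e_3\cdot e_3=e_1+e_2$; $[e_1,e_3]=e_1+e_2$. - ${\rm T}_{19}^{\gamma}$: $e_1\cdot e_3=\gamma e_1+\gamma e_2$, $e_3\cdot e_3=\gamma e_3$; $[e_1,e_3]=e_1+e_2$. - ${\rm T}_{20}$: $e_1\cdot e_1=e_1$, $e_2\cdot e_2=e_2$, $e_3\cdot e_3=e_3$. - ${\rm T}_{21}$: $e_1\cdot e_1=e_1$, $e_2\cdot e_2=e_2$, $e_1\cdot e_3=e_3$. - ${\rm T}_{22}$: $e_1\cdot e_1=e_1$, $e_2\cdot e_2=e_2$. - ${\rm T}_{23}$: $e_1\cdot e_1=e_1$, $e_1\cdot e_2=e_2$, $e_1\cdot e_3=e_3$, $e_2\cdot e_2=e_3$. - ${\rm T}_{24}$: $e_1\cdot e_1=e_1$, $e_1\cdot e_2=e_2$, $e_1\cdot e_3=e_3$. - ${\rm T}_{25}$: $e_1\cdot e_1=e_1$, $e_1\cdot e_2=e_2$. - ${\rm T}_{26}$: $e_1\cdot e_1=e_1$, $e_2\cdot e_2=e_3$. - ${\rm T}_{27}$: $e_1\cdot e_1=e_1$. - ${\rm T}_{28}$: $e_1\cdot e_1=e_2$, $e_1\cdot e_2=e_3$. - ${\rm T}_{29}$: $e_1\cdot e_2=e_3$.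 - ${\rm T}_{30}$: $e_1\cdot e_1=e_2$. Between these algebras there are precisely the following non-trivial isomorphisms: - ${\rm T}_{03}^{\beta_1}\cong{\rm T}_{03}^{\beta_2}$ if and only if $\beta_1=\pm\beta_2$; - ${\rm T}_{09}^{\alpha_1,\beta_1}\cong{\rm T}_{09}^{\alpha_2,\beta_2}$ if and only if $(\alpha_2,\beta_2)=(\alpha_1,\beta_1)$, or $\alpha_1\neq0$ and $(\alpha_2,\beta_2)=\left(\frac{1}{\alpha_1},\frac{\beta_1}{\alpha_1}\right)$; - ${\rm T}_{11}^{\alpha_1}\cong{\rm T}_{11}^{\alpha_2}$ if and only if $\alpha_2=\alpha_1$, or $\alpha_1\neq 0$ and $\alpha_2=\frac{1}{\alpha_1}$.
   Context: All vector spaces are over $\mathbb{C}$. A transposed Poisson algebra is a triple $(\mathfrak{L},\cdot,[\cdot,\cdot])$, where $\mathfrak{L}$ is a vector space, $(\mathfrak{L},\cdot)$ is a commutative associative algebra (not necessarily unital), $(\mathfrak{L},[\cdot,\cdot])$ is a Lie algebra, and $2z\cdot[x,y]=[z\cdot x,y]+[x,z\cdot y]$ for all $x,y,z\in\mathfrak{L}$. Either operation is allowed to be zero. An isomorphism of transposed Poisson algebras is a bijective linear map preserving both operations. In multiplication tables, products $e_i\cdot e_j$ and brackets $[e_i,e_j]$ that are not determined by the listed ones via commutativity of $\cdot$ and anticommutativity of $[\cdot,\cdot]$ are zero. *)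

theory Defs
  imports "HOL-Analysis.Analysis"
begin

section \<open>Transposed Poisson algebras\<close>

locale comm_assoc_algebra = vector_space scale
  for scale :: "complex \<Rightarrow> 'a::ab_group_add \<Rightarrow> 'a" +
  fixes mul :: "'a \<Rightarrow> 'a \<Rightarrow> 'a"
  assumes mul_linear_left: "Vector_Spaces.linear scale scale (\<lambda>x. mul x y)"
    and mul_linear_right: "Vector_Spaces.linear scale scale (\<lambda>y. mul x y)"
    and mul_comm: "mul x y = mul y x"
    and mul_assoc: "mul (mul x y) z = mul x (mul y z)"

locale lie_algebra = vector_space scale
  for scale :: "complex \<Rightarrow> 'a::ab_group_add \<Rightarrow> 'a" +
  fixes bracket :: "'a \<Rightarrow> 'a \<Rightarrow> 'a"
  assumes bracket_linear_left: "Vector_Spaces.linear scale scale (\<lambda>x. bracket x y)"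
    and bracket_linear_right: "Vector_Spaces.linear scale scale (\<lambda>y. bracket x y)"
    and bracket_self: "bracket x x = 0"
    and jacobi: "bracket x (bracket y z) + bracket y (bracket z x) + bracket z (bracket x y) = 0"

locale transposed_poisson_algebra =
  comm_assoc_algebra scale mul + lie_algebra scale bracket
  for scale :: "complex \<Rightarrow> 'a::ab_group_add \<Rightarrow> 'a"
    and mul :: "'a \<Rightarrow> 'a \<Rightarrow> 'a"
    and bracket :: "'a \<Rightarrow> 'a \<Rightarrow> 'a" +
  assumes transposed_leibniz:
    "scale 2 (mul z (bracket x y)) = bracket (mul z x) y + bracket x (mul z y)"

definition tpa_isomorphic ::
  "(complex \<Rightarrow> 'a::ab_group_add \<Rightarrow> 'a) \<Rightarrow> ('a \<Rightarrow> 'a \<Rightarrow> 'a) \<Rightarrow> ('a \<Rightarrow> 'a \<Rightarrow> 'a) \<Rightarrow>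
   (complex \<Rightarrow> 'b::ab_group_add \<Rightarrow> 'b) \<Rightarrow> ('b \<Rightarrow> 'b \<Rightarrow> 'b) \<Rightarrow> ('b \<Rightarrow> 'b \<Rightarrow> 'b) \<Rightarrow> bool"
  where
  "tpa_isomorphic scale1 mul1 bracket1 scale2 mul2 bracket2 \<longleftrightarrow>
     (\<exists>f. Vector_Spaces.linear scale1 scale2 f \<and> bij f \<and>
          (\<forall>x y. f (mul1 x y) = mul2 (f x) (f y)) \<and>
          (\<forall>x y. f (bracket1 x y) = bracket2 (f x) (f y)))"

section \<open>Algebras given by multiplication tables\<close>

text \<open>
  The basis vectors are indexed by the three-element type \<open>3\<close>, in which the numeral
  \<open>3\<close> denotes the same element as \<open>0\<close> and is distinct from \<open>1\<close> and \<open>2\<close>.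
\<close>

type_synonym vec3 = "complex ^ 3"

abbreviation e1 :: vec3 where "e1 \<equiv> axis 1 1"
abbreviation e2 :: vec3 where "e2 \<equiv> axis 2 1"
abbreviation e3 :: vec3 where "e3 \<equiv> axis 3 1"

text \<open>
  An entry \<open>((i, j), v)\<close> of a table prescribes the product of the \<open>i\<close>-th and the \<open>j\<close>-th basis
  vector.  The product in the opposite order is determined by commutativity, respectively
  anticommutativity, and products of basis vectors that are not determined in this way are zero.
\<close>

type_synonym table = "((3 \<times> 3) \<times> vec3) list"

definition comm_entry :: "table \<Rightarrow> 3 \<Rightarrow> 3 \<Rightarrow> vec3" where
  "comm_entry tbl i j =
     (case map_of tbl (i, j) of Some v \<Rightarrow> v
      | None \<Rightarrow> (case map_of tbl (j, i) of Some v \<Rightarrow> v | None \<Rightarrow> 0))"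

definition anticomm_entry :: "table \<Rightarrow> 3 \<Rightarrow> 3 \<Rightarrow> vec3" where
  "anticomm_entry tbl i j =
     (case map_of tbl (i, j) of Some v \<Rightarrow> v
      | None \<Rightarrow> (case map_of tbl (j, i) of Some v \<Rightarrow> - v | None \<Rightarrow> 0))"

definition bilinear_extension :: "(3 \<Rightarrow> 3 \<Rightarrow> vec3) \<Rightarrow> vec3 \<Rightarrow> vec3 \<Rightarrow> vec3" where
  "bilinear_extension c x y = (\<Sum>i\<in>UNIV. \<Sum>j\<in>UNIV. (x $ i * y $ j) *s c i j)"

section \<open>The list of algebras\<close>

datatype tpa_name =
    T01 | T02 | T03 complex | T04 complex | T05 | T06 | T07 complex | T08
  | T09 complex complex | T10 complex | T11 complex | T12 complex | T13 | T14 | T15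
  | T16 | T17 complex | T18 | T19 complex
  | T20 | T21 | T22 | T23 | T24 | T25 | T26 | T27 | T28 | T29 | T30

primrec mult_table :: "tpa_name \<Rightarrow> table" where
  "mult_table T01 = []"
| "mult_table T02 = [((2, 2), e3)]"
| "mult_table (T03 \<beta>) = [((1, 2), \<beta> *s e3)]"
| "mult_table (T04 \<beta>) = [((1, 2), \<beta> *s e3), ((2, 2), e1)]"
| "mult_table T05 = [((1, 1), e3), ((1, 2), e1), ((2, 2), e2), ((2, 3), e3)]"
| "mult_table T06 = [((1, 2), e1), ((2, 2), e2), ((2, 3), e3)]"
| "mult_table (T07 \<beta>) = [((1, 3), \<beta> *s e1), ((2, 3), \<beta> *s e2), ((3, 3), \<beta> *s e3)]"
| "mult_table T08 = [((3, 3), e1)]"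
| "mult_table (T09 \<alpha> \<beta>) = [((1, 3), \<beta> *s e1), ((2, 3), \<beta> *s e2), ((3, 3), \<beta> *s e3)]"
| "mult_table (T10 \<alpha>) = [((3, 3), e2)]"
| "mult_table (T11 \<alpha>) = [((3, 3), e1)]"
| "mult_table (T12 \<beta>) =
     [((1, 1), e2), ((1, 3), \<beta> *s e1), ((2, 3), \<beta> *s e2), ((3, 3), \<beta> *s e3)]"
| "mult_table T13 = [((1, 1), e2), ((3, 3), e2)]"
| "mult_table T14 = [((1, 3), e2), ((3, 3), e1)]"
| "mult_table T15 = [((1, 3), e2)]"
| "mult_table T16 = [((3, 3), e1 + e2)]"
| "mult_table (T17 \<beta>) =
     [((1, 1), e2), ((1, 2), - e2), ((1, 3), \<beta> *s e1), ((2, 2), e2), ((2, 3), \<beta> *s e2),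
      ((3, 3), \<beta> *s e3)]"
| "mult_table T18 = [((1, 1), e2), ((1, 2), - e2), ((2, 2), e2), ((3, 3), e1 + e2)]"
| "mult_table (T19 \<gamma>) = [((1, 3), \<gamma> *s e1 + \<gamma> *s e2), ((3, 3), \<gamma> *s e3)]"
| "mult_table T20 = [((1, 1), e1), ((2, 2), e2), ((3, 3), e3)]"
| "mult_table T21 = [((1, 1), e1), ((2, 2), e2), ((1, 3), e3)]"
| "mult_table T22 = [((1, 1), e1), ((2, 2), e2)]"
| "mult_table T23 = [((1, 1), e1), ((1, 2), e2), ((1, 3), e3), ((2, 2), e3)]"
| "mult_table T24 = [((1, 1), e1), ((1, 2), e2), ((1, 3), e3)]"
| "mult_table T25 = [((1, 1), e1), ((1, 2), e2)]"
| "mult_table T26 = [((1, 1), e1), ((2, 2), e3)]"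
| "mult_table T27 = [((1, 1), e1)]"
| "mult_table T28 = [((1, 1), e2), ((1, 2), e3)]"
| "mult_table T29 = [((1, 2), e3)]"
| "mult_table T30 = [((1, 1), e2)]"

primrec bracket_table :: "tpa_name \<Rightarrow> table" where
  "bracket_table T01 = [((1, 2), e3), ((1, 3), - e2), ((2, 3), e1)]"
| "bracket_table T02 = [((1, 2), e3)]"
| "bracket_table (T03 \<beta>) = [((1, 2), e3)]"
| "bracket_table (T04 \<beta>) = [((1, 2), e3)]"
| "bracket_table T05 = [((1, 2), e3)]"
| "bracket_table T06 = [((1, 2), e3)]"
| "bracket_table (T07 \<beta>) = [((1, 3), e1), ((2, 3), e2)]"
| "bracket_table T08 = [((1, 3), e1), ((2, 3), e2)]"
| "bracket_table (T09 \<alpha> \<beta>) = [((1, 3), e1 + e2), ((2, 3), \<alpha> *s e2)]"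
| "bracket_table (T10 \<alpha>) = [((1, 3), e1 + e2), ((2, 3), \<alpha> *s e2)]"
| "bracket_table (T11 \<alpha>) = [((1, 3), e1 + e2), ((2, 3), \<alpha> *s e2)]"
| "bracket_table (T12 \<beta>) = [((1, 3), e1 + e2), ((2, 3), 2 *s e2)]"
| "bracket_table T13 = [((1, 3), e1 + e2), ((2, 3), 2 *s e2)]"
| "bracket_table T14 = [((1, 3), e1 + e2), ((2, 3), 2 *s e2)]"
| "bracket_table T15 = [((1, 3), e1 + e2), ((2, 3), 2 *s e2)]"
| "bracket_table T16 = [((1, 3), e1 + e2)]"
| "bracket_table (T17 \<beta>) = [((1, 3), e1 + e2)]"
| "bracket_table T18 = [((1, 3), e1 + e2)]"
| "bracket_table (T19 \<gamma>) = [((1, 3), e1 + e2)]"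
| "bracket_table T20 = []"
| "bracket_table T21 = []"
| "bracket_table T22 = []"
| "bracket_table T23 = []"
| "bracket_table T24 = []"
| "bracket_table T25 = []"
| "bracket_table T26 = []"
| "bracket_table T27 = []"
| "bracket_table T28 = []"
| "bracket_table T29 = []"
| "bracket_table T30 = []"

definition T_mult :: "tpa_name \<Rightarrow> vec3 \<Rightarrow> vec3 \<Rightarrow> vec3" where
  "T_mult t = bilinear_extension (comm_entry (mult_table t))"

definition T_bracket :: "tpa_name \<Rightarrow> vec3 \<Rightarrow> vec3 \<Rightarrow> vec3" where
  "T_bracket t = bilinear_extension (anticomm_entry (bracket_table t))"

text \<open>The parameter of the family \<open>T19\<close> ranges over the nonzero complex numbers.\<close>

definition listed :: "tpa_name set" where
  "listed = {t. \<forall>\<gamma>. t = T19 \<gamma> \<longrightarrow> \<gamma> \<noteq> 0}"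

inductive same_class :: "tpa_name \<Rightarrow> tpa_name \<Rightarrow> bool" where
  "same_class t t"
| "\<beta>\<^sub>1 = \<beta>\<^sub>2 \<or> \<beta>\<^sub>1 = - \<beta>\<^sub>2 \<Longrightarrow> same_class (T03 \<beta>\<^sub>1) (T03 \<beta>\<^sub>2)"
| "\<alpha> \<noteq> 0 \<Longrightarrow> same_class (T09 \<alpha> \<beta>) (T09 (1 / \<alpha>) (\<beta> / \<alpha>))"
| "\<alpha> \<noteq> 0 \<Longrightarrow> same_class (T11 \<alpha>) (T11 (1 / \<alpha>))"

end

theory Submission
  imports Defs "HOL-Computational_Algebra.Fundamental_Theorem_Algebra"
begin

text \<open>
  In a transposed Poisson algebra every multiplication operator \<open>\<phi>\<close> is a half-derivation of the Lie
  algebra: \<open>2 \<phi>[x, y] = [\<phi> x, y] + [x, \<phi> y]\<close>.  For each three-dimensional Lie algebra this is a small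
  linear system for the structure constants of the product; solving it, imposing associativity and
  changing basis yields the normal forms.  A Lie algebra that equals its derived algebra carries a
  symmetric matrix of structure constants, which is diagonalised; every other one has a
  two-dimensional abelian ideal, on which a complementary vector acts by a two-by-two matrix.  When
  the bracket vanishes, idempotents and their Peirce decompositions give the commutative associative
  algebras.

  Distinct families are separated by first-order properties of the two operations, and parameters
  within a family by comparing the eigenvalues of the action on the abelian ideal with the effect of
  an isomorphism on the products of basis vectors.
\<close>

section \<open>Multiplication tables in coordinates\<close>

text \<open>Apart from the scalar action of \<open>T07\<close> and \<open>T08\<close>, the tables of
  solvable type write the action of \<open>e3\<close> on the plane of \<open>e1\<close> and
  \<open>e2\<close> as the matrix with rows (1, 1) and (0, \<alpha>). It is diagonalisable for
  \<alpha> different from 1 and a Jordan block for \<alpha> = 1, so one family covers both types.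
  For \<alpha> different from 1 the computations use a diagonal basis instead, and the tables are
  reached from it through \<open>b1 + b2 / (\<alpha> - 1)\<close>. Since \<open>e3\<close> may be
  rescaled, only the ratio of the two eigenvalues matters, and only up to inversion; this is the
  source of the isomorphisms between the parameters \<alpha> and 1 / \<alpha>, and it lets the ratio
  1/2 be reduced to 2. The algebra lives on an arbitrary type, so changes of basis are made in
  coordinates relative to a \<open>frame\<close>: most normal forms are certified by nine numbers,
  and what remains are identities of rational functions. For uniqueness, a pairwise comparison of
  thirty families is avoided: one decision tree computes the number of the family from
  invariants.\<close>

lemma three_neq:
  "(1::3) \<noteq> 2" "(2::3) \<noteq> 1" "(1::3) \<noteq> 3" "(3::3) \<noteq> 1" "(2::3) \<noteq> 3" "(3::3) \<noteq> 2"
  by simp_all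

lemma axis_vector:
  "axis 1 c = (vector [c, 0, 0] :: complex ^ 3)"
  "axis 2 c = (vector [0, c, 0] :: complex ^ 3)"
  "axis 3 c = (vector [0, 0, c] :: complex ^ 3)"
  by (simp_all add: vec_eq_iff forall_3 axis_def)

lemma vector3_arith:
  fixes a b c a' b' c' k :: complex
  shows "(vector [a, b, c] :: vec3) + vector [a', b', c'] = vector [a + a', b + b', c + c']"
    and "(vector [a, b, c] :: vec3) - vector [a', b', c'] = vector [a - a', b - b', c - c']"
    and "- (vector [a, b, c] :: vec3) = vector [- a, - b, - c]"
    and "k *s (vector [a, b, c] :: vec3) = vector [k * a, k * b, k * c]"
    and "(vector [a, b, c] :: vec3) = vector [a', b', c'] \<longleftrightarrow> a = a' \<and> b = b' \<and> c = c'"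
    and "(vector [a, b, c] :: vec3) = 0 \<longleftrightarrow> a = 0 \<and> b = 0 \<and> c = 0"
    and "0 = (vector [a, b, c] :: vec3) \<longleftrightarrow> a = 0 \<and> b = 0 \<and> c = 0"
  by (auto simp: vec_eq_iff forall_3)

lemma bilinear_extension_vector:
  "bilinear_extension c (vector [x1, x2, x3]) (vector [y1, y2, y3]) =
     (x1 * y1) *s c 1 1 + (x1 * y2) *s c 1 2 + (x1 * y3) *s c 1 3 +
     (x2 * y1) *s c 2 1 + (x2 * y2) *s c 2 2 + (x2 * y3) *s c 2 3 +
     (x3 * y1) *s c 3 1 + (x3 * y2) *s c 3 2 + (x3 * y3) *s c 3 3"
  by (simp add: bilinear_extension_def sum_3)

lemma bilinear_extension_linear:
  "Vector_Spaces.linear (*s) (*s) (\<lambda>x. bilinear_extension c x y)"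
  "Vector_Spaces.linear (*s) (*s) (\<lambda>y. bilinear_extension c x y)"
  unfolding bilinear_extension_def
  by (unfold_locales; simp add: sum_3 vec_eq_iff algebra_simps)+

lemmas entry_simps =
  comm_entry_def anticomm_entry_def three_neq axis_vector vector3_arith

lemmas T_simps =
  T_mult_def T_bracket_def bilinear_extension_vector entry_simps

text \<open>With closed coordinate forms, an identity for a table splits into three polynomial
  identities, and no lookup in an association list is left.\<close>

lemma T_mult_vector:
  shows "T_mult T01 (vector [x1, x2, x3]) (vector [y1, y2, y3]) =
     vector [0, 0, 0]"
  and "T_mult T02 (vector [x1, x2, x3]) (vector [y1, y2, y3]) =
     vector [0, 0, x2 * y2]"
  and "T_mult (T03 \<beta>) (vector [x1, x2, x3]) (vector [y1, y2, y3]) =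
     vector [0, 0, \<beta> * (x1 * y2 + x2 * y1)]"
  and "T_mult (T04 \<beta>) (vector [x1, x2, x3]) (vector [y1, y2, y3]) =
     vector [x2 * y2, 0, \<beta> * (x1 * y2 + x2 * y1)]"
  and "T_mult T05 (vector [x1, x2, x3]) (vector [y1, y2, y3]) =
     vector [x1 * y2 + x2 * y1, x2 * y2, x1 * y1 + x2 * y3 + x3 * y2]"
  and "T_mult T06 (vector [x1, x2, x3]) (vector [y1, y2, y3]) =
     vector [x1 * y2 + x2 * y1, x2 * y2, x2 * y3 + x3 * y2]"
  and "T_mult (T07 \<beta>) (vector [x1, x2, x3]) (vector [y1, y2, y3]) =
     vector [\<beta> * (x1 * y3 + x3 * y1), \<beta> * (x2 * y3 + x3 * y2), \<beta> * x3 * y3]"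
  and "T_mult T08 (vector [x1, x2, x3]) (vector [y1, y2, y3]) =
     vector [x3 * y3, 0, 0]"
  and "T_mult (T09 \<alpha> \<beta>) (vector [x1, x2, x3]) (vector [y1, y2, y3]) =
     vector [\<beta> * (x1 * y3 + x3 * y1), \<beta> * (x2 * y3 + x3 * y2), \<beta> * x3 * y3]"
  and "T_mult (T10 \<alpha>) (vector [x1, x2, x3]) (vector [y1, y2, y3]) =
     vector [0, x3 * y3, 0]"
  and "T_mult (T11 \<alpha>) (vector [x1, x2, x3]) (vector [y1, y2, y3]) =
     vector [x3 * y3, 0, 0]"
  and "T_mult (T12 \<beta>) (vector [x1, x2, x3]) (vector [y1, y2, y3]) =
     vector [\<beta> * (x1 * y3 + x3 * y1), x1 * y1 + \<beta> * (x2 * y3 + x3 * y2), \<beta> * x3 * y3]"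
  and "T_mult T13 (vector [x1, x2, x3]) (vector [y1, y2, y3]) =
     vector [0, x1 * y1 + x3 * y3, 0]"
  and "T_mult T14 (vector [x1, x2, x3]) (vector [y1, y2, y3]) =
     vector [x3 * y3, x1 * y3 + x3 * y1, 0]"
  and "T_mult T15 (vector [x1, x2, x3]) (vector [y1, y2, y3]) =
     vector [0, x1 * y3 + x3 * y1, 0]"
  and "T_mult T16 (vector [x1, x2, x3]) (vector [y1, y2, y3]) =
     vector [x3 * y3, x3 * y3, 0]"
  and "T_mult (T17 \<beta>) (vector [x1, x2, x3]) (vector [y1, y2, y3]) =
     vector [\<beta> * (x1 * y3 + x3 * y1), x1 * y1 - (x1 * y2 + x2 * y1) + x2 * y2 + \<beta> * (x2 * y3 + x3 * y2), \<beta> * x3 * y3]"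
  and "T_mult T18 (vector [x1, x2, x3]) (vector [y1, y2, y3]) =
     vector [x3 * y3, x1 * y1 - (x1 * y2 + x2 * y1) + x2 * y2 + x3 * y3, 0]"
  and "T_mult (T19 \<gamma>) (vector [x1, x2, x3]) (vector [y1, y2, y3]) =
     vector [\<gamma> * (x1 * y3 + x3 * y1), \<gamma> * (x1 * y3 + x3 * y1), \<gamma> * x3 * y3]"
  and "T_mult T20 (vector [x1, x2, x3]) (vector [y1, y2, y3]) =
     vector [x1 * y1, x2 * y2, x3 * y3]"
  and "T_mult T21 (vector [x1, x2, x3]) (vector [y1, y2, y3]) =
     vector [x1 * y1, x2 * y2, x1 * y3 + x3 * y1]"
  and "T_mult T22 (vector [x1, x2, x3]) (vector [y1, y2, y3]) =
     vector [x1 * y1, x2 * y2, 0]"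
  and "T_mult T23 (vector [x1, x2, x3]) (vector [y1, y2, y3]) =
     vector [x1 * y1, x1 * y2 + x2 * y1, x1 * y3 + x3 * y1 + x2 * y2]"
  and "T_mult T24 (vector [x1, x2, x3]) (vector [y1, y2, y3]) =
     vector [x1 * y1, x1 * y2 + x2 * y1, x1 * y3 + x3 * y1]"
  and "T_mult T25 (vector [x1, x2, x3]) (vector [y1, y2, y3]) =
     vector [x1 * y1, x1 * y2 + x2 * y1, 0]"
  and "T_mult T26 (vector [x1, x2, x3]) (vector [y1, y2, y3]) =
     vector [x1 * y1, 0, x2 * y2]"
  and "T_mult T27 (vector [x1, x2, x3]) (vector [y1, y2, y3]) =
     vector [x1 * y1, 0, 0]"
  and "T_mult T28 (vector [x1, x2, x3]) (vector [y1, y2, y3]) =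
     vector [0, x1 * y1, x1 * y2 + x2 * y1]"
  and "T_mult T29 (vector [x1, x2, x3]) (vector [y1, y2, y3]) =
     vector [0, 0, x1 * y2 + x2 * y1]"
  and "T_mult T30 (vector [x1, x2, x3]) (vector [y1, y2, y3]) =
     vector [0, x1 * y1, 0]"
  by (simp_all add: T_simps algebra_simps)

lemma T_bracket_vector:
  shows "T_bracket T01 (vector [x1, x2, x3]) (vector [y1, y2, y3]) =
     vector [x2 * y3 - x3 * y2, - (x1 * y3 - x3 * y1), x1 * y2 - x2 * y1]"
  and "T_bracket T02 (vector [x1, x2, x3]) (vector [y1, y2, y3]) =
     vector [0, 0, x1 * y2 - x2 * y1]"
  and "T_bracket (T03 \<beta>) (vector [x1, x2, x3]) (vector [y1, y2, y3]) =
     vector [0, 0, x1 * y2 - x2 * y1]"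
  and "T_bracket (T04 \<beta>) (vector [x1, x2, x3]) (vector [y1, y2, y3]) =
     vector [0, 0, x1 * y2 - x2 * y1]"
  and "T_bracket T05 (vector [x1, x2, x3]) (vector [y1, y2, y3]) =
     vector [0, 0, x1 * y2 - x2 * y1]"
  and "T_bracket T06 (vector [x1, x2, x3]) (vector [y1, y2, y3]) =
     vector [0, 0, x1 * y2 - x2 * y1]"
  and "T_bracket (T07 \<beta>) (vector [x1, x2, x3]) (vector [y1, y2, y3]) =
     vector [x1 * y3 - x3 * y1, x2 * y3 - x3 * y2, 0]"
  and "T_bracket T08 (vector [x1, x2, x3]) (vector [y1, y2, y3]) =
     vector [x1 * y3 - x3 * y1, x2 * y3 - x3 * y2, 0]"
  and "T_bracket (T09 \<alpha> \<beta>) (vector [x1, x2, x3]) (vector [y1, y2, y3]) =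
     vector [x1 * y3 - x3 * y1, x1 * y3 - x3 * y1 + \<alpha> * (x2 * y3 - x3 * y2), 0]"
  and "T_bracket (T10 \<alpha>) (vector [x1, x2, x3]) (vector [y1, y2, y3]) =
     vector [x1 * y3 - x3 * y1, x1 * y3 - x3 * y1 + \<alpha> * (x2 * y3 - x3 * y2), 0]"
  and "T_bracket (T11 \<alpha>) (vector [x1, x2, x3]) (vector [y1, y2, y3]) =
     vector [x1 * y3 - x3 * y1, x1 * y3 - x3 * y1 + \<alpha> * (x2 * y3 - x3 * y2), 0]"
  and "T_bracket (T12 \<beta>) (vector [x1, x2, x3]) (vector [y1, y2, y3]) =
     vector [x1 * y3 - x3 * y1, x1 * y3 - x3 * y1 + 2 * (x2 * y3 - x3 * y2), 0]"
  and "T_bracket T13 (vector [x1, x2, x3]) (vector [y1, y2, y3]) =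
     vector [x1 * y3 - x3 * y1, x1 * y3 - x3 * y1 + 2 * (x2 * y3 - x3 * y2), 0]"
  and "T_bracket T14 (vector [x1, x2, x3]) (vector [y1, y2, y3]) =
     vector [x1 * y3 - x3 * y1, x1 * y3 - x3 * y1 + 2 * (x2 * y3 - x3 * y2), 0]"
  and "T_bracket T15 (vector [x1, x2, x3]) (vector [y1, y2, y3]) =
     vector [x1 * y3 - x3 * y1, x1 * y3 - x3 * y1 + 2 * (x2 * y3 - x3 * y2), 0]"
  and "T_bracket T16 (vector [x1, x2, x3]) (vector [y1, y2, y3]) =
     vector [x1 * y3 - x3 * y1, x1 * y3 - x3 * y1, 0]"
  and "T_bracket (T17 \<beta>) (vector [x1, x2, x3]) (vector [y1, y2, y3]) =
     vector [x1 * y3 - x3 * y1, x1 * y3 - x3 * y1, 0]"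
  and "T_bracket T18 (vector [x1, x2, x3]) (vector [y1, y2, y3]) =
     vector [x1 * y3 - x3 * y1, x1 * y3 - x3 * y1, 0]"
  and "T_bracket (T19 \<gamma>) (vector [x1, x2, x3]) (vector [y1, y2, y3]) =
     vector [x1 * y3 - x3 * y1, x1 * y3 - x3 * y1, 0]"
  and "T_bracket T20 (vector [x1, x2, x3]) (vector [y1, y2, y3]) =
     vector [0, 0, 0]"
  and "T_bracket T21 (vector [x1, x2, x3]) (vector [y1, y2, y3]) =
     vector [0, 0, 0]"
  and "T_bracket T22 (vector [x1, x2, x3]) (vector [y1, y2, y3]) =
     vector [0, 0, 0]"
  and "T_bracket T23 (vector [x1, x2, x3]) (vector [y1, y2, y3]) =
     vector [0, 0, 0]"
  and "T_bracket T24 (vector [x1, x2, x3]) (vector [y1, y2, y3]) =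
     vector [0, 0, 0]"
  and "T_bracket T25 (vector [x1, x2, x3]) (vector [y1, y2, y3]) =
     vector [0, 0, 0]"
  and "T_bracket T26 (vector [x1, x2, x3]) (vector [y1, y2, y3]) =
     vector [0, 0, 0]"
  and "T_bracket T27 (vector [x1, x2, x3]) (vector [y1, y2, y3]) =
     vector [0, 0, 0]"
  and "T_bracket T28 (vector [x1, x2, x3]) (vector [y1, y2, y3]) =
     vector [0, 0, 0]"
  and "T_bracket T29 (vector [x1, x2, x3]) (vector [y1, y2, y3]) =
     vector [0, 0, 0]"
  and "T_bracket T30 (vector [x1, x2, x3]) (vector [y1, y2, y3]) =
     vector [0, 0, 0]"
  by (simp_all add: T_simps algebra_simps)

lemma vector3_cases:
  obtains x1 x2 x3 where "(x::vec3) = vector [x1, x2, x3]"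
  using that[of "x $ 1" "x $ 2" "x $ 3"] by (simp add: vec_eq_iff forall_3)

lemmas T_vector_simps = T_mult_vector T_bracket_vector vector3_arith axis_vector

lemma T_mult_comm: "T_mult t x y = T_mult t y x"
  by (cases x rule: vector3_cases; cases y rule: vector3_cases; hypsubst_thin;
      cases t; hypsubst_thin; simp only: T_vector_simps; intro conjI; simp add: algebra_simps)

lemma T_mult_assoc: "T_mult t (T_mult t x y) z = T_mult t x (T_mult t y z)"
  by (cases x rule: vector3_cases; cases y rule: vector3_cases; cases z rule: vector3_cases;
      hypsubst_thin; cases t; hypsubst_thin; simp only: T_vector_simps; intro conjI;
      simp add: algebra_simps)

lemma T_bracket_self: "T_bracket t x x = 0"
  by (cases x rule: vector3_cases; hypsubst_thin; cases t; hypsubst_thin;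
      simp only: T_vector_simps; intro conjI; simp add: algebra_simps)

lemma T_jacobi:
  "T_bracket t x (T_bracket t y z) + T_bracket t y (T_bracket t z x) + T_bracket t z (T_bracket t x y) = 0"
  by (cases x rule: vector3_cases; cases y rule: vector3_cases; cases z rule: vector3_cases;
      hypsubst_thin; cases t; hypsubst_thin; simp only: T_vector_simps; intro conjI;
      simp add: algebra_simps)

lemma T_leibniz:
  "2 *s T_mult t z (T_bracket t x y) = T_bracket t (T_mult t z x) y + T_bracket t x (T_mult t z y)"
  by (cases x rule: vector3_cases; cases y rule: vector3_cases; cases z rule: vector3_cases;
      hypsubst_thin; cases t; hypsubst_thin; simp only: T_vector_simps; intro conjI;
      simp add: algebra_simps)

lemma T_tpa: "transposed_poisson_algebra (*s) (T_mult t) (T_bracket t)"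
proof -
  have "vector_space ((*s) :: complex \<Rightarrow> vec3 \<Rightarrow> vec3)"
    by (rule vec.vector_space_axioms)
  then have "comm_assoc_algebra (*s) (T_mult t)" "lie_algebra (*s) (T_bracket t)"
    unfolding comm_assoc_algebra_def comm_assoc_algebra_axioms_def lie_algebra_def lie_algebra_axioms_def
    using T_mult_comm T_mult_assoc T_bracket_self T_jacobi bilinear_extension_linear
    unfolding T_mult_def T_bracket_def by blast+
  then show ?thesis
    unfolding transposed_poisson_algebra_def transposed_poisson_algebra_axioms_def
    using T_leibniz by blast
qed

section \<open>Frames of three-dimensional spaces\<close>

locale space3 = vector_space scale
  for scale :: "complex \<Rightarrow> 'a::ab_group_add \<Rightarrow> 'a" +
  assumes dim3: "dim (UNIV :: 'a set) = 3"
begin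

definition comb :: "'a \<Rightarrow> 'a \<Rightarrow> 'a \<Rightarrow> complex \<Rightarrow> complex \<Rightarrow> complex \<Rightarrow> 'a" where
  "comb b1 b2 b3 p q r = scale p b1 + scale q b2 + scale r b3"

text \<open>Independence is phrased through the coefficients of an ordered triple: repeated vectors
  are excluded automatically, and equations between combinations can be compared coordinate by
  coordinate.\<close>

definition frame :: "'a \<Rightarrow> 'a \<Rightarrow> 'a \<Rightarrow> bool" where
  "frame b1 b2 b3 \<longleftrightarrow> (\<forall>p q r. comb b1 b2 b3 p q r = 0 \<longrightarrow> p = 0 \<and> q = 0 \<and> r = 0)"

lemma comb_zero: "comb b1 b2 b3 0 0 0 = 0"
  by (simp add: comb_def)

lemma comb_add: "comb b1 b2 b3 p q r + comb b1 b2 b3 p' q' r' = comb b1 b2 b3 (p + p') (q + q') (r + r')"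
  by (simp add: comb_def scale_left_distrib ac_simps)

lemma comb_minus: "- comb b1 b2 b3 p q r = comb b1 b2 b3 (- p) (- q) (- r)"
  by (simp add: comb_def ac_simps)

lemma comb_diff: "comb b1 b2 b3 p q r - comb b1 b2 b3 p' q' r' = comb b1 b2 b3 (p - p') (q - q') (r - r')"
  by (simp add: comb_def scale_left_diff_distrib algebra_simps)

lemma comb_scale: "scale k (comb b1 b2 b3 p q r) = comb b1 b2 b3 (k * p) (k * q) (k * r)"
  by (simp add: comb_def scale_right_distrib)

lemma comb_comb:
  "comb (comb b1 b2 b3 p1 p2 p3) (comb b1 b2 b3 q1 q2 q3) (comb b1 b2 b3 r1 r2 r3) p q r =
     comb b1 b2 b3 (p * p1 + q * q1 + r * r1) (p * p2 + q * q2 + r * r2) (p * p3 + q * q3 + r * r3)"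
  by (simp add: comb_def scale_right_distrib scale_left_distrib ac_simps)

lemma comb_unit: "comb b1 b2 b3 1 0 0 = b1" "comb b1 b2 b3 0 1 0 = b2" "comb b1 b2 b3 0 0 1 = b3"
  by (simp_all add: comb_def)

lemmas comb_simps = comb_add comb_minus comb_diff comb_scale comb_comb

lemma frame_eq_iff:
  assumes "frame b1 b2 b3"
  shows "comb b1 b2 b3 p q r = comb b1 b2 b3 p' q' r' \<longleftrightarrow> p = p' \<and> q = q' \<and> r = r'"
    and "comb b1 b2 b3 p q r = 0 \<longleftrightarrow> p = 0 \<and> q = 0 \<and> r = 0"
    and "0 = comb b1 b2 b3 p q r \<longleftrightarrow> p = 0 \<and> q = 0 \<and> r = 0"
proof -
  have *: "comb b1 b2 b3 p q r = 0 \<longleftrightarrow> p = 0 \<and> q = 0 \<and> r = 0" for p q r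
    using assms unfolding frame_def by (auto simp: comb_zero)
  show "comb b1 b2 b3 p q r = 0 \<longleftrightarrow> p = 0 \<and> q = 0 \<and> r = 0"
    and "0 = comb b1 b2 b3 p q r \<longleftrightarrow> p = 0 \<and> q = 0 \<and> r = 0"
    using *[of p q r] by auto
  show "comb b1 b2 b3 p q r = comb b1 b2 b3 p' q' r' \<longleftrightarrow> p = p' \<and> q = q' \<and> r = r'"
    using *[of "p - p'" "q - q'" "r - r'"] by (simp flip: comb_diff)
qed

lemma frame_independent:
  assumes "frame b1 b2 b3"
  shows "independent {b1, b2, b3}" "card {b1, b2, b3} = 3"
proof -
  note * = frame_eq_iff(1)[OF assms]
  have b: "b1 \<noteq> b2" "b1 \<noteq> b3" "b2 \<noteq> b3"
    using *[of 1 0 0 0 1 0] *[of 1 0 0 0 0 1] *[of 0 1 0 0 0 1] by (auto simp: comb_unit)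
  then show "card {b1, b2, b3} = 3" by simp
  have "\<forall>v\<in>{b1, b2, b3}. u v = 0" if "(\<Sum>v\<in>{b1, b2, b3}. scale (u v) v) = 0" for u
  proof -
    have "comb b1 b2 b3 (u b1) (u b2) (u b3) = 0"
      using that b by (simp add: comb_def add.assoc)
    then show ?thesis using frame_eq_iff(2)[OF assms] by blast
  qed
  then show "independent {b1, b2, b3}"
    using dependent_finite[of "{b1, b2, b3}"] by blast
qed

lemma finite_basis: obtains B where "finite B" "independent B" "span B = UNIV" "card B = 3"
proof -
  obtain B :: "'a set" where B: "independent B" "UNIV \<subseteq> span B" "card B = 3"
    using basis_exists[of UNIV] dim3 by metis
  then show thesis
    using that[of B] card_ge_0_finite[of B] by auto
qed

lemma frame_spans:
  assumes "frame b1 b2 b3"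
  obtains p q r where "v = comb b1 b2 b3 p q r"
proof -
  obtain B where B: "finite B" "independent B" "span B = UNIV"
    by (rule finite_basis)
  interpret finite_dimensional_vector_space scale B
    using B by unfold_locales auto
  have "UNIV \<subseteq> span {b1, b2, b3}"
    using card_ge_dim_independent[of "{b1, b2, b3}" UNIV] frame_independent[OF assms] dim3 by simp
  then have "v \<in> span {b1, b2, b3}" by auto
  then obtain p q r where "v - scale p b1 - scale q b2 - scale r b3 = 0"
    unfolding span_breakdown_eq span_empty by blast
  then have "v = comb b1 b2 b3 p q r"
    unfolding comb_def diff_diff_eq by (simp only: right_minus_eq)
  then show thesis by (rule that)
qed

lemma frame_exists: obtains b1 b2 b3 where "frame b1 b2 b3"
proof -
  obtain B where B: "independent B" "card B = 3"
    using finite_basis by blast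
  then obtain b1 b2 b3 where b: "B = {b1, b2, b3}" "b1 \<noteq> b2" "b1 \<noteq> b3" "b2 \<noteq> b3"
    by (auto simp: card_3_iff)
  have "frame b1 b2 b3"
    unfolding frame_def
  proof (intro allI impI)
    fix p q r assume *: "comb b1 b2 b3 p q r = 0"
    define u where "u v = (if v = b1 then p else if v = b2 then q else r)" for v
    have u: "u b1 = p" "u b2 = q" "u b3 = r"
      using b by (auto simp: u_def)
    have "(\<Sum>v\<in>B. scale (u v) v) = 0"
      using b(2-4) * unfolding b(1) by (simp add: comb_def add.assoc u)
    moreover have "finite B" using b(1) by simp
    ultimately have "\<forall>v\<in>B. u v = 0"
      using B(1) dependent_finite by blast
    then show "p = 0 \<and> q = 0 \<and> r = 0"
      using b(1) u by simp
  qed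
  then show thesis by (rule that)
qed

text \<open>Cramer's rule: each unknown times the determinant of the coordinate matrix is a
  combination of the three linear equations.\<close>

lemma frame_change:
  assumes "frame b1 b2 b3"
    and "c1 = comb b1 b2 b3 p1 p2 p3" "c2 = comb b1 b2 b3 q1 q2 q3" "c3 = comb b1 b2 b3 r1 r2 r3"
    and det: "p1 * (q2 * r3 - q3 * r2) - p2 * (q1 * r3 - q3 * r1) + p3 * (q1 * r2 - q2 * r1) \<noteq> 0"
  shows "frame c1 c2 c3"
  unfolding frame_def
proof (intro allI impI)
  fix p q r assume "comb c1 c2 c3 p q r = 0"
  then have e: "p * p1 + q * q1 + r * r1 = 0" "p * p2 + q * q2 + r * r2 = 0"
      "p * p3 + q * q3 + r * r3 = 0"
    using assms(1) by (simp_all add: assms(2-4) comb_comb frame_eq_iff)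
  let ?d = "p1 * (q2 * r3 - q3 * r2) - p2 * (q1 * r3 - q3 * r1) + p3 * (q1 * r2 - q2 * r1)"
  have "p * ?d = 0" "q * ?d = 0" "r * ?d = 0"
    using e by algebra+
  then show "p = 0 \<and> q = 0 \<and> r = 0"
    using det by auto
qed

lemma frame_extend:
  assumes "frame b1 b2 b3" "c1 \<noteq> 0"
  obtains c2 c3 where "frame c1 c2 c3"
proof -
  obtain p q r where c: "c1 = comb b1 b2 b3 p q r"
    using frame_spans[OF assms(1)] by blast
  then consider "p \<noteq> 0" | "q \<noteq> 0" | "r \<noteq> 0"
    using assms(2) comb_zero by auto
  then show thesis
  proof cases
    case 1
    have "frame c1 b2 b3"
      by (rule frame_change[OF assms(1) c comb_unit(2,3)[symmetric]]) (use 1 in simp)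
    then show thesis by (rule that)
  next
    case 2
    have "frame c1 b1 b3"
      by (rule frame_change[OF assms(1) c comb_unit(1,3)[symmetric]]) (use 2 in simp)
    then show thesis by (rule that)
  next
    case 3
    have "frame c1 b1 b2"
      by (rule frame_change[OF assms(1) c comb_unit(1,2)[symmetric]]) (use 3 in simp)
    then show thesis by (rule that)
  qed
qed

lemma frame_extend2:
  assumes "frame b1 b2 b3" and indep: "\<And>p q. scale p c1 + scale q c2 = 0 \<Longrightarrow> p = 0 \<and> q = 0"
  obtains c3 where "frame c1 c2 c3"
proof -
  obtain p1 p2 p3 where c1: "c1 = comb b1 b2 b3 p1 p2 p3"
    using frame_spans[OF assms(1)] by blast
  obtain q1 q2 q3 where c2: "c2 = comb b1 b2 b3 q1 q2 q3"
    using frame_spans[OF assms(1)] by blast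
  have "\<not> (p2 * q3 - p3 * q2 = 0 \<and> p1 * q3 - p3 * q1 = 0 \<and> p1 * q2 - p2 * q1 = 0)"
  proof
    assume m: "p2 * q3 - p3 * q2 = 0 \<and> p1 * q3 - p3 * q1 = 0 \<and> p1 * q2 - p2 * q1 = 0"
    \<comment> \<open>All coordinates of these combinations are minors of the two coordinate
      rows.\<close>
    have "scale q1 c1 + scale (- p1) c2 = 0" "scale q2 c1 + scale (- p2) c2 = 0"
         "scale q3 c1 + scale (- p3) c2 = 0"
      unfolding c1 c2 comb_scale comb_add using m by (auto simp: comb_zero algebra_simps)
    then have "p1 = 0 \<and> p2 = 0 \<and> p3 = 0" using indep[of q1 "- p1"] indep[of q2 "- p2"] indep[of q3 "- p3"]
      by (metis neg_equal_0_iff_equal)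
    then show False using indep[of 1 0] by (simp add: c1 comb_zero)
  qed
  then consider "p2 * q3 - p3 * q2 \<noteq> 0" | "p1 * q3 - p3 * q1 \<noteq> 0" | "p1 * q2 - p2 * q1 \<noteq> 0"
    by blast
  then show thesis
  proof cases
    case 1
    have "frame c1 c2 b1"
      by (rule frame_change[OF assms(1) c1 c2 comb_unit(1)[symmetric]]) (use 1 in \<open>simp add: algebra_simps\<close>)
    then show thesis by (rule that)
  next
    case 2
    have "frame c1 c2 b2"
      by (rule frame_change[OF assms(1) c1 c2 comb_unit(2)[symmetric]]) (use 2 in \<open>simp add: algebra_simps\<close>)
    then show thesis by (rule that)
  next
    case 3
    have "frame c1 c2 b3"
      by (rule frame_change[OF assms(1) c1 c2 comb_unit(3)[symmetric]]) (use 3 in \<open>simp add: algebra_simps\<close>)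
    then show thesis by (rule that)
  qed
qed

lemma frame_rotate: "frame b1 b2 b3 \<Longrightarrow> frame b2 b3 b1"
  by (rule frame_change[OF _ comb_unit(2,3,1)[symmetric]]) auto

lemma frame_swap: "frame b1 b2 b3 \<Longrightarrow> frame b2 b1 b3"
  by (rule frame_change[OF _ comb_unit(2,1,3)[symmetric]]) auto

end

section \<open>Three-dimensional algebras\<close>

locale comm3 = comm_assoc_algebra scale mul + space3 scale
  for scale :: "complex \<Rightarrow> 'a::ab_group_add \<Rightarrow> 'a" and mul
begin

lemma mul_add: "mul (x + y) z = mul x z + mul y z" "mul z (x + y) = mul z x + mul z y"
  using mul_linear_left mul_linear_right unfolding Vector_Spaces.linear_iff by auto

lemma mul_scale: "mul (scale k x) z = scale k (mul x z)" "mul z (scale k x) = scale k (mul z x)"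
  using mul_linear_left mul_linear_right unfolding Vector_Spaces.linear_iff by auto

lemma mul_zero [simp]: "mul 0 z = 0" "mul z 0 = 0"
  using mul_scale(1)[of 0 0 z] mul_scale(2)[of z 0 0] by simp_all

lemma mul_minus: "mul (- x) z = - mul x z" "mul z (- x) = - mul z x"
  using mul_add[of x "- x" z] mul_add(2)[of z x "- x"] by (simp_all add: add_eq_0_iff)

lemma mul_diff: "mul (x - y) z = mul x z - mul y z" "mul z (x - y) = mul z x - mul z y"
  using mul_add[of x "- y"] mul_add(2)[of z x "- y"] by (simp_all add: mul_minus)

lemma mul_left_comm: "mul x (mul y z) = mul y (mul x z)"
  by (metis mul_assoc mul_comm)

lemma mul_comb:
  "mul (comb b1 b2 b3 p q r) (comb b1 b2 b3 p' q' r') =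
     scale (p * p') (mul b1 b1) + scale (p * q' + q * p') (mul b1 b2) + scale (p * r' + r * p') (mul b1 b3) +
     scale (q * q') (mul b2 b2) + scale (q * r' + r * q') (mul b2 b3) + scale (r * r') (mul b3 b3)"
  by (simp add: comb_def mul_add mul_scale scale_right_distrib scale_left_distrib
      mul_comm[of b2 b1] mul_comm[of b3 b1] mul_comm[of b3 b2] ac_simps)

end

locale lie3 = lie_algebra scale bracket + space3 scale
  for scale :: "complex \<Rightarrow> 'a::ab_group_add \<Rightarrow> 'a" and bracket
begin

lemma bracket_add:
  "bracket (x + y) z = bracket x z + bracket y z" "bracket z (x + y) = bracket z x + bracket z y"
  using bracket_linear_left bracket_linear_right unfolding Vector_Spaces.linear_iff by auto

lemma bracket_scale:
  "bracket (scale k x) z = scale k (bracket x z)" "bracket z (scale k x) = scale k (bracket z x)"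
  using bracket_linear_left bracket_linear_right unfolding Vector_Spaces.linear_iff by auto

lemma bracket_zero [simp]: "bracket 0 z = 0" "bracket z 0 = 0"
  using bracket_scale(1)[of 0 0 z] bracket_scale(2)[of z 0 0] by simp_all

lemma bracket_anticomm: "bracket y x = - bracket x y"
proof -
  have "bracket x y + bracket y x = 0"
    using bracket_self[of "x + y"] unfolding bracket_add by (simp add: bracket_self add.commute)
  then show ?thesis by (simp only: add_eq_0_iff)
qed

lemma bracket_minus: "bracket (- x) z = - bracket x z" "bracket z (- x) = - bracket z x"
  using bracket_add[of x "- x" z] bracket_add(2)[of z x "- x"] by (simp_all add: add_eq_0_iff)

lemma bracket_diff:
  "bracket (x - y) z = bracket x z - bracket y z" "bracket z (x - y) = bracket z x - bracket z y"
  using bracket_add[of x "- y"] bracket_add(2)[of z x "- y"] by (simp_all add: bracket_minus)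

lemma bracket_comb:
  "bracket (comb b1 b2 b3 p q r) (comb b1 b2 b3 p' q' r') =
     scale (p * q' - q * p') (bracket b1 b2) + scale (p * r' - r * p') (bracket b1 b3) +
     scale (q * r' - r * q') (bracket b2 b3)"
  by (simp add: comb_def bracket_add bracket_scale scale_right_distrib scale_left_diff_distrib
      bracket_self bracket_anticomm[of b2 b1] bracket_anticomm[of b3 b1] bracket_anticomm[of b3 b2]
      scale_minus_right algebra_simps)

end

locale tpa3 = transposed_poisson_algebra scale mul bracket + space3 scale
  for scale :: "complex \<Rightarrow> 'a::ab_group_add \<Rightarrow> 'a" and mul bracket
begin

sublocale comm3 scale mul ..
sublocale lie3 scale bracket ..

end

lemma T_bracket_anticomm: "T_bracket t x y = - T_bracket t y x"
  by (cases x rule: vector3_cases; cases y rule: vector3_cases; hypsubst_thin;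
      cases t; hypsubst_thin; simp only: T_vector_simps; intro conjI; simp add: algebra_simps)

lemma T_mult_bilinear:
  "T_mult t (vector [x1, x2, x3]) (vector [y1, y2, y3]) =
     (x1 * y1) *s T_mult t e1 e1 + (x1 * y2 + x2 * y1) *s T_mult t e1 e2 +
     (x1 * y3 + x3 * y1) *s T_mult t e1 e3 + (x2 * y2) *s T_mult t e2 e2 +
     (x2 * y3 + x3 * y2) *s T_mult t e2 e3 + (x3 * y3) *s T_mult t e3 e3"
proof -
  have *: "comm_entry (mult_table t) 1 1 = T_mult t e1 e1" "comm_entry (mult_table t) 1 2 = T_mult t e1 e2"
    "comm_entry (mult_table t) 1 3 = T_mult t e1 e3" "comm_entry (mult_table t) 2 1 = T_mult t e2 e1"
    "comm_entry (mult_table t) 2 2 = T_mult t e2 e2" "comm_entry (mult_table t) 2 3 = T_mult t e2 e3"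
    "comm_entry (mult_table t) 3 1 = T_mult t e3 e1" "comm_entry (mult_table t) 3 2 = T_mult t e3 e2"
    "comm_entry (mult_table t) 3 3 = T_mult t e3 e3"
    by (simp_all add: T_mult_def axis_vector bilinear_extension_vector)
  show ?thesis
    by (subst T_mult_def) (simp add: bilinear_extension_vector * T_mult_comm[of t e2 e1]
        T_mult_comm[of t e3 e1] T_mult_comm[of t e3 e2] vec.scale_left_distrib ac_simps)
qed

lemma T_bracket_bilinear:
  "T_bracket t (vector [x1, x2, x3]) (vector [y1, y2, y3]) =
     (x1 * y2 - x2 * y1) *s T_bracket t e1 e2 +
     (x1 * y3 - x3 * y1) *s T_bracket t e1 e3 + (x2 * y3 - x3 * y2) *s T_bracket t e2 e3"
proof -
  have *: "anticomm_entry (bracket_table t) 1 1 = T_bracket t e1 e1" "anticomm_entry (bracket_table t) 1 2 = T_bracket t e1 e2"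
    "anticomm_entry (bracket_table t) 1 3 = T_bracket t e1 e3" "anticomm_entry (bracket_table t) 2 1 = T_bracket t e2 e1"
    "anticomm_entry (bracket_table t) 2 2 = T_bracket t e2 e2" "anticomm_entry (bracket_table t) 2 3 = T_bracket t e2 e3"
    "anticomm_entry (bracket_table t) 3 1 = T_bracket t e3 e1" "anticomm_entry (bracket_table t) 3 2 = T_bracket t e3 e2"
    "anticomm_entry (bracket_table t) 3 3 = T_bracket t e3 e3"
    by (simp_all add: T_bracket_def axis_vector bilinear_extension_vector)
  show ?thesis
    by (subst T_bracket_def) (simp add: bilinear_extension_vector * T_bracket_self T_bracket_anticomm[of t e2 e1]
        T_bracket_anticomm[of t e3 e1] T_bracket_anticomm[of t e3 e2] vec.scale_left_diff_distrib algebra_simps)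
qed

context tpa3
begin

text \<open>Bilinear operations agree once they agree on a basis, so nine equations suffice. The map
  \<open>g\<close> runs from coordinate vectors to the algebra, where it is given by a formula; the
  isomorphism is its inverse.\<close>

lemma isomorphic_tableI:
  fixes c1 c2 c3 :: 'a and t :: tpa_name
  defines "g \<equiv> \<lambda>v :: vec3. comb c1 c2 c3 (v $ 1) (v $ 2) (v $ 3)"
  assumes c: "frame c1 c2 c3"
    and m: "mul c1 c1 = g (T_mult t e1 e1)" "mul c1 c2 = g (T_mult t e1 e2)" "mul c1 c3 = g (T_mult t e1 e3)"
      "mul c2 c2 = g (T_mult t e2 e2)" "mul c2 c3 = g (T_mult t e2 e3)" "mul c3 c3 = g (T_mult t e3 e3)"
    and b: "bracket c1 c2 = g (T_bracket t e1 e2)" "bracket c1 c3 = g (T_bracket t e1 e3)"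
      "bracket c2 c3 = g (T_bracket t e2 e3)"
  shows "tpa_isomorphic scale mul bracket (*s) (T_mult t) (T_bracket t)"
proof -
  have g_add: "g (x + y) = g x + g y" and g_scale: "g (k *s x) = scale k (g x)" for x y k
    by (simp_all add: g_def comb_add comb_scale)
  have g_vector: "g (vector [x1, x2, x3]) = comb c1 c2 c3 x1 x2 x3" for x1 x2 x3
    by (simp add: g_def)
  have g_mul: "g (T_mult t x y) = mul (g x) (g y)" for x y
    by (cases x rule: vector3_cases; cases y rule: vector3_cases)
      (simp only: T_mult_bilinear g_add g_scale g_vector mul_comb m)
  have g_bracket: "g (T_bracket t x y) = bracket (g x) (g y)" for x y
    by (cases x rule: vector3_cases; cases y rule: vector3_cases)
      (simp only: T_bracket_bilinear g_add g_scale g_vector bracket_comb b)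
  have "inj g"
    by (rule injI) (simp add: g_def frame_eq_iff[OF c] vec_eq_iff forall_3)
  moreover have "surj g"
  proof (rule surjI)
    show "g (SOME x. g x = v) = v" for v
    proof -
      obtain p q r where "v = comb c1 c2 c3 p q r" by (rule frame_spans[OF c])
      then have "g (vector [p, q, r]) = v" by (simp add: g_vector)
      then show ?thesis by (rule someI)
    qed
  qed
  ultimately have "bij g" by (simp add: bij_def)
  define f where "f = inv g"
  have gf: "g (f v) = v" and fg: "f (g x) = x" for v x
    using \<open>surj g\<close> \<open>inj g\<close> by (simp_all add: f_def surj_f_inv_f)
  have f_add: "f (u + v) = f u + f v" and f_scale: "f (scale k u) = k *s f u"
    and f_mul: "f (mul u v) = T_mult t (f u) (f v)"
    and f_bracket: "f (bracket u v) = T_bracket t (f u) (f v)" for u v k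
    by (metis gf fg g_add, metis gf fg g_scale, metis gf fg g_mul, metis gf fg g_bracket)
  have "Vector_Spaces.linear scale (*s) f"
    unfolding Vector_Spaces.linear_iff using vector_space_axioms vec.vector_space_axioms f_add f_scale by blast
  moreover have "bij f" using \<open>bij g\<close> by (simp add: f_def bij_imp_bij_inv)
  ultimately show ?thesis
    unfolding tpa_isomorphic_def using f_mul f_bracket by blast
qed

end

section \<open>Three-dimensional Lie algebras\<close>

lemma quadratic_root:
  fixes a b :: complex
  obtains z where "z\<^sup>2 = a * z + b"
proof
  let ?s = "csqrt (a\<^sup>2 + 4 * b)"
  have "?s\<^sup>2 = a\<^sup>2 + 4 * b" by simp
  then show "((a + ?s) / 2)\<^sup>2 = a * ((a + ?s) / 2) + b"
    by (simp add: power2_eq_square field_simps)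
qed

section \<open>Normal forms of Lie algebras with a two-dimensional abelian ideal\<close>

context lie3
begin

definition solvable_table :: "'a \<Rightarrow> 'a \<Rightarrow> 'a \<Rightarrow> complex \<Rightarrow> complex \<Rightarrow> complex \<Rightarrow> complex \<Rightarrow> bool" where
  "solvable_table b1 b2 b3 p q r s \<longleftrightarrow> frame b1 b2 b3 \<and> bracket b1 b2 = 0 \<and>
     bracket b1 b3 = comb b1 b2 b3 p q 0 \<and> bracket b2 b3 = comb b1 b2 b3 r s 0"

definition heisenberg_table :: "'a \<Rightarrow> 'a \<Rightarrow> 'a \<Rightarrow> bool" where
  "heisenberg_table b1 b2 b3 \<longleftrightarrow> frame b1 b2 b3 \<and> bracket b1 b2 = b3 \<and> bracket b1 b3 = 0 \<and> bracket b2 b3 = 0"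

text \<open>In a Lie algebra equal to its derived algebra the Jacobi identity says that the matrix of
  \<open>[b2, b3], [b3, b1], [b1, b2]\<close> with respect to \<open>b1, b2, b3\<close> is symmetric.\<close>

definition simple_table :: "'a \<Rightarrow> 'a \<Rightarrow> 'a \<Rightarrow> complex \<Rightarrow> complex \<Rightarrow> complex \<Rightarrow> complex \<Rightarrow> complex \<Rightarrow> complex \<Rightarrow> bool" where
  "simple_table b1 b2 b3 p1 p2 p3 q2 q3 r3 \<longleftrightarrow> frame b1 b2 b3 \<and>
     bracket b2 b3 = comb b1 b2 b3 p1 p2 p3 \<and> bracket b1 b3 = comb b1 b2 b3 (- p2) (- q2) (- q3) \<and>
     bracket b1 b2 = comb b1 b2 b3 p3 q3 r3"

text \<open>With A and A' the old and new matrix of the action and P the matrix with rows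
  \<open>(x1, x2)\<close> and \<open>(y1, y2)\<close>, the equations say k P A = A' P: the matrix is
  conjugated and rescaled, without an inverse of P being written down.\<close>

lemma solvable_table_change:
  assumes "solvable_table b1 b2 b3 p q r s"
    and d: "(x1 * y2 - x2 * y1) * k \<noteq> 0"
    and e: "k * (x1 * p + x2 * r) = x1 * p' + y1 * q'" "k * (x1 * q + x2 * s) = x2 * p' + y2 * q'"
      "k * (y1 * p + y2 * r) = x1 * r' + y1 * s'" "k * (y1 * q + y2 * s) = x2 * r' + y2 * s'"
  shows "solvable_table (comb b1 b2 b3 x1 x2 0) (comb b1 b2 b3 y1 y2 0) (comb b1 b2 b3 0 0 k) p' q' r' s'"
proof -
  have F: "frame b1 b2 b3" and B: "bracket b1 b2 = 0" "bracket b1 b3 = comb b1 b2 b3 p q 0"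
      "bracket b2 b3 = comb b1 b2 b3 r s 0"
    using assms(1) by (auto simp: solvable_table_def)
  have "frame (comb b1 b2 b3 x1 x2 0) (comb b1 b2 b3 y1 y2 0) (comb b1 b2 b3 0 0 k)"
    by (rule frame_change[OF F refl refl refl]) (use d in \<open>simp add: algebra_simps\<close>)
  then show ?thesis
    using e by (auto simp: solvable_table_def bracket_comb B comb_simps frame_eq_iff[OF F] algebra_simps)
qed

text \<open>These are the normal forms of a two-by-two matrix under conjugation and scaling. A
  nonzero nilpotent matrix gives the Heisenberg algebra, with the image of the action as its
  centre.\<close>

lemma solvable_cases:
  assumes "solvable_table b1 b2 b3 p q r s"
  shows "(\<forall>x y. bracket x y = 0) \<or> (\<exists>b1 b2 b3. heisenberg_table b1 b2 b3) \<or>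
    (\<exists>b1 b2 b3. solvable_table b1 b2 b3 1 0 0 1) \<or> (\<exists>b1 b2 b3. solvable_table b1 b2 b3 1 1 0 1) \<or>
    (\<exists>b1 b2 b3 \<alpha>. \<alpha> \<noteq> 1 \<and> solvable_table b1 b2 b3 1 0 0 \<alpha>)"
proof -
  obtain b1 b2 b3 p q s where S: "solvable_table b1 b2 b3 p q 0 s"
  proof (cases "r = 0")
    case True
    then show thesis using assms that by blast
  next
    case False
    \<comment> \<open>\<open>z\<close> is a root of the characteristic polynomial. The vector
      \<open>r b1 + (z - p) b2\<close> is an eigenvector for it, independent of \<open>b2\<close>
      because \<open>r\<close> is nonzero.\<close>
    obtain z where z: "z\<^sup>2 = (p + s) * z + (r * q - p * s)" by (rule quadratic_root)
    have "solvable_table (comb b1 b2 b3 0 1 0) (comb b1 b2 b3 r (z - p) 0) (comb b1 b2 b3 0 0 1)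
        (p + s - z) 1 0 z"
      by (rule solvable_table_change[OF assms])
        (use False z in \<open>simp_all add: algebra_simps power2_eq_square\<close>)
    then show thesis by (rule that)
  qed
  have F: "frame b1 b2 b3" and B: "bracket b1 b2 = 0" "bracket b1 b3 = comb b1 b2 b3 p q 0"
      "bracket b2 b3 = comb b1 b2 b3 0 s 0"
    using S by (auto simp: solvable_table_def)
  show ?thesis
  proof (cases "p = 0")
    case p: False
    show ?thesis
    proof (cases "s = p")
      case s: True
      show ?thesis
      proof (cases "q = 0")
        case True
        have "solvable_table (comb b1 b2 b3 1 0 0) (comb b1 b2 b3 0 1 0) (comb b1 b2 b3 0 0 (1 / p)) 1 0 0 1"
          by (rule solvable_table_change[OF S]) (use p s True in auto)
        then show ?thesis by blast
      next
        case False
        have "solvable_table (comb b1 b2 b3 1 0 0) (comb b1 b2 b3 0 (q / p) 0) (comb b1 b2 b3 0 0 (1 / p)) 1 1 0 1"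
          by (rule solvable_table_change[OF S]) (use p s False in auto)
        then show ?thesis by blast
      qed
    next
      case s: False
      \<comment> \<open>The coefficient \<open>q / (p - s)\<close> makes the first vector an
        eigenvector for \<open>p\<close>; dividing \<open>b3\<close> by \<open>p\<close> turns its
        eigenvalue into 1.\<close>
      have "solvable_table (comb b1 b2 b3 1 (q / (p - s)) 0) (comb b1 b2 b3 0 1 0) (comb b1 b2 b3 0 0 (1 / p))
          1 0 0 (s / p)"
        by (rule solvable_table_change[OF S]) (use p s in \<open>auto simp: field_simps\<close>)
      then show ?thesis using p s by (metis divide_eq_1_iff)
    qed
  next
    case p: True
    show ?thesis
    proof (cases "s = 0")
      case s: True
      show ?thesis
      proof (cases "q = 0")
        case True
        have "bracket x y = 0" for x y
          by (rule frame_spans[OF F, of x]; rule frame_spans[OF F, of y])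
            (simp add: bracket_comb B p s True comb_zero)
        then show ?thesis by blast
      next
        case False
        have "frame b1 b3 (comb b1 b2 b3 0 q 0)"
          by (rule frame_change[OF F comb_unit(1,3)[symmetric] refl]) (use False in simp)
        moreover have "bracket b1 (comb b1 b2 b3 0 q 0) = 0" "bracket b3 (comb b1 b2 b3 0 q 0) = 0"
          using B s bracket_anticomm[of b3 b2] by (simp_all add: comb_def bracket_scale)
        ultimately have "heisenberg_table b1 b3 (comb b1 b2 b3 0 q 0)"
          using B p by (simp add: heisenberg_table_def)
        then show ?thesis by blast
      qed
    next
      case s: False
      have "solvable_table (comb b1 b2 b3 0 1 0) (comb b1 b2 b3 1 (- q / s) 0) (comb b1 b2 b3 0 0 (1 / s)) 1 0 0 0"
        by (rule solvable_table_change[OF S]) (use p s in auto)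
      then show ?thesis by (metis zero_neq_one)
    qed
  qed
qed

text \<open>If the plane of \<open>b1\<close> and \<open>b2\<close> is not abelian, it is the
  algebra \<open>[c1, c2] = c1\<close>, all of whose derivations are inner. Correcting
  \<open>b3\<close> by an element of the plane therefore makes it commute with the plane; then
  \<open>c1\<close> and the corrected vector span an abelian ideal on which \<open>c2\<close>
  acts.\<close>

lemma planar_cases:
  assumes F: "frame b1 b2 b3"
    and B: "bracket b1 b2 = comb b1 b2 b3 w1 w2 0" "bracket b1 b3 = comb b1 b2 b3 p q 0"
      "bracket b2 b3 = comb b1 b2 b3 r s 0"
  shows "\<exists>b1 b2 b3 p q r s. solvable_table b1 b2 b3 p q r s"
proof (cases "w1 = 0 \<and> w2 = 0")
  case True
  then have "solvable_table b1 b2 b3 p q r s"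
    using assms by (simp add: solvable_table_def comb_zero)
  then show ?thesis by blast
next
  case False
  obtain c1 c2 where c: "frame c1 c2 b3" "bracket c1 c2 = c1"
    "\<And>x y. \<exists>x' y'. comb b1 b2 b3 x y 0 = comb c1 c2 b3 x' y' 0"
    "\<exists>x y. c1 = comb b1 b2 b3 x y 0" "\<exists>x y. c2 = comb b1 b2 b3 x y 0"
  proof (cases "w1 = 0")
    case True
    let ?c1 = "comb b1 b2 b3 w1 w2 0" and ?c2 = "comb b1 b2 b3 (- 1 / w2) 0 0"
    have "frame ?c1 ?c2 b3"
      by (rule frame_change[OF F refl refl comb_unit(3)[symmetric]]) (use False True in auto)
    moreover have "bracket ?c1 ?c2 = ?c1"
      using False True by (simp add: bracket_comb B comb_simps frame_eq_iff[OF F])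
    moreover have "comb b1 b2 b3 x y 0 = comb ?c1 ?c2 b3 (y / w2) (- x * w2) 0" for x y
      using False True comb_comb[of b1 b2 b3 w1 w2 0 "- 1 / w2" 0 0 0 0 1]
      by (simp add: comb_unit frame_eq_iff[OF F])
    ultimately show thesis using that[of ?c1 ?c2] by blast
  next
    case w1: False
    let ?c1 = "comb b1 b2 b3 w1 w2 0" and ?c2 = "comb b1 b2 b3 0 (1 / w1) 0"
    have "frame ?c1 ?c2 b3"
      by (rule frame_change[OF F refl refl comb_unit(3)[symmetric]]) (use w1 in auto)
    moreover have "bracket ?c1 ?c2 = ?c1"
      using w1 by (simp add: bracket_comb B comb_simps frame_eq_iff[OF F])
    moreover have "comb b1 b2 b3 x y 0 = comb ?c1 ?c2 b3 (x / w1) (y * w1 - x * w2) 0" for x y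
      using w1 comb_comb[of b1 b2 b3 w1 w2 0 0 "1 / w1" 0 0 0 1]
      by (simp add: comb_unit frame_eq_iff[OF F] field_simps)
    ultimately show thesis using that[of ?c1 ?c2] by blast
  qed
  note C = c(1)
  have "\<exists>x y. bracket (comb b1 b2 b3 u v 0) b3 = comb b1 b2 b3 x y 0" for u v
    using bracket_comb[of b1 b2 b3 u v 0 0 0 1]
    by (auto simp: comb_unit B comb_simps frame_eq_iff[OF F])
  then obtain r s p q where B13: "bracket c1 b3 = comb c1 c2 b3 r s 0"
    and B23: "bracket c2 b3 = comb c1 c2 b3 p q 0"
    using c(3-5) by metis
  note B' = c(2) B13 B23
  have u: "c1 = comb c1 c2 b3 1 0 0" "c2 = comb c1 c2 b3 0 1 0" "b3 = comb c1 c2 b3 0 0 1"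
    by (simp_all add: comb_unit)
  have "bracket c2 c1 = - c1"
    using bracket_anticomm[of c2 c1] B'(1) by simp
  then have "bracket c2 (comb c1 c2 b3 (- r) (- s) 0) = comb c1 c2 b3 r 0 0"
    by (simp add: comb_def bracket_diff bracket_minus bracket_scale bracket_self)
  moreover have "bracket b3 c1 = comb c1 c2 b3 (- r) (- s) 0"
    using bracket_anticomm[of b3 c1] by (simp add: B' comb_minus)
  ultimately have "bracket c2 (bracket b3 c1) = comb c1 c2 b3 r 0 0" by simp
  moreover have "bracket c1 (bracket c2 b3) = comb c1 c2 b3 q 0 0"
    by (simp add: B' comb_def bracket_add bracket_scale bracket_self)
  moreover have "bracket b3 (bracket c1 c2) = comb c1 c2 b3 (- r) (- s) 0"
    using B' bracket_anticomm[of b3 c1] by (simp add: comb_minus)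
  ultimately have "q = 0" "s = 0"
    using jacobi[of c1 c2 b3] by (auto simp: comb_simps frame_eq_iff[OF C])
  \<comment> \<open>On the plane \<open>[-, b3]\<close> coincides with the bracket by
    \<open>r c2 - p c1\<close>, so this element is subtracted from \<open>b3\<close>.\<close>
  have "frame c1 (comb c1 c2 b3 p (- r) 1) c2"
    by (rule frame_change[OF C u(1) refl u(2)]) simp
  moreover have "bracket c1 (comb c1 c2 b3 p (- r) 1) = 0" "bracket (comb c1 c2 b3 p (- r) 1) c2 = 0"
    using \<open>q = 0\<close> \<open>s = 0\<close> bracket_anticomm[of b3 c2]
    by (simp_all add: comb_def bracket_add bracket_diff bracket_minus bracket_scale bracket_self B')
  ultimately have "solvable_table c1 (comb c1 c2 b3 p (- r) 1) c2 1 0 0 0"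
    using c(2) by (simp add: solvable_table_def comb_def)
  then show ?thesis by blast
qed

text \<open>Proportional and zero vectors are included, so that a derived algebra spanned by two
  vectors can always be enclosed in the plane of a frame.\<close>

lemma two_vectors_in_plane:
  obtains c1 c2 c3 x1 x2 y1 y2 where "frame c1 c2 c3" "p = comb c1 c2 c3 x1 x2 0" "q = comb c1 c2 c3 y1 y2 0"
proof -
  obtain b1 b2 b3 where F: "frame b1 b2 b3" by (rule frame_exists)
  show thesis
  proof (cases "\<exists>k. q = scale k p")
    case True
    then obtain k where k: "q = scale k p" by blast
    show ?thesis
    proof (cases "p = 0")
      case True
      then show ?thesis using that[OF F, of 0 0 0 0] k comb_zero by simp
    next
      case False
      then obtain c2 c3 where "frame p c2 c3" using frame_extend[OF F] by blast
      then show ?thesis using that[of p c2 c3 1 0 k 0] k by (simp add: comb_def)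
    qed
  next
    case False
    show ?thesis
    proof (cases "p = 0")
      case True
      then obtain c2 c3 where "frame q c2 c3" using frame_extend[OF F, of q] False by auto
      then show ?thesis using that[of q c2 c3 0 0 1 0] True by (simp add: comb_def)
    next
      case p: False
      obtain c3 where "frame p q c3"
      proof (rule frame_extend2[OF F])
        fix x y assume e: "scale x p + scale y q = 0"
        have "y = 0"
        proof (rule ccontr)
          assume y: "y \<noteq> 0"
          have "scale (1 / y) (scale x p + scale y q) = 0" using e by simp
          then have "q = scale (- x / y) p"
            using y by (simp add: scale_right_distrib add_eq_0_iff2 minus_equation_iff[of q])
          then show False using False by blast
        qed
        then show "x = 0 \<and> y = 0" using e p by simp
      qed (rule that)
      then show ?thesis using that[of p q c3 1 0 0 1] by (simp add: comb_unit)
    qed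
  qed
qed

text \<open>The derived algebra is spanned by the three brackets of the frame. A relation with
  \<open>z\<close> nonzero eliminates one of them, so the derived algebra fits into a plane, and
  \<open>planar_cases\<close> applies to a frame adapted to it.\<close>

lemma derived_dependent:
  assumes F: "frame b1 b2 b3"
    and e: "scale x (bracket b2 b3) + scale y (bracket b3 b1) + scale z (bracket b1 b2) = 0" "z \<noteq> 0"
  shows "\<exists>b1 b2 b3 p q r s. solvable_table b1 b2 b3 p q r s"
proof -
  obtain c1 c2 c3 x1 x2 y1 y2 where C: "frame c1 c2 c3"
    and B: "bracket b2 b3 = comb c1 c2 c3 x1 x2 0" "bracket b1 b3 = comb c1 c2 c3 y1 y2 0"
    by (rule two_vectors_in_plane)
  have "scale (1 / z) (scale x (bracket b2 b3) + scale y (bracket b3 b1) + scale z (bracket b1 b2)) = 0"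
    using e by simp
  then have "bracket b1 b2 + (comb c1 c2 c3 (x * x1 / z - y * y1 / z) (x * x2 / z - y * y2 / z) 0) = 0"
    using e(2) unfolding bracket_anticomm[of b3 b1] B
    by (simp add: scale_right_distrib comb_simps algebra_simps)
  then have B3: "bracket b1 b2 = comb c1 c2 c3 (- (x * x1 / z - y * y1 / z)) (- (x * x2 / z - y * y2 / z)) 0"
    using comb_minus by (metis add_eq_0_iff2 minus_zero)
  have "\<exists>u v. bracket s t = comb c1 c2 c3 u v 0" for s t
    by (rule frame_spans[OF F, of s]; rule frame_spans[OF F, of t])
      (auto simp: bracket_comb B B3 comb_simps frame_eq_iff[OF C])
  then obtain w1 w2 p q r s where "bracket c1 c2 = comb c1 c2 c3 w1 w2 0"
    "bracket c1 c3 = comb c1 c2 c3 p q 0" "bracket c2 c3 = comb c1 c2 c3 r s 0"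
    by metis
  then show ?thesis by (rule planar_cases[OF C])
qed

end

section \<open>Lie algebras equal to their derived algebra\<close>

context lie3
begin

context
  assumes not_solvable: "\<nexists>b1 b2 b3 p q r s. solvable_table b1 b2 b3 p q r s"
begin

text \<open>A relation among the brackets would produce a solvable table:
  \<open>derived_dependent\<close> handles a nonzero last coefficient, and cyclic rotation of the
  frame brings the other two into that place.\<close>

lemma bracket_frame:
  assumes F: "frame b1 b2 b3"
  shows "frame (bracket b2 b3) (bracket b3 b1) (bracket b1 b2)"
  unfolding frame_def comb_def
proof (intro allI impI)
  fix x y z
  assume e: "scale x (bracket b2 b3) + scale y (bracket b3 b1) + scale z (bracket b1 b2) = 0"
  have "z = 0"
    using derived_dependent[OF F e] not_solvable by blast
  moreover have "x = 0"
    using derived_dependent[OF frame_rotate[OF F], of y z x] e not_solvable by (auto simp: ac_simps)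
  moreover have "y = 0"
    using derived_dependent[OF frame_rotate[OF frame_rotate[OF F]], of z x y] e not_solvable
    by (auto simp: ac_simps)
  ultimately show "x = 0 \<and> y = 0 \<and> z = 0" by blast
qed

lemma simple_table_exists:
  assumes F: "frame b1 b2 b3"
  obtains p1 p2 p3 q2 q3 r3 where "simple_table b1 b2 b3 p1 p2 p3 q2 q3 r3"
proof -
  obtain p1 p2 p3 where p: "bracket b2 b3 = comb b1 b2 b3 p1 p2 p3" by (rule frame_spans[OF F])
  obtain q1 q2 q3 where q: "bracket b3 b1 = comb b1 b2 b3 q1 q2 q3" by (rule frame_spans[OF F])
  obtain r1 r2 r3 where r: "bracket b1 b2 = comb b1 b2 b3 r1 r2 r3" by (rule frame_spans[OF F])
  have q': "bracket b1 b3 = comb b1 b2 b3 (- q1) (- q2) (- q3)"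
    using q bracket_anticomm[of b1 b3] by (simp add: comb_minus)
  have K: "bracket b1 (comb b1 b2 b3 x y z) = scale y (bracket b1 b2) - scale z (bracket b3 b1)"
    "bracket b2 (comb b1 b2 b3 x y z) = scale z (bracket b2 b3) - scale x (bracket b1 b2)"
    "bracket b3 (comb b1 b2 b3 x y z) = scale x (bracket b3 b1) - scale y (bracket b2 b3)" for x y z
    by (simp_all add: comb_def bracket_add bracket_scale bracket_self bracket_anticomm[of b1 b3]
        bracket_anticomm[of b2 b1] bracket_anticomm[of b3 b2])
  have J: "bracket b1 (bracket b2 b3) = scale p2 (bracket b1 b2) - scale p3 (bracket b3 b1)"
    "bracket b2 (bracket b3 b1) = scale q3 (bracket b2 b3) - scale q1 (bracket b1 b2)"
    "bracket b3 (bracket b1 b2) = scale r1 (bracket b3 b1) - scale r2 (bracket b2 b3)"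
    using K(1)[of p1 p2 p3] K(2)[of q1 q2 q3] K(3)[of r1 r2 r3] unfolding p[symmetric] q[symmetric] r[symmetric]
    by blast+
  \<comment> \<open>The Jacobi identity is a relation among the three brackets whose coefficients
    are differences of mirrored matrix entries. The brackets form a frame, so these differences
    vanish.\<close>
  have "comb (bracket b2 b3) (bracket b3 b1) (bracket b1 b2) (q3 - r2) (r1 - p3) (p2 - q1) = 0"
    using jacobi[of b1 b2 b3] unfolding J comb_def scale_left_diff_distrib
    by (simp add: algebra_simps)
  then have "q3 = r2" "r1 = p3" "p2 = q1"
    using frame_eq_iff(2)[OF bracket_frame[OF F]] by auto
  then have "simple_table b1 b2 b3 p1 p2 p3 q2 q3 r3"
    using F p q' r by (simp add: simple_table_def)
  then show thesis by (rule that)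
qed

lemma simple_table_nonzero:
  assumes "simple_table b1 b2 b3 p1 p2 p3 q2 q3 r3"
  shows "\<not> (p1 = 0 \<and> p2 = 0 \<and> p3 = 0)" "\<not> (p2 = 0 \<and> q2 = 0 \<and> q3 = 0)"
    "\<not> (p3 = 0 \<and> q3 = 0 \<and> r3 = 0)"
proof -
  have F: "frame b1 b2 b3" and B: "bracket b2 b3 = comb b1 b2 b3 p1 p2 p3"
    "bracket b3 b1 = comb b1 b2 b3 p2 q2 q3" "bracket b1 b2 = comb b1 b2 b3 p3 q3 r3"
    using assms bracket_anticomm[of b3 b1] by (auto simp: simple_table_def comb_minus)
  note * = frame_eq_iff(2)[OF bracket_frame[OF F]]
  show "\<not> (p1 = 0 \<and> p2 = 0 \<and> p3 = 0)" "\<not> (p2 = 0 \<and> q2 = 0 \<and> q3 = 0)"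
    "\<not> (p3 = 0 \<and> q3 = 0 \<and> r3 = 0)"
    using *[of 1 0 0] *[of 0 1 0] *[of 0 0 1] B by (auto simp: comb_zero comb_unit)
qed

text \<open>Under a change of frame the matrix transforms like a quadratic form, up to a determinant
  factor, and \<open>r3\<close> is one of its diagonal values. If these vanished in every frame,
  polarisation would kill the off-diagonal entries too, leaving a zero row.\<close>

lemma simple_table_diagonal_entry:
  obtains b1 b2 b3 p1 p2 p3 q2 q3 r3 where "simple_table b1 b2 b3 p1 p2 p3 q2 q3 r3" "r3 \<noteq> 0"
proof (rule ccontr)
  note general = that
  assume "\<not> thesis"
  then have H: "r3 = 0" if "simple_table b1 b2 b3 p1 p2 p3 q2 q3 r3" for b1 b2 b3 p1 p2 p3 q2 q3 r3
    using that general by blast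
  have H': "z = 0" if F: "frame b1 b2 b3" and z: "bracket b1 b2 = comb b1 b2 b3 x y z" for b1 b2 b3 x y z
  proof -
    obtain p1 p2 p3 q2 q3 r3 where S: "simple_table b1 b2 b3 p1 p2 p3 q2 q3 r3"
      by (rule simple_table_exists[OF F])
    then have "z = r3" using z by (simp add: simple_table_def frame_eq_iff[OF F])
    then show ?thesis using H[OF S] by simp
  qed
  have K: "p2 = 0" if S: "simple_table b1 b2 b3 p1 p2 p3 q2 q3 r3" for b1 b2 b3 p1 p2 p3 q2 q3 r3
  proof -
    have F: "frame b1 b2 b3" and B: "bracket b2 b3 = comb b1 b2 b3 p1 p2 p3"
      "bracket b3 b1 = comb b1 b2 b3 p2 q2 q3" "bracket b1 b3 = comb b1 b2 b3 (- p2) (- q2) (- q3)"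
      "bracket b1 b2 = comb b1 b2 b3 p3 q3 r3"
      using S bracket_anticomm[of b3 b1] by (auto simp: simple_table_def comb_minus)
    have "p1 = 0"
      by (rule H'[OF frame_rotate[OF F], of p2 p3]) (simp add: B comb_def ac_simps)
    moreover have "q2 = 0"
      by (rule H'[OF frame_rotate[OF frame_rotate[OF F]], of q3 p2]) (simp add: B comb_def ac_simps)
    \<comment> \<open>Polarisation: in the frame starting with \<open>b2 - b1\<close> and
      \<open>b3\<close> the diagonal value contains the off-diagonal entry twice.\<close>
    moreover have "q2 + 2 * p2 + p1 = 0"
    proof (rule H')
      let ?c1 = "comb b1 b2 b3 (- 1) 1 0" and ?c2 = "comb b1 b2 b3 0 0 1" and ?c3 = "comb b1 b2 b3 1 0 0"
      show "frame ?c1 ?c2 ?c3"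
        by (rule frame_change[OF F refl refl refl]) simp
      show "bracket ?c1 ?c2 = comb ?c1 ?c2 ?c3 (q2 + p2) (p3 + q3) (q2 + 2 * p2 + p1)"
        by (simp add: bracket_comb B comb_simps frame_eq_iff[OF F])
    qed
    ultimately show ?thesis by simp
  qed
  obtain b1 b2 b3 where F: "frame b1 b2 b3" by (rule frame_exists)
  obtain p1 p2 p3 q2 q3 r3 where S: "simple_table b1 b2 b3 p1 p2 p3 q2 q3 r3"
    by (rule simple_table_exists[OF F])
  have "simple_table b2 b3 b1 q2 q3 p2 r3 p3 p1" "simple_table b3 b1 b2 r3 p3 q3 p1 p2 q2"
    using S frame_rotate[OF F] frame_rotate[OF frame_rotate[OF F]] bracket_anticomm[of b2 b1]
      bracket_anticomm[of b3 b1] bracket_anticomm[of b3 b2]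
    by (auto simp: simple_table_def comb_def ac_simps)
  then show False
    using simple_table_nonzero(3)[OF S] K[OF S] K H[OF S] H by blast
qed

text \<open>Completing the square: replacing \<open>b3\<close> by \<open>[b1, b2] / r\<close> clears
  the last row and, by symmetry, the last column. The remaining two-by-two block is treated likewise
  once its first entry is nonzero.\<close>

lemma simple_diagonal:
  obtains b1 b2 b3 p q r where "simple_table b1 b2 b3 p 0 0 q 0 r"
proof -
  obtain b1 b2 b3 p1 p2 p3 q2 q3 r where S: "simple_table b1 b2 b3 p1 p2 p3 q2 q3 r" and r: "r \<noteq> 0"
    by (rule simple_table_diagonal_entry)
  obtain b1 b2 b3 p1 p2 q2 where S: "simple_table b1 b2 b3 p1 p2 0 q2 0 r"
  proof -
    have F: "frame b1 b2 b3" and B: "bracket b1 b2 = comb b1 b2 b3 p3 q3 r"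
      using S by (auto simp: simple_table_def)
    let ?c = "comb b1 b2 b3 (p3 / r) (q3 / r) 1"
    have F': "frame b1 b2 ?c"
      by (rule frame_change[OF F comb_unit(1,2)[symmetric] refl]) simp
    have "bracket b1 b2 = comb b1 b2 ?c 0 0 r"
      using B r by (simp add: comb_def scale_right_distrib)
    then show thesis
      using that by (rule_tac simple_table_exists[OF F']) (auto simp: simple_table_def frame_eq_iff[OF F'])
  qed
  obtain b1 b2 b3 p1 p2 q2 where S: "simple_table b1 b2 b3 p1 p2 0 q2 0 r" and "p1 \<noteq> 0"
  proof (cases "p1 = 0")
    case False
    then show ?thesis using S that by blast
  next
    case p1: True
    have F: "frame b1 b2 b3" and B: "bracket b2 b3 = comb b1 b2 b3 p1 p2 0"
      "bracket b1 b3 = comb b1 b2 b3 (- p2) (- q2) 0" "bracket b1 b2 = comb b1 b2 b3 0 0 r"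
      using S by (auto simp: simple_table_def)
    show ?thesis
    proof (cases "q2 = 0")
      case False
      have "frame (comb b1 b2 b3 0 1 0) (comb b1 b2 b3 1 0 0) (comb b1 b2 b3 0 0 (- 1))"
        by (rule frame_change[OF F refl refl refl]) simp
      then have "simple_table (comb b1 b2 b3 0 1 0) (comb b1 b2 b3 1 0 0) (comb b1 b2 b3 0 0 (- 1)) q2 p2 0 p1 0 r"
        by (simp add: simple_table_def bracket_comb B comb_simps frame_eq_iff[OF F])
      then show ?thesis using that False by blast
    next
      case True
      then have "p2 \<noteq> 0" using simple_table_nonzero(1)[OF S] p1 by simp
      \<comment> \<open>Both diagonal entries of the block vanish; replacing \<open>b2\<close> by
        \<open>b2 - b1\<close> creates the entry \<open>2 * p2\<close>.\<close>
      have "frame (comb b1 b2 b3 1 0 0) (comb b1 b2 b3 (- 1) 1 0) (comb b1 b2 b3 0 0 1)"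
        by (rule frame_change[OF F refl refl refl]) simp
      then have "simple_table (comb b1 b2 b3 1 0 0) (comb b1 b2 b3 (- 1) 1 0) (comb b1 b2 b3 0 0 1)
          (2 * p2) p2 0 0 0 r"
        by (simp add: simple_table_def bracket_comb B comb_simps frame_eq_iff[OF F] p1 True)
      then show ?thesis using that \<open>p2 \<noteq> 0\<close> by simp
    qed
  qed
  have F: "frame b1 b2 b3" and B: "bracket b2 b3 = comb b1 b2 b3 p1 p2 0"
    "bracket b1 b3 = comb b1 b2 b3 (- p2) (- q2) 0" "bracket b1 b2 = comb b1 b2 b3 0 0 r"
    using S by (auto simp: simple_table_def)
  have "frame (comb b1 b2 b3 1 (p2 / p1) 0) (comb b1 b2 b3 0 1 0) (comb b1 b2 b3 0 0 1)"
    by (rule frame_change[OF F refl refl refl]) simp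
  then have "simple_table (comb b1 b2 b3 1 (p2 / p1) 0) (comb b1 b2 b3 0 1 0) (comb b1 b2 b3 0 0 1)
     p1 0 0 (q2 - p2 * p2 / p1) 0 r"
    using \<open>p1 \<noteq> 0\<close> by (simp add: simple_table_def bracket_comb B comb_simps frame_eq_iff[OF F])
  then show thesis by (rule that)
qed

lemma simple_orthonormal:
  obtains b1 b2 b3 where "simple_table b1 b2 b3 1 0 0 1 0 1"
proof -
  obtain b1 b2 b3 p q r where S: "simple_table b1 b2 b3 p 0 0 q 0 r"
    by (rule simple_diagonal)
  have F: "frame b1 b2 b3" and B: "bracket b2 b3 = comb b1 b2 b3 p 0 0"
    "bracket b1 b3 = comb b1 b2 b3 0 (- q) 0" "bracket b1 b2 = comb b1 b2 b3 0 0 r"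
    using S by (auto simp: simple_table_def)
  have nz: "p \<noteq> 0" "q \<noteq> 0" "r \<noteq> 0"
    using simple_table_nonzero[OF S] by auto
  define x y z where xyz: "x = csqrt p" "y = csqrt q" "z = csqrt r"
  have sq: "p = x * x" "q = y * y" "r = z * z"
    by (simp_all add: xyz flip: power2_eq_square)
  have nz': "x \<noteq> 0" "y \<noteq> 0" "z \<noteq> 0" using nz sq by auto
  \<comment> \<open>Scaling the frame by l1, l2, l3 multiplies the first entry by l2 l3 / l1, and
    cyclically; these factors make all three entries 1.\<close>
  let ?c1 = "comb b1 b2 b3 (1 / (y * z)) 0 0" and ?c2 = "comb b1 b2 b3 0 (1 / (x * z)) 0"
    and ?c3 = "comb b1 b2 b3 0 0 (1 / (x * y))"
  have "frame ?c1 ?c2 ?c3"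
    by (rule frame_change[OF F refl refl refl]) (use nz' in simp)
  then have "simple_table ?c1 ?c2 ?c3 1 0 0 1 0 1"
    using nz' by (simp add: simple_table_def bracket_comb B comb_simps frame_eq_iff[OF F] sq field_simps)
  then show thesis by (rule that)
qed

end

theorem lie_cases:
  shows "(\<forall>x y. bracket x y = 0) \<or> (\<exists>b1 b2 b3. heisenberg_table b1 b2 b3) \<or>
    (\<exists>b1 b2 b3. simple_table b1 b2 b3 1 0 0 1 0 1) \<or>
    (\<exists>b1 b2 b3. solvable_table b1 b2 b3 1 0 0 1) \<or> (\<exists>b1 b2 b3. solvable_table b1 b2 b3 1 1 0 1) \<or>
    (\<exists>b1 b2 b3 \<alpha>. \<alpha> \<noteq> 1 \<and> solvable_table b1 b2 b3 1 0 0 \<alpha>)"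
proof (cases "\<exists>b1 b2 b3 p q r s. solvable_table b1 b2 b3 p q r s")
  case True
  then obtain b1 b2 b3 p q r s where "solvable_table b1 b2 b3 p q r s" by blast
  from solvable_cases[OF this] show ?thesis by blast
next
  case False
  obtain b1 b2 b3 where "simple_table b1 b2 b3 1 0 0 1 0 1"
    by (rule simple_orthonormal[OF False])
  then show ?thesis by blast
qed

end

section \<open>Products on solvable Lie algebras\<close>

definition det3 :: "complex \<Rightarrow> complex \<Rightarrow> complex \<Rightarrow> complex \<Rightarrow> complex \<Rightarrow> complex \<Rightarrow> complex \<Rightarrow> complex \<Rightarrow> complex \<Rightarrow> complex"
  where "det3 p1 p2 p3 q1 q2 q3 r1 r2 r3 =
    p1 * (q2 * r3 - q3 * r2) - p2 * (q1 * r3 - q3 * r1) + p3 * (q1 * r2 - q2 * r1)"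

context tpa3
begin

abbreviation (input) isomorphic_to :: "tpa_name \<Rightarrow> bool" where
  "isomorphic_to t \<equiv> tpa_isomorphic scale mul bracket (*s) (T_mult t) (T_bracket t)"

text \<open>The working form of \<open>isomorphic_tableI\<close>: the nine numbers are the
  coordinate rows of the new basis in a frame whose products are known.\<close>

lemma isomorphic_changeI:
  fixes b1 b2 b3 :: 'a
  assumes "frame b1 b2 b3" and "det3 p1 p2 p3 q1 q2 q3 r1 r2 r3 \<noteq> 0"
  defines "c1 \<equiv> comb b1 b2 b3 p1 p2 p3" and "c2 \<equiv> comb b1 b2 b3 q1 q2 q3" and "c3 \<equiv> comb b1 b2 b3 r1 r2 r3"
  defines "g \<equiv> \<lambda>v :: vec3. comb c1 c2 c3 (v $ 1) (v $ 2) (v $ 3)"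
  assumes "mul c1 c1 = g (T_mult t e1 e1)" "mul c1 c2 = g (T_mult t e1 e2)" "mul c1 c3 = g (T_mult t e1 e3)"
      "mul c2 c2 = g (T_mult t e2 e2)" "mul c2 c3 = g (T_mult t e2 e3)" "mul c3 c3 = g (T_mult t e3 e3)"
    and "bracket c1 c2 = g (T_bracket t e1 e2)" "bracket c1 c3 = g (T_bracket t e1 e3)"
      "bracket c2 c3 = g (T_bracket t e2 e3)"
  shows "isomorphic_to t"
proof (rule isomorphic_tableI)
  show "frame c1 c2 c3"
    unfolding c1_def c2_def c3_def using assms(2)
    by (intro frame_change[OF assms(1) refl refl refl]) (simp add: det3_def)
qed (fact assms[unfolded g_def])+

lemmas change_simps = det3_def
  T_mult_vector T_bracket_vector axis_vector mul_comb bracket_comb comb_simps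

text \<open>The equations are coefficients of the half-derivation rule for multiplication by
  \<open>b1\<close>, \<open>b2\<close> and \<open>b3\<close> in turn. All are linear; associativity
  is imposed later, only where extra coefficients survive.\<close>

lemma solvable_mul:
  assumes S: "solvable_table b1 b2 b3 1 q 0 s"
  obtains a1 a2 a3 c1 c2 c3 d1 d2 d3 f1 f2 f3 g1 g2 g3 h1 h2 h3 where
    "mul b1 b1 = comb b1 b2 b3 a1 a2 a3" "mul b1 b2 = comb b1 b2 b3 c1 c2 c3"
    "mul b1 b3 = comb b1 b2 b3 d1 d2 d3" "mul b2 b2 = comb b1 b2 b3 f1 f2 f3"
    "mul b2 b3 = comb b1 b2 b3 g1 g2 g3" "mul b3 b3 = comb b1 b2 b3 h1 h2 h3"
    "c3 = 0" "a1 + 2 * (q * c1) = d3" "2 * a2 + 2 * (q * c2) = a1 * q + a2 * s + d3 * q"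
    "a3 + q * c3 = 0" "2 * (s * c1) = c1" "c2 * s = c1 * q + d3 * s"
    "f3 = 0" "c1 + 2 * (q * f1) = g3" "2 * c2 + 2 * (q * f2) = c1 * q + c2 * s + g3 * q"
    "2 * (s * f1) = f1" "f2 * s = f1 * q + g3 * s"
    "g3 = 0" "d1 + 2 * (q * g1) = h3" "2 * d2 + 2 * (q * g2) = d1 * q + d2 * s + h3 * q"
    "d3 + q * g3 = 0" "2 * (s * g1) = g1" "g2 * s = g1 * q + h3 * s"
proof -
  have F: "frame b1 b2 b3" and B: "bracket b1 b2 = comb b1 b2 b3 0 0 0"
    "bracket b1 b3 = comb b1 b2 b3 1 q 0" "bracket b2 b3 = comb b1 b2 b3 0 s 0"
    using S by (auto simp: solvable_table_def comb_zero)
  obtain a1 a2 a3 where a: "mul b1 b1 = comb b1 b2 b3 a1 a2 a3" by (rule frame_spans[OF F])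
  obtain c1 c2 c3 where c: "mul b1 b2 = comb b1 b2 b3 c1 c2 c3" by (rule frame_spans[OF F])
  obtain d1 d2 d3 where d: "mul b1 b3 = comb b1 b2 b3 d1 d2 d3" by (rule frame_spans[OF F])
  obtain f1 f2 f3 where f: "mul b2 b2 = comb b1 b2 b3 f1 f2 f3" by (rule frame_spans[OF F])
  obtain g1 g2 g3 where g: "mul b2 b3 = comb b1 b2 b3 g1 g2 g3" by (rule frame_spans[OF F])
  obtain h1 h2 h3 where h: "mul b3 b3 = comb b1 b2 b3 h1 h2 h3" by (rule frame_spans[OF F])
  note M = a c d f g h
  let ?b1 = "comb b1 b2 b3 1 0 0" and ?b2 = "comb b1 b2 b3 0 1 0" and ?b3 = "comb b1 b2 b3 0 0 1"
  note L = transposed_leibniz[of _ ?b1 ?b2] transposed_leibniz[of _ ?b1 ?b3] transposed_leibniz[of _ ?b2 ?b3]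
  note E = L[of ?b1] L[of ?b2] L[of ?b3]
  note E' = E[simplified mul_comb bracket_comb B M comb_simps frame_eq_iff[OF F], simplified]
  show thesis
    by (rule that[OF a c d f g h]) (use E' in \<open>auto simp: algebra_simps\<close>)
qed

text \<open>The excluded values \<open>0, 2, 1/2\<close> of \<open>s\<close> are those for which the product can map the
  plane of \<open>b1\<close> and \<open>b2\<close> to itself by a non-scalar operator: on this plane a half-derivation
  differs from a scalar by an operator \<open>\<psi>\<close> with \<open>2 \<psi> T = T \<psi>\<close>, where \<open>T = [-, b3]\<close>, and
  such a \<open>\<psi>\<close> maps \<open>\<lambda>\<close>-eigenvectors of \<open>T\<close> to \<open>2 \<lambda>\<close>-eigenvectors.\<close>

lemma solvable_mul_generic:
  assumes S: "solvable_table b1 b2 b3 1 q 0 s" and s: "s \<noteq> 0" "s \<noteq> 2" "2 * s \<noteq> 1" "q = 0 \<or> s = 1"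
  obtains \<beta> h1 h2 where
    "mul b1 b1 = comb b1 b2 b3 0 0 0" "mul b1 b2 = comb b1 b2 b3 0 0 0"
    "mul b1 b3 = comb b1 b2 b3 \<beta> 0 0" "mul b2 b2 = comb b1 b2 b3 0 0 0"
    "mul b2 b3 = comb b1 b2 b3 0 \<beta> 0" "mul b3 b3 = comb b1 b2 b3 h1 h2 \<beta>"
proof (rule solvable_mul[OF S])
  fix a1 a2 a3 c1 c2 c3 d1 d2 d3 f1 f2 f3 g1 g2 g3 h1 h2 h3
  assume M: "mul b1 b1 = comb b1 b2 b3 a1 a2 a3" "mul b1 b2 = comb b1 b2 b3 c1 c2 c3"
    "mul b1 b3 = comb b1 b2 b3 d1 d2 d3" "mul b2 b2 = comb b1 b2 b3 f1 f2 f3"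
    "mul b2 b3 = comb b1 b2 b3 g1 g2 g3" "mul b3 b3 = comb b1 b2 b3 h1 h2 h3"
  assume E: "c3 = 0" "a1 + 2 * (q * c1) = d3" "2 * a2 + 2 * (q * c2) = a1 * q + a2 * s + d3 * q"
    "a3 + q * c3 = 0" "2 * (s * c1) = c1" "c2 * s = c1 * q + d3 * s"
    "f3 = 0" "c1 + 2 * (q * f1) = g3" "2 * c2 + 2 * (q * f2) = c1 * q + c2 * s + g3 * q"
    "2 * (s * f1) = f1" "f2 * s = f1 * q + g3 * s"
    "g3 = 0" "d1 + 2 * (q * g1) = h3" "2 * d2 + 2 * (q * g2) = d1 * q + d2 * s + h3 * q"
    "d3 + q * g3 = 0" "2 * (s * g1) = g1" "g2 * s = g1 * q + h3 * s"
  have z: "x = 0" if "2 * (s * x) = x" for x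
  proof -
    have "(2 * s - 1) * x = 0" using that by (simp add: algebra_simps)
    then show ?thesis using s(3) by auto
  qed
  have z2: "x = 0" if "2 * x = x * s" for x
  proof -
    have "(2 - s) * x = 0" using that by (simp add: algebra_simps)
    then show ?thesis using s(2) by auto
  qed
  have 1: "c3 = 0" "f3 = 0" "g3 = 0" "c1 = 0" "f1 = 0" "g1 = 0" "a3 = 0" "d3 = 0"
    using E s(1) z by auto
  have 2: "c2 = 0" "f2 = 0" "g2 = h3" "d1 = h3" "a1 = 0"
    using E s(1) 1 by auto
  have "a2 = 0" "d2 = 0"
    using E s(4) 1 2 z2[of a2] z2[of d2] by auto
  with 1 2 show thesis
    using M that by auto
qed

lemma generic_cases:
  assumes S: "solvable_table b1 b2 b3 1 q 0 s"
    and M: "mul b1 b1 = comb b1 b2 b3 0 0 0" "mul b1 b2 = comb b1 b2 b3 0 0 0"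
      "mul b1 b3 = comb b1 b2 b3 \<beta> 0 0" "mul b2 b2 = comb b1 b2 b3 0 0 0"
      "mul b2 b3 = comb b1 b2 b3 0 \<beta> 0" "mul b3 b3 = comb b1 b2 b3 h1 h2 \<beta>"
  shows "q = 0 \<Longrightarrow> s = 1 \<Longrightarrow> \<exists>t\<in>listed. isomorphic_to t"
    and "q = 1 \<Longrightarrow> s = 1 \<Longrightarrow> \<exists>t\<in>listed. isomorphic_to t"
    and "q = 0 \<Longrightarrow> s \<noteq> 1 \<Longrightarrow> s \<noteq> 0 \<or> \<beta> \<noteq> 0 \<Longrightarrow> \<exists>t\<in>listed. isomorphic_to t"
proof -
  obtain b3 h1 h2 where S: "solvable_table b1 b2 b3 1 q 0 s"
    and M: "mul b1 b1 = comb b1 b2 b3 0 0 0" "mul b1 b2 = comb b1 b2 b3 0 0 0"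
      "mul b1 b3 = comb b1 b2 b3 \<beta> 0 0" "mul b2 b2 = comb b1 b2 b3 0 0 0"
      "mul b2 b3 = comb b1 b2 b3 0 \<beta> 0" "mul b3 b3 = comb b1 b2 b3 h1 h2 \<beta>"
    and h: "\<beta> = 0 \<or> h1 = 0 \<and> h2 = 0"
  proof (cases "\<beta> = 0")
    case True
    then show ?thesis using that[of b3 h1 h2] S M by simp
  next
    case False
    have F: "frame b1 b2 b3" and B: "bracket b1 b2 = comb b1 b2 b3 0 0 0"
      "bracket b1 b3 = comb b1 b2 b3 1 q 0" "bracket b2 b3 = comb b1 b2 b3 0 s 0"
      using S by (auto simp: solvable_table_def comb_zero)
    \<comment> \<open>With \<open>h\<close> the plane part of the square of \<open>b3\<close>,
      subtracting \<open>h / \<beta>\<close> from \<open>b3\<close> subtracts \<open>2 h\<close>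
      from the square, which becomes \<beta> times the new vector.\<close>
    let ?b1 = "comb b1 b2 b3 1 0 0" and ?b2 = "comb b1 b2 b3 0 1 0"
      and ?b3 = "comb b1 b2 b3 (- h1 / \<beta>) (- h2 / \<beta>) 1"
    have "frame ?b1 ?b2 ?b3"
      by (rule frame_change[OF F refl refl refl]) simp
    then have S': "solvable_table ?b1 ?b2 ?b3 1 q 0 s"
      by (auto simp: solvable_table_def change_simps B frame_eq_iff[OF F])
    have M': "mul ?b1 ?b1 = comb ?b1 ?b2 ?b3 0 0 0" "mul ?b1 ?b2 = comb ?b1 ?b2 ?b3 0 0 0"
      "mul ?b1 ?b3 = comb ?b1 ?b2 ?b3 \<beta> 0 0" "mul ?b2 ?b2 = comb ?b1 ?b2 ?b3 0 0 0"
      "mul ?b2 ?b3 = comb ?b1 ?b2 ?b3 0 \<beta> 0" "mul ?b3 ?b3 = comb ?b1 ?b2 ?b3 0 0 \<beta>"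
      using False by (simp_all add: change_simps M frame_eq_iff[OF F] field_simps)
    have u: "?b1 = b1" "?b2 = b2" by (simp_all add: comb_unit)
    show ?thesis
      using that[of ?b3 0 0] S' M' unfolding u by blast
  qed
  have F: "frame b1 b2 b3" and B: "bracket b1 b2 = comb b1 b2 b3 0 0 0"
    "bracket b1 b3 = comb b1 b2 b3 1 q 0" "bracket b2 b3 = comb b1 b2 b3 0 s 0"
    using S by (auto simp: solvable_table_def comb_zero)
  note simps = change_simps M B frame_eq_iff[OF F]
  {
    assume q: "q = 0" and s: "s = 1"
    show "\<exists>t\<in>listed. isomorphic_to t"
    proof (cases "h1 = 0 \<and> h2 = 0")
      case True
      have "isomorphic_to (T07 \<beta>)"
        by (rule isomorphic_changeI[OF F, of 1 0 0 0 1 0 0 0 1]) (simp_all add: simps q s True)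
      then show ?thesis by (force simp: listed_def)
    next
      case False
      then have "\<beta> = 0" using h by blast
      show ?thesis
      proof (cases "h1 = 0")
        case True
        have "isomorphic_to T08"
          by (rule isomorphic_changeI[OF F, of h1 h2 0 1 0 0 0 0 1])
            (use False True in \<open>simp_all add: simps q s \<open>\<beta> = 0\<close>\<close>)
        then show ?thesis by (force simp: listed_def)
      next
        case False
        have "isomorphic_to T08"
          by (rule isomorphic_changeI[OF F, of h1 h2 0 0 1 0 0 0 1])
            (use False in \<open>simp_all add: simps q s \<open>\<beta> = 0\<close>\<close>)
        then show ?thesis by (force simp: listed_def)
      qed
    qed
  }
  {
    assume q: "q = 1" and s: "s = 1"
    show "\<exists>t\<in>listed. isomorphic_to t"
    proof (cases "h1 = 0")
      case h1: True
      show ?thesis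
      proof (cases "h2 = 0")
        case True
        have "isomorphic_to (T09 1 \<beta>)"
          by (rule isomorphic_changeI[OF F, of 1 0 0 0 1 0 0 0 1]) (simp_all add: simps q s h1 True)
        then show ?thesis by (force simp: listed_def)
      next
        case False
        then have "\<beta> = 0" using h by blast
        have "isomorphic_to (T10 1)"
          by (rule isomorphic_changeI[OF F, of h2 0 0 0 h2 0 0 0 1])
            (use False in \<open>simp_all add: simps q s h1 \<open>\<beta> = 0\<close>\<close>)
        then show ?thesis by (force simp: listed_def)
      qed
    next
      case False
      then have "\<beta> = 0" using h by blast
      \<comment> \<open>The table dictates the basis: \<open>e1\<close> is the square of
        \<open>e3\<close>, and \<open>e2\<close> is \<open>[e1, e3] - e1\<close>.\<close>
      have "isomorphic_to (T11 1)"
        by (rule isomorphic_changeI[OF F, of h1 h2 0 0 h1 0 0 0 1])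
          (use False in \<open>simp_all add: simps q s \<open>\<beta> = 0\<close>\<close>)
      then show ?thesis by (force simp: listed_def)
    qed
  }
  {
    assume q: "q = 0" and s: "s \<noteq> 1" and s\<beta>: "s \<noteq> 0 \<or> \<beta> \<noteq> 0"
    then have s': "s - 1 \<noteq> 0" by simp
    show "\<exists>t\<in>listed. isomorphic_to t"
    proof (cases "h1 = 0")
      case h1: True
      show ?thesis
      proof (cases "h2 = 0")
        case True
        have "isomorphic_to (T09 s \<beta>)"
          by (rule isomorphic_changeI[OF F, of 1 "1 / (s - 1)" 0 0 1 0 0 0 1])
            (use s' in \<open>simp_all add: simps q h1 True field_simps\<close>)
        then show ?thesis by (force simp: listed_def)
      next
        case False
        then have "\<beta> = 0" using h by blast
        have "isomorphic_to (T10 s)"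
          by (rule isomorphic_changeI[OF F, of 1 "h2 / (s - 1)" 0 0 h2 0 0 0 1])
            (use False s' in \<open>simp_all add: simps q h1 \<open>\<beta> = 0\<close> field_simps\<close>)
        then show ?thesis by (force simp: listed_def)
      qed
    next
      case h1: False
      then have "\<beta> = 0" using h by blast
      show ?thesis
      proof (cases "h2 = 0")
        case True
        have "s \<noteq> 0" using s\<beta> \<open>\<beta> = 0\<close> by blast
        \<comment> \<open>The square of \<open>b3\<close> is an eigenvector for 1, while the table
          wants it for its parameter. Dividing \<open>b3\<close> by \<open>s\<close> changes the
          eigenvalues to 1 / s and 1, and the two eigenvectors exchange roles.\<close>
        have "isomorphic_to (T10 (1 / s))"
          by (rule isomorphic_changeI[OF F, of "h1 / (s * (1 - s))" 1 0 "h1 / (s * s)" 0 0 0 0 "1 / s"])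
            (use h1 s \<open>s \<noteq> 0\<close> in \<open>simp_all add: simps q True \<open>\<beta> = 0\<close>  field_simps\<close>)
        then show ?thesis by (force simp: listed_def)
      next
        case False
        have "isomorphic_to (T11 s)"
          by (rule isomorphic_changeI[OF F, of h1 h2 0 0 "h2 * (s - 1)" 0 0 0 1])
            (use h1 False s' in \<open>simp_all add: simps q \<open>\<beta> = 0\<close> field_simps\<close>)
        then show ?thesis by (force simp: listed_def)
      qed
    qed
  }
qed

end

section \<open>The exceptional eigenvalue ratios 2 and 0\<close>

context tpa3
begin

text \<open>As the eigenvalue 2 is twice the eigenvalue 1, a half-derivation may also send
  \<open>b1\<close> to \<open>b2\<close>. This leaves the extra coefficients \<open>a\<close> in
  \<open>mul b1 b1\<close> and \<open>b\<close> in \<open>mul b1 b3\<close>, tied to the others by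
  associativity.\<close>

lemma solvable_two:
  assumes S: "solvable_table b1 b2 b3 1 0 0 2"
  shows "\<exists>t\<in>listed. isomorphic_to t"
proof -
  have F: "frame b1 b2 b3" and B: "bracket b1 b2 = comb b1 b2 b3 0 0 0"
    "bracket b1 b3 = comb b1 b2 b3 1 0 0" "bracket b2 b3 = comb b1 b2 b3 0 2 0"
    using S by (auto simp: solvable_table_def comb_zero)
  obtain a b p q \<beta> where M: "mul b1 b1 = comb b1 b2 b3 0 a 0" "mul b1 b2 = comb b1 b2 b3 0 0 0"
    "mul b1 b3 = comb b1 b2 b3 \<beta> b 0" "mul b2 b2 = comb b1 b2 b3 0 0 0"
    "mul b2 b3 = comb b1 b2 b3 0 \<beta> 0" "mul b3 b3 = comb b1 b2 b3 p q \<beta>"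
  proof (rule solvable_mul[OF S])
    fix a1 a2 a3 c1 c2 c3 d1 d2 d3 f1 f2 f3 g1 g2 g3 h1 h2 h3 :: complex
    assume "mul b1 b1 = comb b1 b2 b3 a1 a2 a3" "mul b1 b2 = comb b1 b2 b3 c1 c2 c3"
      "mul b1 b3 = comb b1 b2 b3 d1 d2 d3" "mul b2 b2 = comb b1 b2 b3 f1 f2 f3"
      "mul b2 b3 = comb b1 b2 b3 g1 g2 g3" "mul b3 b3 = comb b1 b2 b3 h1 h2 h3"
      "c3 = 0" "a1 + 2 * (0 * c1) = d3" "a3 + 0 * c3 = 0" "2 * (2 * c1) = c1" "c2 * 2 = c1 * 0 + d3 * 2"
      "f3 = 0" "c1 + 2 * (0 * f1) = g3" "2 * (2 * f1) = f1" "f2 * 2 = f1 * 0 + g3 * 2"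
      "g3 = 0" "d1 + 2 * (0 * g1) = h3" "d3 + 0 * g3 = 0" "2 * (2 * g1) = g1" "g2 * 2 = g1 * 0 + h3 * 2"
    then show thesis
      using that[of a2 h3 d2 h1 h2] by simp
  qed
  have "mul (mul b3 b3) b1 = mul b3 (mul b3 b1)" by (rule mul_assoc)
  then have "mul (comb b1 b2 b3 p q \<beta>) (comb b1 b2 b3 1 0 0) = mul (comb b1 b2 b3 0 0 1) (comb b1 b2 b3 \<beta> b 0)"
    by (simp only: comb_unit M mul_comm[of b3 b1])
  then have pa: "p * a = b * \<beta>"
    by (simp add: mul_comb M comb_simps frame_eq_iff[OF F] algebra_simps)
  note simps = change_simps M B frame_eq_iff[OF F]
  show ?thesis
  proof (cases "a = 0")
    case False
    \<comment> \<open>The shift \<open>b3 - (b / a) b1\<close> clears \<open>b\<close>, and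
      \<open>k\<close> is the coefficient of \<open>b2\<close> that remains in its square. A nonzero
      \<open>k\<close> is absorbed by a further shift along \<open>b2\<close> if \<beta> is nonzero,
      and scaled to 1 otherwise.\<close>
    define k where "k = q - b * b / a"
    have p: "p = b * \<beta> / a" using pa False by (simp add: field_simps)
    show ?thesis
    proof (cases "\<beta> = 0 \<and> k \<noteq> 0")
      case True
      define x where "x = csqrt (k / a)"
      have x: "x * x * a = k" "x \<noteq> 0"
        using True False by (auto simp: x_def simp flip: power2_eq_square)
      have q: "q = x * x * a + b * b / a" using x by (simp add: k_def)
      have "isomorphic_to T13"
        by (rule isomorphic_changeI[OF F, of x "x * x * a" 0 0 "x * x * a" 0 "- b / a" 0 1])
          (use False True x(2) in \<open>simp_all add: simps p q field_simps\<close>)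
      then show ?thesis by (force simp: listed_def)
    next
      case k: False
      define v where "v = (if \<beta> = 0 then 0 else - k / \<beta>)"
      have v: "k = - \<beta> * v" using k by (auto simp: v_def)
      have q: "q = b * b / a - \<beta> * v" using v by (simp add: k_def algebra_simps)
      have "isomorphic_to (T12 \<beta>)"
        by (rule isomorphic_changeI[OF F, of 1 a 0 0 a 0 "- b / a" v 1])
          (use False in \<open>simp_all add: simps p q field_simps\<close>)
      then show ?thesis by (force simp: listed_def)
    qed
  next
    case a: True
    show ?thesis
    proof (cases "b = 0")
      case True
      show ?thesis
        by (rule generic_cases(3)[OF S]) (use M a True in auto)
    next
      case False
      then have \<beta>: "\<beta> = 0" using pa a by simp
      show ?thesis
      proof (cases "p = 0")
        case True
        \<comment> \<open>A shift of \<open>b3\<close> by \<open>t b1\<close> changes the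
          coefficient \<open>q\<close> by \<open>2 * t * b\<close>. Here it clears \<open>q\<close>;
          for \<open>T14\<close> it makes the square of \<open>e3\<close> equal to
          \<open>e1\<close>.\<close>
        have "isomorphic_to T15"
          by (rule isomorphic_changeI[OF F, of 1 b 0 0 b 0 "- q / (2 * b)" 0 1])
            (use False True in \<open>simp_all add: simps \<beta> a field_simps\<close>)
        then show ?thesis by (force simp: listed_def)
      next
        case p: False
        have "isomorphic_to T14"
          by (rule isomorphic_changeI[OF F, of p "p * b" 0 0 "p * b" 0 "(p * b - q) / (2 * b)" 0 1])
            (use False p in \<open>simp_all add: simps \<beta> a field_simps\<close>)
        then show ?thesis by (force simp: listed_def)
      qed
    qed
  qed
qed

text \<open>Twice the eigenvalue 0 is again 0, so a half-derivation may act on the line of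
  \<open>b2\<close> by a scalar of its own. The extra coefficients are \<sigma> in
  \<open>mul b2 b2\<close> and \<tau> in \<open>mul b2 b3\<close>; for \<sigma> nonzero,
  \<open>b2 / \<sigma>\<close> is an idempotent.\<close>

lemma solvable_zero:
  assumes S: "solvable_table b1 b2 b3 1 0 0 0"
  shows "\<exists>t\<in>listed. isomorphic_to t"
proof -
  have F: "frame b1 b2 b3" and B: "bracket b1 b2 = comb b1 b2 b3 0 0 0"
    "bracket b1 b3 = comb b1 b2 b3 1 0 0" "bracket b2 b3 = comb b1 b2 b3 0 0 0"
    using S by (auto simp: solvable_table_def comb_zero)
  obtain \<sigma> \<tau> p q \<beta> where M: "mul b1 b1 = comb b1 b2 b3 0 0 0" "mul b1 b2 = comb b1 b2 b3 0 0 0"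
    "mul b1 b3 = comb b1 b2 b3 \<beta> 0 0" "mul b2 b2 = comb b1 b2 b3 0 \<sigma> 0"
    "mul b2 b3 = comb b1 b2 b3 0 \<tau> 0" "mul b3 b3 = comb b1 b2 b3 p q \<beta>"
  proof (rule solvable_mul[OF S])
    fix a1 a2 a3 c1 c2 c3 d1 d2 d3 f1 f2 f3 g1 g2 g3 h1 h2 h3 :: complex
    assume "mul b1 b1 = comb b1 b2 b3 a1 a2 a3" "mul b1 b2 = comb b1 b2 b3 c1 c2 c3"
      "mul b1 b3 = comb b1 b2 b3 d1 d2 d3" "mul b2 b2 = comb b1 b2 b3 f1 f2 f3"
      "mul b2 b3 = comb b1 b2 b3 g1 g2 g3" "mul b3 b3 = comb b1 b2 b3 h1 h2 h3"
      "c3 = 0" "a1 + 2 * (0 * c1) = d3" "2 * a2 + 2 * (0 * c2) = a1 * 0 + a2 * 0 + d3 * 0"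
      "a3 + 0 * c3 = 0" "2 * (0 * c1) = c1"
      "f3 = 0" "2 * c2 + 2 * (0 * f2) = c1 * 0 + c2 * 0 + g3 * 0" "2 * (0 * f1) = f1"
      "g3 = 0" "d1 + 2 * (0 * g1) = h3" "2 * d2 + 2 * (0 * g2) = d1 * 0 + d2 * 0 + h3 * 0"
      "d3 + 0 * g3 = 0" "2 * (0 * g1) = g1"
    then show thesis
      using that[of h3 f2 g2 h1 h2] by simp
  qed
  have "mul (mul b3 b3) b2 = mul b3 (mul b3 b2)" by (rule mul_assoc)
  then have "mul (comb b1 b2 b3 p q \<beta>) (comb b1 b2 b3 0 1 0) = mul (comb b1 b2 b3 0 0 1) (comb b1 b2 b3 0 \<tau> 0)"
    by (simp only: comb_unit M mul_comm[of b3 b2])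
  then have \<tau>: "q * \<sigma> = \<tau> * \<tau> - \<beta> * \<tau>"
    by (simp add: mul_comb M comb_simps frame_eq_iff[OF F] algebra_simps)
  note simps = change_simps M B frame_eq_iff[OF F]
  show ?thesis
  proof (cases "\<sigma> = 0")
    case False
    have q: "q = (\<tau> * \<tau> - \<beta> * \<tau>) / \<sigma>" using \<tau> False by (simp add: field_simps)
    show ?thesis
    proof (cases "\<beta> = 0 \<and> p \<noteq> 0")
      case True
      have "isomorphic_to T18"
        by (rule isomorphic_changeI[OF F, of p "- 1 / \<sigma>" 0 0 "1 / \<sigma>" 0 0 "- \<tau> / \<sigma>" 1])
          (use False True in \<open>simp_all add: simps q field_simps\<close>)
      then show ?thesis by (force simp: listed_def)
    next
      case p: False
      define u where "u = (if \<beta> = 0 then 0 else - p / \<beta>)"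
      have p: "p = - \<beta> * u" using p by (auto simp: u_def)
      \<comment> \<open>The shift along \<open>b1\<close> absorbs \<open>p\<close>, and the one
        along \<open>b2\<close> makes multiplication by \<open>e3\<close> act on the idempotent
        \<open>e2\<close> by \<beta>.\<close>
      have "isomorphic_to (T17 \<beta>)"
        by (rule isomorphic_changeI[OF F, of 1 "- 1 / \<sigma>" 0 0 "1 / \<sigma>" 0 u "(\<beta> - \<tau>) / \<sigma>" 1])
          (use False in \<open>simp_all add: simps p q field_simps\<close>)
      then show ?thesis by (force simp: listed_def)
    qed
  next
    case \<sigma>: True
    then have "\<tau> * (\<tau> - \<beta>) = 0" using \<tau> by algebra
    then have "\<tau> = 0 \<or> \<tau> = \<beta>" unfolding mult_eq_0_iff right_minus_eq .
    then consider "\<tau> = \<beta>" "\<beta> \<noteq> 0" | "\<tau> = 0" "\<beta> \<noteq> 0" | "\<tau> = 0" "\<beta> = 0" by blast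
    then show ?thesis
    proof cases
      case 1
      show ?thesis
        by (rule generic_cases(3)[OF S]) (use M \<sigma> 1 in auto)
    next
      case 2
      \<comment> \<open>\<open>b2\<close> annihilates the whole algebra, so adding a multiple of it
        to \<open>b3\<close> leaves the square unchanged; the coefficient \<open>q / \<beta>\<close>
        makes the square \<beta> times the new vector.\<close>
      have "isomorphic_to (T19 \<beta>)"
        by (rule isomorphic_changeI[OF F, of 1 "- 1" 0 0 1 0 "- p / \<beta>" "q / \<beta>" 1])
          (use 2 in \<open>simp_all add: simps \<sigma> field_simps\<close>)
      then show ?thesis using 2 by (force simp: listed_def)
    next
      case 3
      consider "p = 0" "q = 0" | "p \<noteq> 0" "q = 0" | "p = 0" "q \<noteq> 0" | "p \<noteq> 0" "q \<noteq> 0" by blast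
      then show ?thesis
      proof cases
        case 1
        have "isomorphic_to (T09 0 0)"
          by (rule isomorphic_changeI[OF F, of 1 "- 1" 0 0 1 0 0 0 1])
            (use 1 3 in \<open>simp_all add: simps \<sigma>\<close>)
        then show ?thesis by (force simp: listed_def)
      next
        case 2
        have "isomorphic_to T16"
          by (rule isomorphic_changeI[OF F, of p "- 1" 0 0 1 0 0 0 1])
            (use 2 3 in \<open>simp_all add: simps \<sigma>\<close>)
        then show ?thesis by (force simp: listed_def)
      next
        case p: 3
        have "isomorphic_to (T10 0)"
          by (rule isomorphic_changeI[OF F, of 1 "- q" 0 0 q 0 0 0 1])
            (use p 3 in \<open>simp_all add: simps \<sigma>\<close>)
        then show ?thesis by (force simp: listed_def)
      next
        case 4
        have "isomorphic_to (T11 0)"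
          by (rule isomorphic_changeI[OF F, of p q 0 0 "- q" 0 0 0 1])
            (use 4 3 in \<open>simp_all add: simps \<sigma>\<close>)
        then show ?thesis by (force simp: listed_def)
      qed
    qed
  qed
qed

theorem solvable_classification:
  assumes "solvable_table b1 b2 b3 1 q 0 s" "q = 0 \<or> q = 1 \<and> s = 1"
  shows "\<exists>t\<in>listed. isomorphic_to t"
proof -
  consider "s = 0" | "s = 2" | "2 * s = 1" | "s \<noteq> 0" "s \<noteq> 2" "2 * s \<noteq> 1" by blast
  then show ?thesis
  proof cases
    case 1
    then show ?thesis using assms solvable_zero by auto
  next
    case 2
    then show ?thesis using assms solvable_two by auto
  next
    case 3
    then have s: "s = 1 / 2" "q = 0" using assms(2) by (auto simp: field_simps)
    \<comment> \<open>Exchanging the eigenvectors and doubling \<open>b3\<close> turns the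
      eigenvalues 1 and 1/2 into 1 and 2.\<close>
    have "solvable_table (comb b1 b2 b3 0 1 0) (comb b1 b2 b3 1 0 0) (comb b1 b2 b3 0 0 2) 1 0 0 2"
      by (rule solvable_table_change[OF assms(1)]) (simp_all add: s)
    then show ?thesis by (rule solvable_two)
  next
    case 4
    obtain \<beta> h1 h2 where M:
      "mul b1 b1 = comb b1 b2 b3 0 0 0" "mul b1 b2 = comb b1 b2 b3 0 0 0"
      "mul b1 b3 = comb b1 b2 b3 \<beta> 0 0" "mul b2 b2 = comb b1 b2 b3 0 0 0"
      "mul b2 b3 = comb b1 b2 b3 0 \<beta> 0" "mul b3 b3 = comb b1 b2 b3 h1 h2 \<beta>"
      by (rule solvable_mul_generic[OF assms(1) 4]) (use assms(2) in auto)
    note G = generic_cases[OF assms(1) M]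
    show ?thesis using G assms(2) 4(1) by blast
  qed
qed

end

section \<open>Products on simple and Heisenberg Lie algebras\<close>

context tpa3
begin

text \<open>The half-derivations of this algebra are the scalars, so the product of \<open>x\<close>
  and \<open>y\<close> is a multiple of \<open>y\<close> by a scalar depending on \<open>x\<close>,
  and symmetrically; for independent \<open>x\<close> and \<open>y\<close> both scalars must vanish.
  The linear system is solved directly.\<close>

theorem simple_classification:
  assumes "simple_table b1 b2 b3 1 0 0 1 0 1"
  shows "isomorphic_to T01"
proof -
  have F: "frame b1 b2 b3" and B: "bracket b1 b2 = comb b1 b2 b3 0 0 1"
    "bracket b1 b3 = comb b1 b2 b3 0 (- 1) 0" "bracket b2 b3 = comb b1 b2 b3 1 0 0"
    using assms by (auto simp: simple_table_def)
  obtain a1 a2 a3 where a: "mul b1 b1 = comb b1 b2 b3 a1 a2 a3" by (rule frame_spans[OF F])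
  obtain c1 c2 c3 where c: "mul b1 b2 = comb b1 b2 b3 c1 c2 c3" by (rule frame_spans[OF F])
  obtain d1 d2 d3 where d: "mul b1 b3 = comb b1 b2 b3 d1 d2 d3" by (rule frame_spans[OF F])
  obtain f1 f2 f3 where f: "mul b2 b2 = comb b1 b2 b3 f1 f2 f3" by (rule frame_spans[OF F])
  obtain g1 g2 g3 where g: "mul b2 b3 = comb b1 b2 b3 g1 g2 g3" by (rule frame_spans[OF F])
  obtain h1 h2 h3 where h: "mul b3 b3 = comb b1 b2 b3 h1 h2 h3" by (rule frame_spans[OF F])
  note M = a c d f g h
  let ?b1 = "comb b1 b2 b3 1 0 0" and ?b2 = "comb b1 b2 b3 0 1 0" and ?b3 = "comb b1 b2 b3 0 0 1"
  note L = transposed_leibniz[of _ ?b1 ?b2] transposed_leibniz[of _ ?b1 ?b3] transposed_leibniz[of _ ?b2 ?b3]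
  note E = L[of ?b1] L[of ?b2] L[of ?b3]
  note E' = E[simplified mul_comb bracket_comb B M comb_simps frame_eq_iff[OF F], simplified]
  have "a1 = 0 \<and> a2 = 0 \<and> a3 = 0 \<and> c1 = 0 \<and> c2 = 0 \<and> c3 = 0 \<and> d1 = 0 \<and> d2 = 0 \<and> d3 = 0 \<and>
    f1 = 0 \<and> f2 = 0 \<and> f3 = 0 \<and> g1 = 0 \<and> g2 = 0 \<and> g3 = 0 \<and> h1 = 0 \<and> h2 = 0 \<and> h3 = 0"
    using E' by (elim conjE; intro conjI; algebra)
  then show ?thesis
    by (intro isomorphic_changeI[OF F, of 1 0 0 0 1 0 0 0 1])
      (simp_all add: change_simps M B frame_eq_iff[OF F])
qed

lemma heisenberg_table_change:
  assumes "heisenberg_table b1 b2 b3" "x1 * y2 - x2 * y1 \<noteq> 0"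
  shows "heisenberg_table (comb b1 b2 b3 x1 x2 x3) (comb b1 b2 b3 y1 y2 y3) (comb b1 b2 b3 0 0 (x1 * y2 - x2 * y1))"
proof -
  have F: "frame b1 b2 b3" and B: "bracket b1 b2 = comb b1 b2 b3 0 0 1"
    "bracket b1 b3 = comb b1 b2 b3 0 0 0" "bracket b2 b3 = comb b1 b2 b3 0 0 0"
    using assms(1) by (auto simp: heisenberg_table_def comb_unit comb_zero)
  have "frame (comb b1 b2 b3 x1 x2 x3) (comb b1 b2 b3 y1 y2 y3) (comb b1 b2 b3 0 0 (x1 * y2 - x2 * y1))"
    by (rule frame_change[OF F refl refl refl])
      (use assms(2) in \<open>simp add: mult.commute[of y2] flip: left_diff_distrib right_diff_distrib\<close>)
  then show ?thesis
    by (simp add: heisenberg_table_def bracket_comb B comb_simps frame_eq_iff[OF F])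
qed

text \<open>A half-derivation of the Heisenberg algebra preserves the centre, and its scalar there
  is half the trace of the map induced on the quotient; hence the two trace equations. The other
  equations express associativity.\<close>

lemma heisenberg_mul:
  assumes H: "heisenberg_table b1 b2 b3"
  obtains a1 a2 a3 c1 c2 c3 f1 f2 f3 x y where
    "mul b1 b1 = comb b1 b2 b3 a1 a2 a3" "mul b1 b2 = comb b1 b2 b3 c1 c2 c3"
    "mul b1 b3 = comb b1 b2 b3 0 0 x" "mul b2 b2 = comb b1 b2 b3 f1 f2 f3"
    "mul b2 b3 = comb b1 b2 b3 0 0 y" "mul b3 b3 = comb b1 b2 b3 0 0 0"
    "a1 + c2 = 2 * x" "c1 + f2 = 2 * y"
    "a1 * x + a2 * y = x * x" "c1 * x + c2 * y = x * y" "f1 * x + f2 * y = y * y"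
    "a1 * c1 + a2 * f1 = c1 * a1 + c2 * c1" "a1 * c2 + a2 * f2 = c1 * a2 + c2 * c2"
    "a1 * c3 + a2 * f3 + a3 * y = c1 * a3 + c2 * c3 + c3 * x"
    "c1 * c1 + c2 * f1 = f1 * a1 + f2 * c1" "c1 * c2 + c2 * f2 = f1 * a2 + f2 * c2"
    "c1 * c3 + c2 * f3 + c3 * y = f1 * a3 + f2 * c3 + f3 * x"
proof -
  have F: "frame b1 b2 b3" and B: "bracket b1 b2 = comb b1 b2 b3 0 0 1"
    "bracket b1 b3 = comb b1 b2 b3 0 0 0" "bracket b2 b3 = comb b1 b2 b3 0 0 0"
    using H by (auto simp: heisenberg_table_def comb_unit comb_zero)
  obtain a1 a2 a3 where a: "mul b1 b1 = comb b1 b2 b3 a1 a2 a3" by (rule frame_spans[OF F])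
  obtain c1 c2 c3 where c: "mul b1 b2 = comb b1 b2 b3 c1 c2 c3" by (rule frame_spans[OF F])
  obtain d1 d2 d3 where d: "mul b1 b3 = comb b1 b2 b3 d1 d2 d3" by (rule frame_spans[OF F])
  obtain f1 f2 f3 where f: "mul b2 b2 = comb b1 b2 b3 f1 f2 f3" by (rule frame_spans[OF F])
  obtain g1 g2 g3 where g: "mul b2 b3 = comb b1 b2 b3 g1 g2 g3" by (rule frame_spans[OF F])
  obtain h1 h2 h3 where h: "mul b3 b3 = comb b1 b2 b3 h1 h2 h3" by (rule frame_spans[OF F])
  note M = a c d f g h
  let ?b1 = "comb b1 b2 b3 1 0 0" and ?b2 = "comb b1 b2 b3 0 1 0" and ?b3 = "comb b1 b2 b3 0 0 1"
  note L = transposed_leibniz[of _ ?b1 ?b2] transposed_leibniz[of _ ?b1 ?b3] transposed_leibniz[of _ ?b2 ?b3]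
  note E = L[of ?b1] L[of ?b2] L[of ?b3]
  note E' = E[simplified mul_comb bracket_comb B M comb_simps frame_eq_iff[OF F], simplified]
  have z: "d1 = 0" "d2 = 0" "g1 = 0" "g2 = 0" "h1 = 0" "h2 = 0" "h3 = 0"
    and t: "a1 + c2 = 2 * d3" "c1 + f2 = 2 * g3"
    using E' by auto
  note A = mul_assoc[of ?b1 ?b1 ?b2] mul_assoc[of ?b1 ?b2 ?b2] mul_assoc[of ?b1 ?b1 ?b3]
    mul_assoc[of ?b1 ?b2 ?b3] mul_assoc[of ?b2 ?b2 ?b3]
  note A' = A[simplified mul_comb M comb_simps frame_eq_iff[OF F] z, simplified]
  show thesis
    by (rule that[OF a c _ f]) (use M z t A' in auto)
qed

text \<open>When \<open>b2\<close> acts on the centre as the identity and \<open>b1\<close> as zero,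
  the trace equations and associativity make \<open>b2\<close> an identity element up to corrections
  along \<open>b1\<close> and \<open>b3\<close>. It remains to ask whether \<open>mul b1 b1\<close>
  vanishes.\<close>

lemma heisenberg_unital:
  assumes H: "heisenberg_table b1 b2 b3" and "mul b2 b3 = b3" "mul b1 b3 = 0"
  shows "\<exists>t\<in>listed. isomorphic_to t"
proof -
  have F: "frame b1 b2 b3" and B: "bracket b1 b2 = comb b1 b2 b3 0 0 1"
    "bracket b1 b3 = comb b1 b2 b3 0 0 0" "bracket b2 b3 = comb b1 b2 b3 0 0 0"
    using H by (auto simp: heisenberg_table_def comb_unit comb_zero)
  obtain a f1 f3 where M: "mul b1 b1 = comb b1 b2 b3 0 0 a" "mul b1 b2 = comb b1 b2 b3 1 0 (f1 * a)"
    "mul b1 b3 = comb b1 b2 b3 0 0 0" "mul b2 b2 = comb b1 b2 b3 f1 1 f3"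
    "mul b2 b3 = comb b1 b2 b3 0 0 1" "mul b3 b3 = comb b1 b2 b3 0 0 0"
  proof (rule heisenberg_mul[OF H])
    fix a1 a2 a3 c1 c2 c3 f1 f2 f3 x y :: complex
    assume M: "mul b1 b1 = comb b1 b2 b3 a1 a2 a3" "mul b1 b2 = comb b1 b2 b3 c1 c2 c3"
      "mul b1 b3 = comb b1 b2 b3 0 0 x" "mul b2 b2 = comb b1 b2 b3 f1 f2 f3"
      "mul b2 b3 = comb b1 b2 b3 0 0 y" "mul b3 b3 = comb b1 b2 b3 0 0 0"
    assume E: "a1 + c2 = 2 * x" "c1 + f2 = 2 * y"
      "a1 * x + a2 * y = x * x" "c1 * x + c2 * y = x * y" "f1 * x + f2 * y = y * y"
      "c1 * c3 + c2 * f3 + c3 * y = f1 * a3 + f2 * c3 + f3 * x"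
    have xy: "x = 0" "y = 1"
      using assms(2,3) M frame_eq_iff[OF F] comb_unit(3)[of b1 b2 b3] comb_zero[of b1 b2 b3] by metis+
    then have "a2 = 0" "c2 = 0" "f2 = 1" "a1 = 0" "c1 = 1" "c3 = f1 * a3"
      using E by auto
    then show thesis using that[of a3 f1 f3] M xy by simp
  qed
  note simps = change_simps M B frame_eq_iff[OF F]
  show ?thesis
  proof (cases "a = 0")
    case True
    have "isomorphic_to T06"
      by (rule isomorphic_changeI[OF F, of 1 0 0 "- f1" 1 "- f3" 0 0 1])
        (simp_all add: simps True)
    then show ?thesis by (force simp: listed_def)
  next
    case False
    have "isomorphic_to T05"
      by (rule isomorphic_changeI[OF F, of "1 / a" 0 0 "- f1" 1 "f1 * f1 * a - f3" 0 0 "1 / a"])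
        (use False in \<open>simp_all add: simps field_simps\<close>)
    then show ?thesis by (force simp: listed_def)
  qed
qed

text \<open>The table is generated by one vector: \<open>e2 = b2\<close>, \<open>e1\<close> is its
  square, and \<open>e3 = [e1, e2]\<close>, which is \<open>f1\<close> times \<open>b3\<close>. The
  parameter is the coefficient of \<open>e3\<close> in the product of \<open>e1\<close> and
  \<open>e2\<close>.\<close>

lemma heisenberg_square:
  assumes H: "heisenberg_table b1 b2 b3" and M: "mul b1 b1 = comb b1 b2 b3 a1 a2 a3"
      "mul b1 b2 = comb b1 b2 b3 c1 (- a1) c3"
      "mul b1 b3 = comb b1 b2 b3 0 0 0" "mul b2 b2 = comb b1 b2 b3 f1 (- c1) f3"
      "mul b2 b3 = comb b1 b2 b3 0 0 0" "mul b3 b3 = comb b1 b2 b3 0 0 0"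
    and E: "a2 * f1 = - a1 * c1" "a1 * a1 = - a2 * c1" "c1 * c1 = a1 * f1" 
      "f1 * a3 = 2 * c1 * c3 - a1 * f3"
    and f1: "f1 \<noteq> 0"
  shows "isomorphic_to (T04 ((f1 * c3 - c1 * f3) / f1))"
proof -
  have F: "frame b1 b2 b3" and B: "bracket b1 b2 = comb b1 b2 b3 0 0 1"
    "bracket b1 b3 = comb b1 b2 b3 0 0 0" "bracket b2 b3 = comb b1 b2 b3 0 0 0"
    using H by (auto simp: heisenberg_table_def comb_unit comb_zero)
  have a: "a1 = c1 * c1 / f1" "a2 = - c1 * c1 * c1 / (f1 * f1)" "a3 = (2 * c1 * c3 - a1 * f3) / f1"
    using E f1 by (auto simp: field_simps)
  show ?thesis
    by (rule isomorphic_changeI[OF F, of f1 "- c1" f3 0 1 0 0 0 f1])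
      (use f1 in \<open>simp_all add: change_simps M B frame_eq_iff[OF F] a field_simps\<close>)
qed

text \<open>The product is a quadratic form on the quotient by the centre. Two isotropic lines lead
  to \<open>T03\<close>, a double one to \<open>T02\<close>, and the zero form to
  \<open>T03 0\<close>.\<close>

lemma heisenberg_form:
  assumes H: "heisenberg_table b1 b2 b3" and M: "mul b1 b1 = comb b1 b2 b3 0 0 a"
      "mul b1 b2 = comb b1 b2 b3 0 0 c" "mul b2 b2 = comb b1 b2 b3 0 0 f"
      "mul b1 b3 = comb b1 b2 b3 0 0 0" 
      "mul b2 b3 = comb b1 b2 b3 0 0 0" "mul b3 b3 = comb b1 b2 b3 0 0 0"
  shows "\<exists>t\<in>listed. isomorphic_to t"
proof -
  have F: "frame b1 b2 b3" and B: "bracket b1 b2 = comb b1 b2 b3 0 0 1"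
    "bracket b1 b3 = comb b1 b2 b3 0 0 0" "bracket b2 b3 = comb b1 b2 b3 0 0 0"
    using H by (auto simp: heisenberg_table_def comb_unit comb_zero)
  note simps = change_simps M B frame_eq_iff[OF F]
  define D where "D = csqrt (c * c - a * f)"
  have D: "D * D = c * c - a * f" by (simp add: D_def flip: power2_eq_square)
  consider "a = 0" "f = 0 \<or> c \<noteq> 0" | "a = 0" "c = 0" "f \<noteq> 0" | "a \<noteq> 0" "D = 0" | "a \<noteq> 0" "D \<noteq> 0" by blast
  then show ?thesis
  proof cases
    case 1
    have "isomorphic_to (T03 c)"
      by (rule isomorphic_changeI[OF F, of 1 0 0 "- f / (2 * c)" 1 0 0 0 1])
        (use 1 in \<open>auto simp: simps field_simps\<close>)
    then show ?thesis by (force simp: listed_def)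
  next
    case 2
    have "isomorphic_to T02"
      by (rule isomorphic_changeI[OF F, of f 0 0 0 1 0 0 0 f])
        (use 2 in \<open>simp_all add: simps\<close>)
    then show ?thesis by (force simp: listed_def)
  next
    case 3
    then have f: "f = c * c / a" using D by (simp add: field_simps)
    \<comment> \<open>\<open>c b1 - a b2\<close> spans the radical of the degenerate form.\<close>
    have "isomorphic_to T02"
      by (rule isomorphic_changeI[OF F, of c "- a" 0 1 0 0 0 0 a])
        (use 3 in \<open>simp_all add: simps f field_simps\<close>)
    then show ?thesis by (force simp: listed_def)
  next
    case 4
    have f: "f = (c * c - D * D) / a" using D 4 by (simp add: field_simps)
    \<comment> \<open>The roots of a t^2 + 2 c t + f, so that \<open>u b1 + b2\<close> and
      \<open>v b1 + b2\<close> are isotropic.\<close>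
    let ?u = "(- c + D) / a" and ?v = "(- c - D) / a"
    have "isomorphic_to (T03 (- D))"
      by (rule isomorphic_changeI[OF F, of ?u 1 0 ?v 1 0 0 0 "2 * D / a"])
        (use 4 in \<open>simp_all add: simps f field_simps\<close>)
    then show ?thesis by (force simp: listed_def)
  qed
qed

theorem heisenberg_classification:
  assumes H: "heisenberg_table b1 b2 b3"
  shows "\<exists>t\<in>listed. isomorphic_to t"
proof (rule heisenberg_mul[OF H])
  fix a1 a2 a3 c1 c2 c3 f1 f2 f3 x y :: complex
  assume M: "mul b1 b1 = comb b1 b2 b3 a1 a2 a3" "mul b1 b2 = comb b1 b2 b3 c1 c2 c3"
    "mul b1 b3 = comb b1 b2 b3 0 0 x" "mul b2 b2 = comb b1 b2 b3 f1 f2 f3"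
    "mul b2 b3 = comb b1 b2 b3 0 0 y" "mul b3 b3 = comb b1 b2 b3 0 0 0"
  assume E: "a1 + c2 = 2 * x" "c1 + f2 = 2 * y"
    "a1 * c1 + a2 * f1 = c1 * a1 + c2 * c1" "a1 * c2 + a2 * f2 = c1 * a2 + c2 * c2"
    "a1 * c3 + a2 * f3 + a3 * y = c1 * a3 + c2 * c3 + c3 * x"
    "c1 * c1 + c2 * f1 = f1 * a1 + f2 * c1" "c1 * c2 + c2 * f2 = f1 * a2 + f2 * c2"
    "c1 * c3 + c2 * f3 + c3 * y = f1 * a3 + f2 * c3 + f3 * x"
  have F: "frame b1 b2 b3" and B: "bracket b1 b2 = comb b1 b2 b3 0 0 1"
    using H by (auto simp: heisenberg_table_def comb_unit)
  consider "x \<noteq> 0" | "x = 0" "y \<noteq> 0" | "x = 0" "y = 0" by blast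
  then show ?thesis
  proof cases
    case 1
    \<comment> \<open>\<open>(x, y)\<close> is a linear form on the quotient by the centre;
      \<open>c1\<close> spans its kernel there, and \<open>c2\<close> has value 1.\<close>
    let ?c1 = "comb b1 b2 b3 y (- x) 0" and ?c2 = "comb b1 b2 b3 (1 / x) 0 0" and ?c3 = "comb b1 b2 b3 0 0 1"
    have "heisenberg_table ?c1 ?c2 ?c3"
      using heisenberg_table_change[OF H, of y 0 "- x" "1 / x" 0 0] 1 by simp
    moreover have "mul ?c2 ?c3 = ?c3" "mul ?c1 ?c3 = 0"
      using 1 by (simp_all add: mul_comb M comb_simps frame_eq_iff[OF F])
    ultimately show ?thesis by (rule heisenberg_unital)
  next
    case 2
    let ?c1 = "comb b1 b2 b3 1 0 0" and ?c2 = "comb b1 b2 b3 0 (1 / y) 0" and ?c3 = "comb b1 b2 b3 0 0 (1 / y)"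
    have "heisenberg_table ?c1 ?c2 ?c3"
      using heisenberg_table_change[OF H, of 1 "1 / y" 0 0 0 0] 2 by simp
    moreover have "mul ?c2 ?c3 = ?c3" "mul ?c1 ?c3 = 0"
      using 2 by (simp_all add: mul_comb M comb_simps frame_eq_iff[OF F])
    ultimately show ?thesis by (rule heisenberg_unital)
  next
    case 3
    then have c: "c2 = - a1" "f2 = - c1" using E(1,2) by (simp_all add: add_eq_0_iff)
    have E': "a2 * f1 = - a1 * c1" "a1 * a1 = - a2 * c1" "c1 * c1 = a1 * f1"
      "f1 * a3 = 2 * c1 * c3 - a1 * f3" "a2 * f3 = c1 * a3 - 2 * a1 * c3"
      using E(3-) unfolding c 3 by algebra+
    show ?thesis
    proof (cases "f1 = 0")
      case False
      have "isomorphic_to (T04 ((f1 * c3 - c1 * f3) / f1))"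
        by (rule heisenberg_square[OF H M(1) _ _ _ _ _ E'(1-4) False]) (use M c 3 in auto)
      then show ?thesis by (force simp: listed_def)
    next
      case f1: True
      show ?thesis
      proof (cases "a2 = 0")
        case True
        then have "a1 = 0" "c1 = 0" using E' f1 by auto
        then show ?thesis
          by (intro heisenberg_form[OF H, of a3 c3 f3]) (use M c 3 f1 True in auto)
      next
        case False
        \<comment> \<open>The case of nonzero \<open>f1\<close> with \<open>b1\<close> and
          \<open>b2\<close> exchanged, which reverses the sign of \<open>b3\<close>; now
          \<open>a2\<close> takes the place of \<open>f1\<close>.\<close>
        let ?c1 = "comb b1 b2 b3 0 1 0" and ?c2 = "comb b1 b2 b3 1 0 0" and ?c3 = "comb b1 b2 b3 0 0 (- 1)"
        have "heisenberg_table ?c1 ?c2 ?c3"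
          using heisenberg_table_change[OF H, of 0 0 1 1 0 0] by simp
        then have "isomorphic_to (T04 ((a2 * (- c3) - (- a1) * (- a3)) / a2))"
          by (rule heisenberg_square[of _ _ _ "- c1" "f1" "- f3" "- a1" "- c3" a2 "- a3"])
            (use M c 3 False E' in \<open>simp_all add: mul_comb comb_simps frame_eq_iff[OF F] ac_simps\<close>)
        then show ?thesis by (force simp: listed_def)
      qed
    qed
  qed
qed

end

section \<open>Three-dimensional commutative associative algebras\<close>

context comm3
begin

text \<open>In dimension three \<open>x\<close> and its powers up to the fourth are dependent, so a
  nilpotent element already has fourth power zero.\<close>

abbreviation pow4 :: "'a \<Rightarrow> 'a" where
  "pow4 x \<equiv> mul x (mul x (mul x x))"

lemma pow4_mul: "pow4 (mul x y) = mul (pow4 x) (pow4 y)"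
  by (simp add: mul_assoc mul_left_comm mul_comm)

lemma four_dependent:
  obtains a b c d where "scale a u + scale b v + scale c w + scale d z = 0" "\<not> (a = 0 \<and> b = 0 \<and> c = 0 \<and> d = 0)"
proof (cases "frame u v w")
  case True
  then obtain p q r where "z = comb u v w p q r" using frame_spans by blast
  then have "scale p u + scale q v + scale r w + scale (- 1) z = 0"
    by (simp add: comb_def)
  then show ?thesis by (rule that) simp
next
  case False
  then obtain p q r where "comb u v w p q r = 0" "\<not> (p = 0 \<and> q = 0 \<and> r = 0)"
    unfolding frame_def by blast
  then show ?thesis using that[of p q r 0] by (auto simp: comb_def)
qed

lemma solve_relation:
  assumes "scale a u + v = 0" "a \<noteq> 0"
  shows "u = scale (- 1 / a) v"
proof -
  have "scale (1 / a) (scale a u + v) = 0" using assms(1) by simp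
  then have "u + scale (1 / a) v = 0" using assms(2) by (simp add: scale_right_distrib)
  then show ?thesis by (simp add: eq_neg_iff_add_eq_0)
qed

text \<open>A linear relation among \<open>x, x\<^sup>2, x\<^sup>3, x\<^sup>4\<close>, solved for its lowest power, gives a polynomial \<open>y\<close> in
  \<open>x\<close> without constant term such that \<open>x\<^sup>4 y = x\<^sup>4\<close>.  The vectors fixed by \<open>y\<close> form an ideal, so
  \<open>y\<^sup>4\<close> is fixed as well and hence idempotent.\<close>

lemma idempotent_from_power:
  obtains e g where "mul e e = e" "mul (pow4 x) e = pow4 x" "e = mul x g"
    "\<And>W. subspace W \<Longrightarrow> (\<And>u v. u \<in> W \<Longrightarrow> v \<in> W \<Longrightarrow> mul u v \<in> W) \<Longrightarrow> x \<in> W \<Longrightarrow> e \<in> W"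
proof -
  let ?x2 = "mul x x" and ?x3 = "mul x (mul x x)"
  obtain c0 c1 c2 where y4: "mul (pow4 x) (comb x ?x2 ?x3 c0 c1 c2) = pow4 x"
  proof -
    obtain a b c d where r: "scale a x + scale b ?x2 + scale c ?x3 + scale d (pow4 x) = 0"
      and nz: "\<not> (a = 0 \<and> b = 0 \<and> c = 0 \<and> d = 0)" by (rule four_dependent)
    consider "a \<noteq> 0" | "a = 0" "b \<noteq> 0" | "a = 0" "b = 0" "c \<noteq> 0" | "a = 0" "b = 0" "c = 0" "d \<noteq> 0"
      using nz by blast
    then show thesis
    proof cases
      case 1
      have "x = scale (- 1 / a) (scale b ?x2 + scale c ?x3 + scale d (pow4 x))"
        by (rule solve_relation) (use r 1 in \<open>simp_all add: add.assoc\<close>)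
      also have "\<dots> = mul x (comb x ?x2 ?x3 (- b / a) (- c / a) (- d / a))"
        by (simp add: comb_def mul_add mul_diff mul_minus mul_scale scale_right_distrib scale_right_diff_distrib mul_assoc)
      finally have x: "x = mul x (comb x ?x2 ?x3 (- b / a) (- c / a) (- d / a))" .
      have "mul (pow4 x) (comb x ?x2 ?x3 (- b / a) (- c / a) (- d / a)) =
          mul (mul x (comb x ?x2 ?x3 (- b / a) (- c / a) (- d / a))) ?x3"
        by (metis mul_assoc mul_comm)
      then show ?thesis using x that by metis
    next
      case 2
      have "?x2 = scale (- 1 / b) (scale c ?x3 + scale d (pow4 x))"
        by (rule solve_relation) (use r 2 in \<open>simp_all add: add.assoc\<close>)
      also have "\<dots> = mul ?x2 (comb x ?x2 ?x3 (- c / b) (- d / b) 0)"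
        by (simp add: comb_def mul_add mul_diff mul_minus mul_scale scale_right_distrib scale_right_diff_distrib mul_assoc)
      finally have x: "?x2 = mul ?x2 (comb x ?x2 ?x3 (- c / b) (- d / b) 0)" .
      have "mul (pow4 x) (comb x ?x2 ?x3 (- c / b) (- d / b) 0) =
          mul (mul ?x2 (comb x ?x2 ?x3 (- c / b) (- d / b) 0)) ?x2"
        by (metis mul_assoc mul_comm)
      then show ?thesis using x that by (metis mul_assoc)
    next
      case 3
      have "?x3 = scale (- 1 / c) (scale d (pow4 x))"
        by (rule solve_relation) (use r 3 in \<open>simp_all add: add.assoc\<close>)
      also have "\<dots> = mul ?x3 (comb x ?x2 ?x3 (- d / c) 0 0)"
        by (simp add: comb_def mul_add mul_diff mul_minus mul_scale scale_right_distrib scale_right_diff_distrib mul_assoc)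
      finally have x: "?x3 = mul ?x3 (comb x ?x2 ?x3 (- d / c) 0 0)" .
      have "mul (pow4 x) (comb x ?x2 ?x3 (- d / c) 0 0) =
          mul (mul ?x3 (comb x ?x2 ?x3 (- d / c) 0 0)) x"
        by (metis mul_assoc mul_comm)
      then show ?thesis using x that by (metis mul_comm)
    next
      case 4
      then have "pow4 x = 0" using r by simp
      then show ?thesis using that[of 0 0 0] by simp
    qed
  qed
  define y where "y = comb x ?x2 ?x3 c0 c1 c2"
  have y: "mul y w = scale c0 (mul x w) + scale c1 (mul x (mul x w)) + scale c2 (mul x (mul x (mul x w)))" for w
    by (simp add: y_def comb_def mul_add mul_scale mul_assoc)
  define I where "I w \<longleftrightarrow> mul y w = w" for w
  \<comment> \<open>The fixed vectors form an ideal, and \<open>mul y w\<close> is a combination of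
    \<open>mul x w\<close> and its multiples by \<open>x\<close>. Each use trades a factor
    \<open>x\<close> of a fixed product for a factor \<open>y\<close>, until only \<open>y\<close>
    is left.\<close>
  have step: "I (mul y w)" if "I (mul x w)" for w
  proof -
    have "I (mul x u)" if "I u" for u
      using that unfolding I_def by (metis mul_left_comm)
    then have "I (mul x (mul x w))" "I (mul x (mul x (mul x w)))" using that by blast+
    then show ?thesis
      using \<open>I (mul x w)\<close> unfolding I_def by (subst (2 3) y) (simp add: mul_add mul_scale)
  qed
  have "I (pow4 x)" using y4 by (simp add: I_def y_def mul_comm)
  then have "I (mul y (mul x (mul x x)))" by (rule step)
  then have "I (mul x (mul y (mul x x)))" by (simp add: mul_left_comm)
  then have "I (mul y (mul y (mul x x)))" by (rule step)
  then have "I (mul x (mul y (mul y x)))" by (metis mul_left_comm)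
  then have "I (mul y (mul y (mul y x)))" by (rule step)
  then have "I (mul x (mul y (mul y y)))" by (metis mul_left_comm mul_comm)
  then have ye: "mul y (pow4 y) = pow4 y" using step unfolding I_def by blast
  have "mul (pow4 y) (pow4 y) = pow4 y"
    by (simp add: mul_assoc ye)
  moreover have "mul (pow4 x) (pow4 y) = pow4 x"
    using y4 unfolding y_def[symmetric] by (metis mul_assoc)
  moreover have "pow4 y = mul x (let w = mul y (mul y y) in scale c0 w + scale c1 (mul x w) + scale c2 (mul x (mul x w)))"
    by (subst y) (simp add: Let_def mul_add mul_scale)
  moreover have "pow4 y \<in> W"
    if W: "subspace W" "\<And>u v. u \<in> W \<Longrightarrow> v \<in> W \<Longrightarrow> mul u v \<in> W" "x \<in> W" for W
  proof -
    have "y \<in> W"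
      unfolding y_def comb_def by (intro subspace_add subspace_scale W)
    then show ?thesis using W(2) by blast
  qed
  ultimately show thesis by (rule that)
qed

text \<open>The plane of \<open>v\<close> and \<open>w\<close> is a two-dimensional algebra, and the
  triples are its possible types: zero product, nilpotent with \<open>w'\<close> the square of
  \<open>v'\<close>, an idempotent with a null line, dual numbers, and two orthogonal idempotents.
  Keeping \<open>b\<close> in the frame lets the result be joined to an ambient algebra.\<close>

lemma plane_cases:
  assumes F: "frame b v w" and M: "mul v v = comb b v w 0 p1 q1" "mul v w = comb b v w 0 p2 q2"
    "mul w w = comb b v w 0 p3 q3"
  obtains v' w' x1 x2 y1 y2 where "frame b v' w'" "v' = comb b v w 0 x1 x2" "w' = comb b v w 0 y1 y2"
    "(mul v' v', mul v' w', mul w' w') \<in> {(0, 0, 0), (w', 0, 0), (v', 0, 0), (v', w', 0), (v', 0, w')}"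
proof -
  define W where "W = range (\<lambda>(x, y). comb b v w 0 x y)"
  have W: "comb b v w 0 x y \<in> W" for x y by (force simp: W_def)
  have WE: "\<exists>x y. s = comb b v w 0 x y" if "s \<in> W" for s using that by (auto simp: W_def)
  have sW: "subspace W"
  proof (rule subspaceI)
    show "0 \<in> W" using W[of 0 0] by (simp add: comb_zero)
    show "s + t \<in> W" if "s \<in> W" "t \<in> W" for s t
      using that by (auto dest!: WE simp: comb_simps W)
    show "scale c s \<in> W" if "s \<in> W" for c s
      using that by (auto dest!: WE simp: comb_simps W)
  qed
  have mW: "mul s t \<in> W" if "s \<in> W" "t \<in> W" for s t
    using that by (auto dest!: WE simp: mul_comb M comb_simps W)
  note general = that
  have fin: thesis if "k \<in> W" "l \<in> W" "frame b k l"
    "(mul k k, mul k l, mul l l) \<in> {(0, 0, 0), (l, 0, 0), (k, 0, 0), (k, l, 0), (k, 0, l)}" for k l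
    using that general[of k l] WE by blast
  have inW: "\<exists>m n. s = comb b k l 0 m n" if kl: "k \<in> W" "l \<in> W" "frame b k l" and "s \<in> W" for k l s
  proof -
    obtain m n r where s: "s = comb b k l m n r" by (rule frame_spans[OF kl(3)])
    have "m = 0" using kl(1,2) \<open>s \<in> W\<close> comb_comb[of b v w 1 0 0] frame_eq_iff(1)[OF F]
      unfolding s by (auto dest!: WE simp: comb_unit)
    then show ?thesis using s by blast
  qed
  have extend: "\<exists>l\<in>W. frame b k l" if "k \<in> W" "k \<noteq> 0" for k
  proof -
    obtain x y where k: "k = comb b v w 0 x y" using WE[OF \<open>k \<in> W\<close>] by blast
    show ?thesis
    proof (cases "x = 0")
      case True
      then have "frame b k v"
        using that(2) k comb_zero by (intro frame_change[OF F comb_unit(1)[symmetric] k comb_unit(2)[symmetric]]) auto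
      then show ?thesis using W[of 1 0] by (metis comb_unit(2))
    next
      case False
      then have "frame b k w"
        by (intro frame_change[OF F comb_unit(1)[symmetric] k comb_unit(3)[symmetric]]) auto
      then show ?thesis using W[of 0 1] by (metis comb_unit(3))
    qed
  qed
  have cW: "comb b k l 0 x y \<in> W" if "k \<in> W" "l \<in> W" for k l x y
    using that subspace_add[OF sW] subspace_scale[OF sW] by (simp add: comb_def)
  show thesis
  proof (cases "\<exists>k\<in>W. k \<noteq> 0 \<and> mul k k = k")
    case True
    then obtain k where k: "k \<in> W" "k \<noteq> 0" "mul k k = k" by blast
    obtain l where l: "l \<in> W" and G: "frame b k l" and kl: "mul k l = 0 \<or> mul k l = l"
    proof -
      obtain l where l: "l \<in> W" and G: "frame b k l" using extend[OF k(1,2)] by blast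
      obtain s t where kl: "mul k l = comb b k l 0 s t" using inW[OF k(1) l G mW[OF k(1) l]] by blast
      have kk: "mul k k = comb b k l 0 1 0" using k(3) by (simp add: comb_unit)
      have "mul (comb b k l 0 1 0) (mul (comb b k l 0 1 0) (comb b k l 0 0 1)) =
          mul (mul (comb b k l 0 1 0) (comb b k l 0 1 0)) (comb b k l 0 0 1)"
        by (simp only: mul_assoc)
      then have "s + t * s = s" "t * t = t"
        by (simp_all add: mul_comb kk kl comb_simps frame_eq_iff[OF G])
      \<comment> \<open>Multiplication by the idempotent \<open>k\<close> is a projection, so its
        eigenvalue \<open>t\<close> on the second direction is 0 or 1.\<close>
      then consider "t = 0" | "t = 1" "s = 0" by auto
      then show thesis
      proof cases
        case 1
        have "frame b k (comb b k l 0 (- s) 1)"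
          by (rule frame_change[OF G comb_unit(1,2)[symmetric] refl]) simp
        moreover have "mul k (comb b k l 0 (- s) 1) = 0"
          using kl 1 by (simp add: comb_def mul_diff mul_scale k(3))
        ultimately show thesis using that cW[OF k(1) l] by blast
      next
        case 2
        then show thesis using that[OF l G] kl by (simp add: comb_unit)
      qed
    qed
    obtain m n where ll: "mul l l = comb b k l 0 m n" using inW[OF k(1) l G mW[OF l l]] by blast
    have kk: "mul k k = comb b k l 0 1 0" using k(3) by (simp add: comb_unit)
    from kl show thesis
    proof
      assume kl: "mul k l = 0"
      have "mul k (mul l l) = 0" using kl by (metis mul_assoc mul_zero(1))
      then have "m = 0" unfolding ll
        using k(2,3) kl by (simp add: comb_def mul_add mul_scale)
      show thesis
      proof (cases "n = 0")
        case True
        then show thesis using fin[OF k(1) l G] k(3) kl ll \<open>m = 0\<close> by (simp add: comb_zero)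
      next
        case False
        let ?l = "comb b k l 0 0 (1 / n)"
        have "frame b k ?l"
          by (rule frame_change[OF G comb_unit(1,2)[symmetric] refl]) (use False in simp)
        moreover have "mul k ?l = 0" using kl by (simp add: comb_def mul_scale)
        moreover have "mul ?l ?l = ?l"
          using False ll \<open>m = 0\<close> by (simp add: mul_comb comb_simps frame_eq_iff[OF G])
        ultimately show thesis using fin[OF k(1) cW[OF k(1) l]] k(3) by simp
      qed
    next
      assume kl: "mul k l = l"
      then have kl': "mul k l = comb b k l 0 0 1" by (simp add: comb_unit)
      \<comment> \<open>\<open>k\<close> is the identity of the plane, and \<open>D k\<close> is the
        square of \<open>l - (n / 2) k\<close>. For \<open>D\<close> zero this vector has square
        zero; otherwise dividing it by a root of \<open>D\<close> gives a square root of
        \<open>k\<close>, hence two orthogonal idempotents.\<close>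
      define D where "D = m + n * n / 4"
      have D: "m = D - n * n / 4" by (simp add: D_def)
      note simps = mul_comb kk kl' ll comb_simps frame_eq_iff[OF G] D
      show thesis
      proof (cases "D = 0")
        case True
        let ?l = "comb b k l 0 (- n / 2) 1"
        have "frame b k ?l"
          by (rule frame_change[OF G comb_unit(1,2)[symmetric] refl]) simp
        moreover have "mul k ?l = ?l"
          by (simp add: comb_def mul_add mul_diff mul_scale mul_minus k(3) kl)
        moreover have "mul ?l ?l = 0"
          using True by (simp add: simps)
        ultimately show thesis using fin[OF k(1) cW[OF k(1) l]] k(3) by simp
      next
        case False
        define r where "r = csqrt D"
        have r: "D = r * r" "r \<noteq> 0" using False by (auto simp: r_def simp flip: power2_eq_square)
        let ?k = "comb b k l 0 (1 / 2 - n / (4 * r)) (1 / (2 * r))"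
        let ?l = "comb b k l 0 (1 / 2 + n / (4 * r)) (- 1 / (2 * r))"
        have "frame b ?k ?l"
          by (rule frame_change[OF G comb_unit(1)[symmetric] refl refl])
            (use r(2) in \<open>simp add: field_simps\<close>)
        moreover have "mul ?k ?k = ?k" "mul ?k ?l = 0" "mul ?l ?l = ?l"
          using r(2) by (simp_all add: simps r(1) field_simps)
        ultimately show thesis using fin[OF cW[OF k(1) l] cW[OF k(1) l], of "1 / 2 - n / (4 * r)"] by simp
      qed
    qed
  next
    case False
    \<comment> \<open>The idempotent built from \<open>x\<close> stays in \<open>W\<close>, where
      only zero is idempotent.\<close>
    have nil: "pow4 x = 0" if x: "x \<in> W" for x
    proof (rule idempotent_from_power[of x])
      fix e g
      assume e: "mul e e = e" "mul (pow4 x) e = pow4 x"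
        and "\<And>W. subspace W \<Longrightarrow> (\<And>u v. u \<in> W \<Longrightarrow> v \<in> W \<Longrightarrow> mul u v \<in> W) \<Longrightarrow> x \<in> W \<Longrightarrow> e \<in> W"
      then have "e \<in> W" using sW mW x by blast
      then have "e = 0" using e(1) False by blast
      then show "pow4 x = 0" using e(2) by simp
    qed
    have vw: "v \<in> W" "w \<in> W" using W[of 1 0] W[of 0 1] by (simp_all add: comb_unit)
    show thesis
    proof (cases "\<exists>x\<in>W. mul x x \<noteq> 0")
      case True
      then obtain x where x: "x \<in> W" "mul x x \<noteq> 0" by blast
      let ?y = "mul x x"
      have y: "?y \<in> W" using mW x by blast
      obtain p q where px: "x = comb b v w 0 p q" using x(1) WE by blast
      obtain r s where py: "?y = comb b v w 0 r s" using y WE by blast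
      have G: "frame b x ?y"
      proof (rule frame_change[OF F comb_unit(1)[symmetric] px py])
        \<comment> \<open>If \<open>mul x x\<close> were \<open>l x\<close>, the fourth power would
          be \<open>l^3 x\<close>; its vanishing would make the square zero.\<close>
        have "p * s - q * r \<noteq> 0"
        proof
          assume d: "p * s - q * r = 0"
          have "x \<noteq> 0" using x(2) by auto
          then have "p \<noteq> 0 \<or> q \<noteq> 0" using px comb_zero by auto
          then obtain l where l: "r = l * p" "s = l * q"
          proof
            assume "p \<noteq> 0"
            then show thesis using that[of "r / p"] d by (simp add: field_simps)
          next
            assume "q \<noteq> 0"
            then show thesis using that[of "s / q"] d by (simp add: field_simps)
          qed
          have "comb b v w 0 r s = scale l (comb b v w 0 p q)" by (simp add: comb_scale l)
          then have e: "?y = scale l x" unfolding py[symmetric] px[symmetric] .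
          then have "pow4 x = scale (l * l * l) x" by (simp add: mul_scale)
          then have "l = 0" using nil[OF x(1)] \<open>x \<noteq> 0\<close> by simp
          then show False using e x(2) by simp
        qed
        then show "1 * (p * s - q * r) - 0 * (0 * s - q * 0) + 0 * (0 * r - p * 0) \<noteq> 0" by simp
      qed
      obtain m n where xy: "mul x ?y = comb b x ?y 0 m n" using inW[OF x(1) y G mW[OF x(1) y]] by blast
      have "pow4 x = mul x (comb b x ?y 0 m n)" by (simp only: xy)
      also have "\<dots> = scale m ?y + scale n (comb b x ?y 0 m n)"
        unfolding xy[symmetric] by (subst xy) (simp add: comb_def mul_add mul_scale)
      also have "\<dots> = comb b x ?y 0 (n * m) (m + n * n)"
        by (simp add: comb_def scale_right_distrib scale_left_distrib)
      finally have "n * m = 0" "m + n * n = 0"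
        using nil[OF x(1)] frame_eq_iff(2)[OF G] by auto
      then have "m = 0 \<and> n = 0" by auto
      then have 0: "mul x ?y = 0" using xy by (simp add: comb_zero)
      moreover have "mul ?y ?y = 0" using 0 by (metis mul_assoc mul_zero(2))
      ultimately show thesis using fin[OF x(1) y G] by simp
    next
      case False
      then have "mul v v = 0" "mul w w = 0" "mul (v + w) (v + w) = 0"
        using vw subspace_add[OF sW] by blast+
      then have "mul v w + mul v w = 0"
        by (simp add: mul_add mul_comm[of w v])
      then have "scale (1 + 1) (mul v w) = 0" by (simp only: scale_left_distrib scale_one)
      then have "mul v w = 0" by simp
      then show thesis using fin[OF vw F] \<open>mul v v = 0\<close> \<open>mul w w = 0\<close> by simp
    qed
  qed
qed

end

section \<open>Local algebras with identity\<close>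

context comm3
begin

lemma mul_eq_0_of_squares:
  assumes "\<And>x. mul x x = 0"
  shows "mul x y = 0"
proof -
  have "mul x y + mul x y = 0"
    using assms[of "x + y"] unfolding mul_add by (simp add: assms mul_comm[of y x])
  then have "scale (1 + 1) (mul x y) = 0" by (simp only: scale_left_distrib scale_one)
  then show ?thesis by simp
qed

text \<open>Dividing a polynomial relation for \<open>v\<close> by a linear factor
  \<open>X - z\<close> gives \<open>u\<close> with \<open>(v - z) u = 0\<close>. If \<open>u\<close>
  is zero, it is itself a relation of lower degree, and the descent continues.\<close>

lemma eigenvector_exists:
  assumes unit: "\<And>x. mul e x = x" and "e \<noteq> 0"
  obtains u l where "u \<noteq> 0" "mul v u = scale l u"
proof -
  have 1: "\<exists>u l. u \<noteq> 0 \<and> mul v u = scale l u" if "b \<noteq> 0" "scale b v + scale a e = 0" for a b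
  proof -
    have "v = scale (- 1 / b) (scale a e)" by (rule solve_relation[OF that(2,1)])
    then have "mul v e = scale (- a / b) e" by (metis scale_scale times_divide_eq_left mult_minus1 mul_comm unit)
    then show ?thesis using \<open>e \<noteq> 0\<close> by blast
  qed
  have 2: "\<exists>u l. u \<noteq> 0 \<and> mul v u = scale l u"
    if "c \<noteq> 0" "scale c (mul v v) + (scale b v + scale a e) = 0" for a b c
  proof -
    obtain z where z: "z\<^sup>2 = (- b / c) * z + (- a / c)" by (rule quadratic_root)
    then have z: "z * (b + c * z) = - a" using that(1) by (simp add: power2_eq_square field_simps)
    let ?u = "scale c v + scale (b + c * z) e"
    have "mul v ?u - scale z ?u = scale c (mul v v) + (scale b v + scale a e)"
      by (simp add: mul_add mul_scale mul_comm[of v e] unit scale_right_distrib z) (simp add: scale_left_distrib mult.commute)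
    then have u: "mul v ?u = scale z ?u" using that(2) by simp
    show ?thesis
    proof (cases "?u = 0")
      case True
      then show ?thesis using 1 that(1) by blast
    next
      case False
      then show ?thesis using u by blast
    qed
  qed
  have 3: "\<exists>u l. u \<noteq> 0 \<and> mul v u = scale l u"
    if d: "d \<noteq> 0" and r: "scale d (mul v (mul v v)) + (scale c (mul v v) + (scale b v + scale a e)) = 0" for a b c d
  proof -
    have "\<not> constant (poly [:a, b, c, d:])" using d by (simp add: constant_degree)
    then obtain z where "poly [:a, b, c, d:] z = 0" using fundamental_theorem_of_algebra by blast
    then have z: "z * (b + z * (c + d * z)) = - a" by (simp add: algebra_simps add_eq_0_iff)
    let ?u = "scale d (mul v v) + (scale (c + d * z) v + scale (b + z * (c + d * z)) e)"
    have "mul v ?u - scale z ?u = scale d (mul v (mul v v)) + (scale c (mul v v) + (scale b v + scale a e))"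
      by (simp add: mul_add mul_scale mul_comm[of v e] unit scale_right_distrib z) (simp add: scale_left_distrib mult.commute)
    then have u: "mul v ?u = scale z ?u" using r by simp
    show ?thesis
    proof (cases "?u = 0")
      case True
      then show ?thesis using 2 d by blast
    next
      case False
      then show ?thesis using u by blast
    qed
  qed
  obtain a b c d where r: "scale a e + scale b v + scale c (mul v v) + scale d (mul v (mul v v)) = 0"
    "\<not> (a = 0 \<and> b = 0 \<and> c = 0 \<and> d = 0)" by (rule four_dependent)
  consider "d \<noteq> 0" | "d = 0" "c \<noteq> 0" | "d = 0" "c = 0" "b \<noteq> 0" | "d = 0" "c = 0" "b = 0" "a \<noteq> 0"
    using r(2) by blast
  then have "\<exists>u l. u \<noteq> 0 \<and> mul v u = scale l u"
  proof cases
    case 1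
    show ?thesis by (rule 3[OF 1, of c b a]) (use r(1) in \<open>simp add: ac_simps\<close>)
  next
    case case2: 2
    show ?thesis by (rule 2[OF case2(2), of b a]) (use r(1) case2 in \<open>simp add: ac_simps\<close>)
  next
    case 3
    show ?thesis by (rule 1[OF 3(3), of a]) (use r(1) 3 in \<open>simp add: ac_simps\<close>)
  next
    case 4
    then show ?thesis using r(1) \<open>e \<noteq> 0\<close> by simp
  qed
  then show thesis using that by blast
qed

text \<open>With a single nonzero idempotent the algebra is local: an element that is not nilpotent
  is invertible, and the nilpotent ones form a plane complementary to the line of \<open>e\<close>.
  \<open>plane_cases\<close> describes this plane, and its types with an idempotent cannot
  occur.\<close>

lemma local_unital_cases:
  assumes unit: "\<And>x. mul e x = x" and "e \<noteq> 0"
    and idem: "\<And>k. mul k k = k \<Longrightarrow> k \<noteq> 0 \<Longrightarrow> k = e"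
  obtains v w where "frame e v w" "mul v w = 0" "mul w w = 0" "mul v v = 0 \<or> mul v v = w"
proof -
  have inverse: "\<exists>g. mul x g = e" if "pow4 x \<noteq> 0" for x
  proof (rule idempotent_from_power[of x])
    fix k g assume k: "mul k k = k" "mul (pow4 x) k = pow4 x" "k = mul x g"
    then have "k \<noteq> 0" using that by auto
    then show ?thesis using idem k by blast
  qed
  have pow4_scale: "pow4 (scale c x) = scale (c * c * c * c) (pow4 x)" for c x
    by (simp add: mul_scale mult.assoc)
  have nil_mul: "pow4 (mul x y) = 0" if "pow4 x = 0" for x y
    using that by (simp add: pow4_mul)
  have nil_add: "pow4 (x + y) = 0" if x: "pow4 x = 0" and y: "pow4 y = 0" for x y
  proof (rule ccontr)
    assume "pow4 (x + y) \<noteq> 0"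
    then obtain g where g: "mul (x + y) g = e" using inverse by blast
    define a where "a = mul x g"
    have b: "e - a = mul y g" using g by (simp add: a_def mul_add algebra_simps)
    have "pow4 a = 0" "pow4 (e - a) = 0" using nil_mul x y unfolding a_def b[unfolded a_def] by blast+
    \<comment> \<open>A geometric series: \<open>a\<close> is nilpotent, so \<open>e - a\<close> is
      invertible, yet it is nilpotent too.\<close>
    have "mul (e - a) (e + (a + (mul a a + mul a (mul a a)))) = e - pow4 a"
      by (simp add: mul_add mul_diff unit mul_comm[of a e])
    then have "mul (e - a) (e + (a + (mul a a + mul a (mul a a)))) = e" using \<open>pow4 a = 0\<close> by simp
    then have "pow4 e = 0" using nil_mul[OF \<open>pow4 (e - a) = 0\<close>] by metis
    then show False using \<open>e \<noteq> 0\<close> by (simp add: unit)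
  qed
  have nil_scale: "pow4 (scale c x) = 0" if "pow4 x = 0" for c x
    using that by (simp add: pow4_scale)
  have shift: "\<exists>l. pow4 (v - scale l e) = 0" for v
  proof (rule eigenvector_exists[OF unit \<open>e \<noteq> 0\<close>, of v])
    fix u l assume u: "u \<noteq> 0" "mul v u = scale l u"
    have "mul (v - scale l e) u = 0" by (simp add: mul_diff mul_scale unit u)
    have "pow4 (v - scale l e) = 0"
    proof (rule ccontr)
      assume "pow4 (v - scale l e) \<noteq> 0"
      then obtain g where "mul (v - scale l e) g = e" using inverse by blast
      then have "u = mul g (mul (v - scale l e) u)" by (metis unit mul_assoc mul_comm)
      then show False using \<open>mul (v - scale l e) u = 0\<close> u(1) by simp
    qed
    then show ?thesis by blast
  qed
  obtain b1 b2 b3 where "frame b1 b2 b3" by (rule frame_exists)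
  then obtain v w where F: "frame e v w" using frame_extend[OF _ \<open>e \<noteq> 0\<close>] by blast
  obtain l m where lm: "pow4 (v - scale l e) = 0" "pow4 (w - scale m e) = 0" using shift by blast
  define x where "x = v - scale l e"
  define y where "y = w - scale m e"
  have nil: "pow4 x = 0" "pow4 y = 0" using lm by (simp_all add: x_def y_def)
  have "frame e (comb e v w (- l) 1 0) (comb e v w (- m) 0 1)"
    by (rule frame_change[OF F comb_unit(1)[symmetric] refl refl]) simp
  then have G: "frame e x y" by (simp add: x_def y_def comb_def algebra_simps)
  have plane: "\<exists>q r. s = comb e x y 0 q r" if "pow4 s = 0" for s
  proof -
    obtain p q r where s: "s = comb e x y p q r" by (rule frame_spans[OF G])
    have "scale p e = s + (scale (- q) x + scale (- r) y)" by (simp add: s comb_def algebra_simps)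
    then have "pow4 (scale p e) = 0"
      using nil that by (simp only: nil_add nil_scale)
    then have "p = 0" using \<open>e \<noteq> 0\<close> by (simp add: pow4_scale unit)
    then show ?thesis using s by blast
  qed
  obtain q1 r1 q2 r2 q3 r3 where M: "mul x x = comb e x y 0 q1 r1" "mul x y = comb e x y 0 q2 r2"
    "mul y y = comb e x y 0 q3 r3"
    using plane nil_mul nil by metis
  show thesis
  proof (rule plane_cases[OF G M])
    fix v' w' x1 x2 y1 y2
    assume G': "frame e v' w'" and "(mul v' v', mul v' w', mul w' w') \<in>
        {(0, 0, 0), (w', 0, 0), (v', 0, 0), (v', w', 0), (v', 0, w')}"
    moreover have "mul v' v' \<noteq> v'"
    proof
      assume "mul v' v' = v'"
      moreover have "v' \<noteq> 0" "v' \<noteq> e"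
        using frame_eq_iff(1)[OF G', of 0 1 0 1 0 0] frame_eq_iff(2)[OF G', of 0 1 0] by (auto simp: comb_unit)
      ultimately show False using idem by blast
    qed
    ultimately show thesis using that[OF G'] by auto
  qed
qed

end

section \<open>Normal forms when the bracket vanishes\<close>

context tpa3
begin

context
  assumes abelian: "\<And>x y. bracket x y = 0"
begin

lemmas comm_simps = T_mult_vector T_bracket_vector axis_vector abelian comb_unit comb_zero

text \<open>A nonzero cube makes \<open>x\<close>, its square and its cube a frame. If all cubes
  vanish, squares annihilate the algebra; then the product takes values in the line of a square
  \<open>c\<close>, and its rank as a quadratic form separates \<open>T30\<close> from
  \<open>T29\<close>.\<close>

lemma nil_classification:
  assumes nil: "\<And>x. pow4 x = 0" and nz: "mul x0 y0 \<noteq> 0"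
  shows "isomorphic_to T28 \<or> isomorphic_to T29 \<or> isomorphic_to T30"
proof (cases "\<exists>x. mul x (mul x x) \<noteq> 0")
  case True
  then obtain x where x: "mul x (mul x x) \<noteq> 0" by blast
  let ?x2 = "mul x x" and ?x3 = "mul x (mul x x)"
  have 0: "mul x ?x3 = 0" "mul ?x2 ?x2 = 0" "mul ?x2 ?x3 = 0" "mul ?x3 ?x3 = 0"
    using nil[of x] by (simp_all add: mul_assoc)
  have "frame x ?x2 ?x3"
    unfolding frame_def
  proof (intro allI impI)
    fix p q r assume e: "comb x ?x2 ?x3 p q r = 0"
    then have "mul ?x2 (comb x ?x2 ?x3 p q r) = 0" by simp
    then have "scale p ?x3 = 0" by (simp add: comb_def mul_add mul_scale 0 mul_assoc)
    then have "p = 0" using x by simp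
    have "mul x (comb x ?x2 ?x3 p q r) = 0" using e by simp
    then have "scale q ?x3 = 0" by (simp add: comb_def mul_add mul_scale 0 \<open>p = 0\<close>)
    then have "q = 0" using x by simp
    then show "p = 0 \<and> q = 0 \<and> r = 0" using e x \<open>p = 0\<close> by (simp add: comb_def)
  qed
  then have "isomorphic_to T28"
    by (rule isomorphic_tableI) (simp_all add: comm_simps 0)
  then show ?thesis by blast
next
  case False
  then have cube: "mul x (mul x x) = 0" for x by blast
  have cube2: "mul (mul x x) y = 0" for x y
  proof -
    \<comment> \<open>Obtained by expanding the cube of \<open>x + z\<close>; replacing
      \<open>z\<close> by its negative then separates the two terms.\<close>
    have 1: "mul (mul x x) z + mul (mul z z) x = 0" for z
    proof -
      let ?s = "mul (mul x x) z + mul (mul z z) x"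
      have *: "mul x (mul x z) = mul (mul x x) z" "mul x (mul z x) = mul (mul x x) z"
        "mul z (mul x x) = mul (mul x x) z" "mul x (mul z z) = mul (mul z z) x"
        "mul z (mul x z) = mul (mul z z) x" "mul z (mul z x) = mul (mul z z) x"
        by (metis mul_assoc mul_comm)+
      have "mul (x + z) (mul (x + z) (x + z)) = ?s + ?s + ?s"
        unfolding mul_add * cube[of x] cube[of z] by (simp add: ac_simps)
      then have "scale (1 + 1 + 1) ?s = 0" unfolding scale_left_distrib scale_one using cube by simp
      then show ?thesis by simp
    qed
    have "mul (mul x x) y + mul (mul y y) x = 0" "- mul (mul x x) y + mul (mul y y) x = 0"
      using 1[of y] 1[of "- y"] by (simp_all add: mul_minus)
    then have "mul (mul x x) y + mul (mul x x) y = 0" by (simp add: add_eq_0_iff2)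
    then have "scale (1 + 1) (mul (mul x x) y) = 0" by (simp only: scale_left_distrib scale_one)
    then show ?thesis by simp
  qed
  obtain x where x: "mul x x \<noteq> 0" using mul_eq_0_of_squares nz by blast
  define c where "c = mul x x"
  have c: "mul c z = 0" "mul z c = 0" for z using cube2 mul_comm by (simp_all add: c_def)
  obtain b1 b2 b3 where "frame b1 b2 b3" by (rule frame_exists)
  then obtain w where F: "frame x c w"
  proof (rule frame_extend2)
    fix p q assume e: "scale p x + scale q c = 0"
    then have "mul x (scale p x + scale q c) = 0" by simp
    then have "scale p c = 0" by (simp add: mul_add mul_scale c flip: c_def)
    then have "p = 0" using x by (simp add: c_def)
    then show "p = 0 \<and> q = 0" using e x by (simp add: c_def)
  qed
  obtain p q r where xw: "mul x w = comb x c w p q r" by (rule frame_spans[OF F])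
  have "mul x (mul x w) = 0" using c(1)[of w] by (simp add: c_def mul_assoc)
  moreover have "mul x (mul x w) = scale p c + scale r (mul x w)"
    unfolding xw by (subst xw[symmetric]) (simp add: comb_def mul_add mul_scale c flip: c_def)
  ultimately have "comb x c w (r * p) (p + r * q) (r * r) = 0"
    unfolding xw by (simp add: comb_def scale_right_distrib scale_left_distrib ac_simps)
  then have "r = 0" "p = 0" using frame_eq_iff(2)[OF F] by auto
  then have xw: "mul x w = scale q c" using xw by (simp add: comb_def)
  define w' where "w' = comb x c w (- q) 0 1"
  have F': "frame x c w'"
    by (rule frame_change[OF F comb_unit(1,2)[symmetric] w'_def]) simp
  have xw': "mul x w' = 0"
    by (simp add: w'_def comb_def mul_add mul_diff mul_scale xw mul_minus flip: c_def)
  obtain p q r where ww: "mul w' w' = comb x c w' p q r" by (rule frame_spans[OF F'])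
  have "mul x (mul w' w') = 0" using xw' by (metis mul_assoc mul_zero(1))
  then have "scale p c = 0" unfolding ww by (simp add: comb_def mul_add mul_scale c xw' flip: c_def)
  then have "p = 0" using x by (simp add: c_def)
  have "mul w' (mul w' w') = scale r (mul w' w')"
    unfolding ww by (subst ww[symmetric]) (simp add: comb_def mul_add mul_scale c \<open>p = 0\<close>)
  then have "r = 0 \<or> mul w' w' = 0" using cube[of w'] by simp
  then obtain q where ww: "mul w' w' = scale q c"
    using ww \<open>p = 0\<close> by (metis comb_def add.right_neutral scale_zero_left add_0)
  show ?thesis
  proof (cases "q = 0")
    case True
    have "isomorphic_to T30"
      by (rule isomorphic_tableI[OF F']) (simp_all add: comm_simps c xw' ww True flip: c_def)
    then show ?thesis by blast
  next
    case False
    \<comment> \<open>\<open>x + s w'\<close> and \<open>x - s w'\<close> have square zero and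
      product \<open>2 c\<close>.\<close>
    define s where "s = csqrt (- 1 / q)"
    have s: "s * s * q = - 1" "s \<noteq> 0" using False by (auto simp: s_def simp flip: power2_eq_square)
    have q: "q = - 1 / (s * s)" using s by (simp add: field_simps)
    have M: "mul x x = comb x c w' 0 1 0" "mul x c = comb x c w' 0 0 0" "mul x w' = comb x c w' 0 0 0"
      "mul c c = comb x c w' 0 0 0" "mul c w' = comb x c w' 0 0 0" "mul w' w' = comb x c w' 0 q 0"
      by (simp_all add: c xw' ww comb_zero comb_unit flip: c_def) (simp add: comb_def)
    have "isomorphic_to T29"
      by (rule isomorphic_changeI[OF F', of 1 0 s 1 0 "- s" 0 2 0])
        (use s(2) in \<open>simp_all add: change_simps M abelian frame_eq_iff[OF F'] q\<close>)
    then show ?thesis by blast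
  qed
qed

text \<open>Multiplication by \<open>e\<close> is a projection, \<open>e\<close> and
  \<open>w\<close> lie in its parts for 1 and 0, and products across the parts vanish. The third
  vector joins one of them: the result is a plane with identity \<open>e\<close> next to the line of
  \<open>w\<close>, or the line of \<open>e\<close> next to an arbitrary plane algebra.\<close>

lemma peirce_classification:
  assumes e: "mul e e = e" "e \<noteq> 0" and w: "mul e w = 0" "w \<noteq> 0"
  shows "\<exists>t\<in>listed. isomorphic_to t"
proof -
  obtain b1 b2 b3 where "frame b1 b2 b3" by (rule frame_exists)
  then obtain b where F: "frame e w b"
  proof (rule frame_extend2)
    fix p q assume r: "scale p e + scale q w = 0"
    then have "mul e (scale p e + scale q w) = 0" by simp
    then have "p = 0" using e w by (simp add: mul_add mul_scale)
    then show "p = 0 \<and> q = 0" using r w by simp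
  qed
  obtain p q r where eb: "mul e b = comb e w b p q r" by (rule frame_spans[OF F])
  have "mul e (mul e b) = mul e b" using e by (metis mul_assoc)
  moreover have "mul e (mul e b) = scale p e + scale r (mul e b)"
    unfolding eb by (subst eb[symmetric]) (simp add: comb_def mul_add mul_scale e w)
  ultimately have "comb e w b (p + r * p) (r * q) (r * r) = comb e w b p q r"
    unfolding eb by (simp add: comb_def scale_right_distrib scale_left_distrib ac_simps)
  then have r: "r * p = 0" "r * q = q" "r * r = r" using frame_eq_iff(1)[OF F] by auto
  then consider "r = 1" "p = 0" | "r = 0" "q = 0" by auto
  then show ?thesis
  proof cases
    case 1
    define v where "v = comb e w b 0 q 1"
    have G: "frame e w v" by (rule frame_change[OF F comb_unit(1,2)[symmetric] v_def]) simp
    have ev: "mul e v = v" by (simp add: v_def comb_def mul_add mul_scale e w eb 1)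
    obtain p q r where ww: "mul w w = comb e w v p q r" by (rule frame_spans[OF G])
    have "mul e (mul w w) = 0" using w by (metis mul_assoc mul_zero(1))
    then have "comb e w v p 0 r = 0" unfolding ww by (simp add: comb_def mul_add mul_scale e w ev)
    then have "p = 0" "r = 0" using frame_eq_iff(2)[OF G] by auto
    then have ww: "mul w w = comb e w v 0 q 0" using ww by simp
    have wv: "mul w v = comb e w v 0 0 0" unfolding comb_zero using w(1) ev by (metis mul_assoc mul_comm mul_zero(1))
    obtain p m r where vv: "mul v v = comb e w v p m r" by (rule frame_spans[OF G])
    have "mul e (mul v v) = mul v v" using ev by (metis mul_assoc)
    then have "comb e w v p 0 r = comb e w v p m r" unfolding vv by (simp add: comb_def mul_add mul_scale e w ev)
    then have "m = 0" using frame_eq_iff(1)[OF G] by auto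
    then have vv: "mul v v = comb e w v p 0 r" using vv by simp
    define D where "D = p + r * r / 4"
    have p: "p = D - r * r / 4" by (simp add: D_def)
    have ee: "mul e e = comb e w v 1 0 0" "mul e w = comb e w v 0 0 0" "mul e v = comb e w v 0 0 1"
      using e w ev by (simp_all add: comb_unit comb_zero)
    note simps = change_simps ww wv vv ee p abelian frame_eq_iff[OF G]
    show ?thesis
    proof (cases "D = 0")
      case D: True
      show ?thesis
      proof (cases "q = 0")
        case True
        have "isomorphic_to T25"
          by (rule isomorphic_changeI[OF G, of 1 0 0 "- r / 2" 0 1 0 1 0])
            (simp_all add: simps D True field_simps)
        then show ?thesis by (force simp: listed_def)
      next
        case False
        have "isomorphic_to T21"
          by (rule isomorphic_changeI[OF G, of 1 0 0 0 "1 / q" 0 "- r / 2" 0 1])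
            (use False in \<open>simp_all add: simps D field_simps\<close>)
        then show ?thesis by (force simp: listed_def)
      qed
    next
      case False
      define d where "d = csqrt D"
      have d: "D = d * d" "d \<noteq> 0" using False by (auto simp: d_def simp flip: power2_eq_square)
      show ?thesis
      proof (cases "q = 0")
        case True
        have "isomorphic_to T22"
          by (rule isomorphic_changeI[OF G, of "1 / 2 - r / (4 * d)" 0 "1 / (2 * d)" "1 / 2 + r / (4 * d)" 0 "- 1 / (2 * d)" 0 1 0])
            (use d(2) in \<open>simp_all add: simps d(1) True field_simps\<close>)
        then show ?thesis by (force simp: listed_def)
      next
        case False
        have "isomorphic_to T20"
          by (rule isomorphic_changeI[OF G, of "1 / 2 - r / (4 * d)" 0 "1 / (2 * d)" "1 / 2 + r / (4 * d)" 0 "- 1 / (2 * d)" 0 "1 / q" 0])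
            (use d(2) False in \<open>simp_all add: simps d(1) field_simps\<close>)
        then show ?thesis by (force simp: listed_def)
      qed
    qed
  next
    case 2
    define v where "v = comb e w b (- p) 0 1"
    have G: "frame e w v" by (rule frame_change[OF F comb_unit(1,2)[symmetric] v_def]) simp
    have ev: "mul e v = 0" by (simp add: v_def comb_def mul_add mul_minus mul_diff mul_scale e w eb 2)
    have closed: "\<exists>q r. mul s t = comb e w v 0 q r" if "mul e s = 0" for s t
    proof -
      obtain p q r where st: "mul s t = comb e w v p q r" by (rule frame_spans[OF G])
      have "mul e (mul s t) = 0" using that by (metis mul_assoc mul_zero(1))
      then have "p = 0" unfolding st using e w ev by (simp add: comb_def mul_add mul_scale)
      then show ?thesis using st by blast
    qed
    obtain q1 r1 q2 r2 q3 r3 where M: "mul w w = comb e w v 0 q1 r1" "mul w v = comb e w v 0 q2 r2"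
      "mul v v = comb e w v 0 q3 r3" using closed w ev by metis
    show ?thesis
    proof (rule plane_cases[OF G M])
      fix v' w' x1 x2 y1 y2
      assume H: "frame e v' w'" and v': "v' = comb e w v 0 x1 x2" and w': "w' = comb e w v 0 y1 y2"
        and "(mul v' v', mul v' w', mul w' w') \<in> {(0, 0, 0), (w', 0, 0), (v', 0, 0), (v', w', 0), (v', 0, w')}"
      then consider "mul v' v' = 0" "mul v' w' = 0" "mul w' w' = 0" | "mul v' v' = w'" "mul v' w' = 0" "mul w' w' = 0"
        | "mul v' v' = v'" "mul v' w' = 0" "mul w' w' = 0" | "mul v' v' = v'" "mul v' w' = w'" "mul w' w' = 0"
        | "mul v' v' = v'" "mul v' w' = 0" "mul w' w' = w'" by auto
      moreover have e': "mul e v' = 0" "mul e w' = 0"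
        by (simp_all add: v' w' comb_def mul_add mul_scale w ev)
      ultimately show ?thesis
      proof cases
        case 1
        have "isomorphic_to T27"
          by (rule isomorphic_tableI[OF H]) (simp_all add: comm_simps e e' 1)
        then show ?thesis by (force simp: listed_def)
      next
        case 2
        have "isomorphic_to T26"
          by (rule isomorphic_tableI[OF H]) (simp_all add: comm_simps e e' 2)
        then show ?thesis by (force simp: listed_def)
      next
        case 3
        have "isomorphic_to T22"
          by (rule isomorphic_tableI[OF H]) (simp_all add: comm_simps e e' 3)
        then show ?thesis by (force simp: listed_def)
      next
        case 4
        have "isomorphic_to T21"
          by (rule isomorphic_tableI[OF frame_swap[OF H]]) (simp_all add: comm_simps e e' 4 mul_comm[of v' e])
        then show ?thesis by (force simp: listed_def)
      next
        case 5
        have "isomorphic_to T20"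
          by (rule isomorphic_tableI[OF H]) (simp_all add: comm_simps e e' 5)
        then show ?thesis by (force simp: listed_def)
      qed
    qed
  qed
qed

text \<open>If no nonzero idempotent annihilates a nonzero vector, each of them is an identity
  element, because \<open>k\<close> annihilates \<open>mul k x - x\<close>; so there is only one,
  and the algebra is local.\<close>

theorem abelian_classification:
  assumes nz: "mul x0 y0 \<noteq> 0"
  shows "\<exists>t\<in>listed. isomorphic_to t"
proof (cases "\<exists>e. mul e e = e \<and> e \<noteq> 0")
  case False
  have "pow4 x = 0" for x
    by (rule idempotent_from_power[of x]) (use False in auto)
  then have "isomorphic_to T28 \<or> isomorphic_to T29 \<or> isomorphic_to T30"
    by (rule nil_classification[OF _ nz])
  moreover have "T28 \<in> listed" "T29 \<in> listed" "T30 \<in> listed" by (simp_all add: listed_def)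
  ultimately show ?thesis by blast
next
  case True
  then obtain e where e: "mul e e = e" "e \<noteq> 0" by blast
  show ?thesis
  proof (cases "\<exists>k w. mul k k = k \<and> k \<noteq> 0 \<and> mul k w = 0 \<and> w \<noteq> 0")
    case True
    then show ?thesis using peirce_classification by blast
  next
    case False
    have unit: "mul k x = x" if "mul k k = k" "k \<noteq> 0" for k x
    proof -
      have "mul k (mul k x) = mul k x" using that(1) by (metis mul_assoc)
      then have "mul k (mul k x - x) = 0" by (simp add: mul_diff)
      then have "mul k x - x = 0" using False that by blast
      then show ?thesis by simp
    qed
    have "k = e" if "mul k k = k" "k \<noteq> 0" for k
      using unit[OF that, of e] unit[OF e, of k] mul_comm[of k e] by metis
    then show ?thesis
    proof (rule local_unital_cases[OF unit[OF e] e(2)])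
      fix v w assume F: "frame e v w" and M: "mul v w = 0" "mul w w = 0" "mul v v = 0 \<or> mul v v = w"
      from M(3) show ?thesis
      proof
        assume "mul v v = 0"
        then have "isomorphic_to T24"
          by (intro isomorphic_tableI[OF F]) (simp_all add: comm_simps unit[OF e] M)
        then show ?thesis by (force simp: listed_def)
      next
        assume "mul v v = w"
        then have "isomorphic_to T23"
          by (intro isomorphic_tableI[OF F]) (simp_all add: comm_simps unit[OF e] M)
        then show ?thesis by (force simp: listed_def)
      qed
    qed
  qed
qed

end

theorem classification:
  assumes "\<not> ((\<forall>x y. mul x y = 0) \<and> (\<forall>x y. bracket x y = 0))"
  shows "\<exists>t\<in>listed. isomorphic_to t"
  using lie_cases
proof (elim disjE exE conjE)
  assume "\<forall>x y. bracket x y = 0"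
  then show ?thesis using assms abelian_classification by blast
next
  fix b1 b2 b3 assume "simple_table b1 b2 b3 1 0 0 1 0 1"
  then show ?thesis using simple_classification by (force simp: listed_def)
qed (use heisenberg_classification solvable_classification in blast)+

end

section \<open>Invariants\<close>

type_synonym binop = "vec3 \<Rightarrow> vec3 \<Rightarrow> vec3"

definition abelian :: "binop \<Rightarrow> binop \<Rightarrow> bool" where
  "abelian m b \<longleftrightarrow> (\<forall>x y. b x y = 0)"

definition class_two :: "binop \<Rightarrow> binop \<Rightarrow> bool" where
  "class_two m b \<longleftrightarrow> (\<forall>x y z. b (b x y) z = 0)"

definition metabelian :: "binop \<Rightarrow> binop \<Rightarrow> bool" where
  "metabelian m b \<longleftrightarrow> (\<forall>x y z w. b (b x y) (b z w) = 0)"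

text \<open>Among the solvable tables outside the Heisenberg type this singles out the scalar action
  of \<open>T07\<close> and \<open>T08\<close>.\<close>

definition bracket_in_span :: "binop \<Rightarrow> binop \<Rightarrow> bool" where
  "bracket_in_span m b \<longleftrightarrow> (\<forall>x y. \<exists>c d. b x y = c *s x + d *s y)"

definition has_centre :: "binop \<Rightarrow> binop \<Rightarrow> bool" where
  "has_centre m b \<longleftrightarrow> (\<exists>z. z \<noteq> 0 \<and> (\<forall>y. b z y = 0))"

definition zero_product :: "binop \<Rightarrow> binop \<Rightarrow> bool" where
  "zero_product m b \<longleftrightarrow> (\<forall>x y. m x y = 0)"

definition unital :: "binop \<Rightarrow> binop \<Rightarrow> bool" where
  "unital m b \<longleftrightarrow> (\<exists>u. \<forall>x. m u x = x)"

definition has_idempotent :: "binop \<Rightarrow> binop \<Rightarrow> bool" where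
  "has_idempotent m b \<longleftrightarrow> (\<exists>x. x \<noteq> 0 \<and> m x x = x)"

definition unique_idempotent :: "binop \<Rightarrow> binop \<Rightarrow> bool" where
  "unique_idempotent m b \<longleftrightarrow> (\<forall>x y. m x x = x \<longrightarrow> m y y = y \<longrightarrow> x = 0 \<or> y = 0 \<or> x = y)"

definition cube_reduced :: "binop \<Rightarrow> binop \<Rightarrow> bool" where
  "cube_reduced m b \<longleftrightarrow> (\<forall>x. m x (m x x) = 0 \<longrightarrow> m x x = 0)"

definition square_zero_annihilates :: "binop \<Rightarrow> binop \<Rightarrow> bool" where
  "square_zero_annihilates m b \<longleftrightarrow> (\<forall>x y. m x x = 0 \<longrightarrow> m x y = 0)"

definition square_commutes :: "binop \<Rightarrow> binop \<Rightarrow> bool" where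
  "square_commutes m b \<longleftrightarrow> (\<forall>x. b x (m x x) = 0)"

definition square_central :: "binop \<Rightarrow> binop \<Rightarrow> bool" where
  "square_central m b \<longleftrightarrow> (\<forall>x y. b (m x x) y = 0)"

definition square_eigenvector :: "binop \<Rightarrow> binop \<Rightarrow> bool" where
  "square_eigenvector m b \<longleftrightarrow> (\<forall>x. \<exists>c. b (m x x) x = c *s m x x)"

definition derived_square_zero :: "binop \<Rightarrow> binop \<Rightarrow> bool" where
  "derived_square_zero m b \<longleftrightarrow> (\<forall>x y z w. m (b x y) (b z w) = 0)"

definition bracket_eigenvector :: "binop \<Rightarrow> binop \<Rightarrow> bool" where
  "bracket_eigenvector m b \<longleftrightarrow> (\<forall>x y z. \<exists>c. m x (b y z) = c *s b y z)"

definition central_square :: "binop \<Rightarrow> binop \<Rightarrow> bool" where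
  "central_square m b \<longleftrightarrow> (\<exists>z. (\<forall>y. b z y = 0) \<and> m z z \<noteq> 0)"

text \<open>This separates \<open>T09\<close> with \<alpha> = 0 and \<beta> nonzero from
  \<open>T19\<close>: in both the centre is spanned by \<open>e2\<close>, but \<open>e3\<close>
  multiplies it by \<beta> in the first and by 0 in the second.\<close>

definition central_product :: "binop \<Rightarrow> binop \<Rightarrow> bool" where
  "central_product m b \<longleftrightarrow> (\<exists>z w. (\<forall>y. b z y = 0) \<and> m z w \<noteq> 0)"

lemmas invariant_defs =
  abelian_def class_two_def metabelian_def bracket_in_span_def has_centre_def zero_product_def
  unital_def has_idempotent_def unique_idempotent_def cube_reduced_def square_zero_annihilates_def
  square_commutes_def square_central_def square_eigenvector_def derived_square_zero_def
  bracket_eigenvector_def central_square_def central_product_def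

text \<open>The graph of an isomorphism is a bi-total and bi-unique relation respecting both
  operations, scalars, addition and zero; properties built from these by connectives and quantifiers
  are parametric.\<close>

lemma isomorphic_invariant:
  includes lifting_syntax
  assumes iso: "tpa_isomorphic (*s) m1 b1 (*s) m2 b2"
  shows "abelian m1 b1 = abelian m2 b2 \<and> class_two m1 b1 = class_two m2 b2 \<and>
    metabelian m1 b1 = metabelian m2 b2 \<and> bracket_in_span m1 b1 = bracket_in_span m2 b2 \<and>
    has_centre m1 b1 = has_centre m2 b2 \<and> zero_product m1 b1 = zero_product m2 b2 \<and>
    unital m1 b1 = unital m2 b2 \<and> has_idempotent m1 b1 = has_idempotent m2 b2 \<and>
    unique_idempotent m1 b1 = unique_idempotent m2 b2 \<and> cube_reduced m1 b1 = cube_reduced m2 b2 \<and>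
    square_zero_annihilates m1 b1 = square_zero_annihilates m2 b2 \<and> square_commutes m1 b1 = square_commutes m2 b2 \<and>
    square_central m1 b1 = square_central m2 b2 \<and> square_eigenvector m1 b1 = square_eigenvector m2 b2 \<and>
    derived_square_zero m1 b1 = derived_square_zero m2 b2 \<and> bracket_eigenvector m1 b1 = bracket_eigenvector m2 b2 \<and>
    central_square m1 b1 = central_square m2 b2 \<and> central_product m1 b1 = central_product m2 b2"
proof -
  obtain f :: "vec3 \<Rightarrow> vec3" where f: "Vector_Spaces.linear (*s) (*s) f" "bij f"
    "\<And>x y. f (m1 x y) = m2 (f x) (f y)" "\<And>x y. f (b1 x y) = b2 (f x) (f y)"
    using iso unfolding tpa_isomorphic_def by blast
  have f0: "f 0 = 0"
    using f(1) unfolding Vector_Spaces.linear_iff by (metis vec.scale_zero_left)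
  define R where "R x y \<longleftrightarrow> y = f x" for x y
  have [transfer_rule]: "bi_total R" "bi_unique R"
    using f(2) by (auto simp: bi_total_def bi_unique_def R_def bij_def inj_def surj_def)
  have [transfer_rule]: "(R ===> R ===> R) m1 m2" "(R ===> R ===> R) b1 b2"
    "(R ===> R ===> R) (+) (+)" "((=) ===> R ===> R) (*s) (*s)" "R 0 0"
    using f(1,3,4) f0 unfolding Vector_Spaces.linear_iff rel_fun_def R_def by auto
  show ?thesis
    unfolding invariant_defs by (intro conjI; transfer_prover)
qed

section \<open>Evaluation of the invariants on the tables\<close>

lemma exists_vector_3: "(\<exists>v::vec3. P v) \<longleftrightarrow> (\<exists>x y z. P (vector [x, y, z]))"
  by (metis vector3_cases)

lemmas eval_simps = forall_vector_3 exists_vector_3 T_vector_simps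

abbreviation (input) holds :: "(binop \<Rightarrow> binop \<Rightarrow> bool) \<Rightarrow> tpa_name \<Rightarrow> bool" where
  "holds P t \<equiv> P (T_mult t) (T_bracket t)"

lemma abelian_eval1:
  "holds abelian T20"
  "holds abelian T21"
  "holds abelian T22"
  "holds abelian T23"
  "holds abelian T24"
  "holds abelian T25"
  "holds abelian T26"
  "holds abelian T27"
  "holds abelian T28"
  "holds abelian T29"
  "holds abelian T30"
  by (auto simp: abelian_def eval_simps)

lemma abelian_eval2:
  "\<not> holds abelian T01"
  "\<not> holds abelian T02"
  "\<not> holds abelian (T03 r)"
  "\<not> holds abelian (T04 r)"
  "\<not> holds abelian T05"
  "\<not> holds abelian T06"
  unfolding abelian_def by (rule notI, drule spec[of _ e1], drule spec[of _ e2], simp add: T_vector_simps)+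

lemma abelian_eval3:
  "\<not> holds abelian (T07 r)"
  "\<not> holds abelian T08"
  "\<not> holds abelian (T09 k r)"
  "\<not> holds abelian (T10 k)"
  "\<not> holds abelian (T11 k)"
  "\<not> holds abelian (T12 r)"
  "\<not> holds abelian T13"
  "\<not> holds abelian T14"
  "\<not> holds abelian T15"
  "\<not> holds abelian T16"
  "\<not> holds abelian (T17 r)"
  "\<not> holds abelian T18"
  "\<not> holds abelian (T19 r)"
  unfolding abelian_def by (rule notI, drule spec[of _ e1], drule spec[of _ e3], simp add: T_vector_simps)+

lemma class_two_eval1:
  "holds class_two T02"
  "holds class_two (T03 r)"
  "holds class_two (T04 r)"
  "holds class_two T05"
  "holds class_two T06"
  by (auto simp: class_two_def eval_simps)

lemma class_two_eval2:
  "\<not> holds class_two T01"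
  unfolding class_two_def
  by (rule notI, drule spec[of _ e1], drule spec[of _ e2], drule spec[of _ e1], simp add: T_vector_simps)+

lemma class_two_eval3:
  "\<not> holds class_two (T07 r)"
  "\<not> holds class_two T08"
  "\<not> holds class_two (T09 k r)"
  "\<not> holds class_two (T10 k)"
  "\<not> holds class_two (T11 k)"
  "\<not> holds class_two (T12 r)"
  "\<not> holds class_two T13"
  "\<not> holds class_two T14"
  "\<not> holds class_two T15"
  "\<not> holds class_two T16"
  "\<not> holds class_two (T17 r)"
  "\<not> holds class_two T18"
  "\<not> holds class_two (T19 r)"
  unfolding class_two_def
  by (rule notI, drule spec[of _ e1], drule spec[of _ e3], drule spec[of _ e3], simp add: T_vector_simps)+

lemma metabelian_eval1:
  "holds metabelian (T07 r)"
  "holds metabelian T08"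
  "holds metabelian (T09 k r)"
  "holds metabelian (T10 k)"
  "holds metabelian (T11 k)"
  "holds metabelian (T12 r)"
  "holds metabelian T13"
  "holds metabelian T14"
  "holds metabelian T15"
  "holds metabelian T16"
  "holds metabelian (T17 r)"
  "holds metabelian T18"
  "holds metabelian (T19 r)"
  by (auto simp: metabelian_def eval_simps)

lemma metabelian_eval2:
  "\<not> holds metabelian T01"
  unfolding metabelian_def
  by (rule notI, drule spec[of _ e1], drule spec[of _ e2], drule spec[of _ e1], drule spec[of _ e3],
      simp add: T_vector_simps)+

lemma bracket_in_span_eval1:
  "holds bracket_in_span (T07 r)"
  "holds bracket_in_span T08"
  unfolding bracket_in_span_def forall_vector_3
  by (intro allI, rename_tac x1 x2 x3 y1 y2 y3, rule_tac x = y3 in exI, rule_tac x = "- x3" in exI, simp add: T_vector_simps algebra_simps)+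

lemma bracket_in_span_eval2:
  "\<not> holds bracket_in_span (T09 k r)"
  "\<not> holds bracket_in_span (T10 k)"
  "\<not> holds bracket_in_span (T11 k)"
  "\<not> holds bracket_in_span (T12 r)"
  "\<not> holds bracket_in_span T13"
  "\<not> holds bracket_in_span T14"
  "\<not> holds bracket_in_span T15"
  "\<not> holds bracket_in_span T16"
  "\<not> holds bracket_in_span (T17 r)"
  "\<not> holds bracket_in_span T18"
  "\<not> holds bracket_in_span (T19 r)"
  unfolding bracket_in_span_def
  by (rule notI, drule spec[of _ e1], drule spec[of _ e3], simp add: T_vector_simps)+

lemma has_centre_eval1:
  "holds has_centre (T09 k r) \<longleftrightarrow> k = 0"
  "holds has_centre (T10 k) \<longleftrightarrow> k = 0"
  "holds has_centre (T11 k) \<longleftrightarrow> k = 0"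
  proof -
  have "vector [1, 0, 0] \<noteq> (0::vec3)" by (simp add: vector3_arith)
  have *: "(\<exists>x y z. (x \<noteq> 0 \<or> y \<noteq> 0 \<or> z \<noteq> 0) \<and> (\<forall>u v w. x * w - z * u = 0 \<and> x * w - z * u + k * (y * w - z * v) = 0))
      \<longleftrightarrow> k = 0" (is "?L \<longleftrightarrow> _")
  proof
    assume ?L
    then obtain x y z where n: "x \<noteq> 0 \<or> y \<noteq> 0 \<or> z \<noteq> 0"
      and h: "\<And>u v w. x * w - z * u = 0 \<and> x * w - z * u + k * (y * w - z * v) = 0" by blast
    show "k = 0" using n h[where u = 1 and v = 0 and w = 0] h[where u = 0 and v = 0 and w = 1] by auto
  next
    assume "k = 0"
    then show ?L by (intro exI[of _ 0] exI[of _ 1]) simp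
  qed
  show "holds has_centre (T09 k r) \<longleftrightarrow> k = 0" "holds has_centre (T10 k) \<longleftrightarrow> k = 0"
    "holds has_centre (T11 k) \<longleftrightarrow> k = 0"
    using * by (simp_all add: has_centre_def eval_simps)
qed

lemma has_centre_eval2:
  "\<not> holds has_centre (T12 r)"
  "\<not> holds has_centre T13"
  "\<not> holds has_centre T14"
  "\<not> holds has_centre T15"
  unfolding has_centre_def exists_vector_3
  by (rule notI, elim exE conjE, frule spec[of _ e1], drule spec[of _ e3], force simp: T_vector_simps)+

lemma has_centre_eval3:
  "holds has_centre T16"
  "holds has_centre (T17 r)"
  "holds has_centre T18"
  "holds has_centre (T19 r)"
  unfolding has_centre_def by (rule exI[of _ e2], simp add: eval_simps)+

lemma zero_product_eval1:
  "holds zero_product (T03 r) \<longleftrightarrow> r = 0"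
  "holds zero_product (T07 r) \<longleftrightarrow> r = 0"
  "holds zero_product (T09 k r) \<longleftrightarrow> r = 0"
  by (simp_all add: zero_product_def eval_simps)
    (metis mult_1 mult_1_right mult_zero_left mult_zero_right add_0 add_0_right)+

lemma zero_product_eval2:
  "\<not> holds zero_product T02"
  unfolding zero_product_def
  by (rule notI, drule spec[of _ e2], drule spec[of _ e2], simp add: T_vector_simps)+

lemma zero_product_eval3:
  "\<not> holds zero_product T08"
  "\<not> holds zero_product (T10 k)"
  "\<not> holds zero_product (T11 k)"
  "\<not> holds zero_product T14"
  "\<not> holds zero_product T16"
  "\<not> holds zero_product T18"
  unfolding zero_product_def
  by (rule notI, drule spec[of _ e3], drule spec[of _ e3], simp add: T_vector_simps)+

lemma zero_product_eval4:
  "\<not> holds zero_product (T12 r)"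
  "\<not> holds zero_product T13"
  "\<not> holds zero_product (T17 r)"
  unfolding zero_product_def
  by (rule notI, drule spec[of _ e1], drule spec[of _ e1], simp add: T_vector_simps)+

lemma zero_product_eval5:
  "\<not> holds zero_product T15"
  unfolding zero_product_def
  by (rule notI, drule spec[of _ e1], drule spec[of _ e3], simp add: T_vector_simps)+

lemma unital_eval1:
  "holds unital T20"
  unfolding unital_def by (rule exI[of _ "vector [1, 1, 1]"], simp add: eval_simps)+

lemma unital_eval2:
  "holds unital T21"
  unfolding unital_def by (rule exI[of _ "vector [1, 1, 0]"], simp add: eval_simps)+

lemma unital_eval3:
  "holds unital T23"
  "holds unital T24"
  unfolding unital_def by (rule exI[of _ e1], simp add: eval_simps)+

lemma unital_eval4:
  "\<not> holds unital T22"
  "\<not> holds unital T25"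
  "\<not> holds unital T27"
  "\<not> holds unital T29"
  "\<not> holds unital T30"
  unfolding unital_def exists_vector_3
  by (rule notI, elim exE, drule spec[of _ e3], simp add: T_vector_simps)+

lemma unital_eval5:
  "\<not> holds unital T26"
  "\<not> holds unital T28"
  unfolding unital_def exists_vector_3
  by (rule notI, elim exE, drule spec[of _ "vector [1, 0, 1]"], simp add: T_vector_simps)+

lemma has_idempotent_eval1:
  "holds has_idempotent T20"
  "holds has_idempotent T21"
  "holds has_idempotent T22"
  "holds has_idempotent T23"
  "holds has_idempotent T24"
  "holds has_idempotent T25"
  "holds has_idempotent T26"
  "holds has_idempotent T27"
  unfolding has_idempotent_def by (rule exI[of _ e1], simp add: eval_simps)+

lemma has_idempotent_eval2:
  "\<not> holds has_idempotent T28"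
  "\<not> holds has_idempotent T29"
  "\<not> holds has_idempotent T30"
  "\<not> holds has_idempotent T02"
  "\<not> holds has_idempotent (T03 r)"
  "\<not> holds has_idempotent (T04 r)"
  by (auto simp: has_idempotent_def eval_simps)

lemma has_idempotent_eval3:
  "holds has_idempotent T05"
  "holds has_idempotent T06"
  unfolding has_idempotent_def by (rule exI[of _ e2], simp add: eval_simps)+

lemma has_idempotent_eval4:
  "holds has_idempotent (T07 r) \<longleftrightarrow> r \<noteq> 0"
  "holds has_idempotent (T09 k r) \<longleftrightarrow> r \<noteq> 0"
  "holds has_idempotent (T12 r) \<longleftrightarrow> r \<noteq> 0"
  proof -
  show "holds has_idempotent (T07 r) \<longleftrightarrow> r \<noteq> 0" "holds has_idempotent (T09 k r) \<longleftrightarrow> r \<noteq> 0"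
    "holds has_idempotent (T12 r) \<longleftrightarrow> r \<noteq> 0"
    by (cases "r = 0"; unfold has_idempotent_def;
        (intro iffI exI[of _ "vector [0, 0, 1 / r]"])?; auto simp: eval_simps)+
qed

lemma has_idempotent_eval5:
  "r \<noteq> 0 \<Longrightarrow> holds has_idempotent (T19 r)"
  by (unfold has_idempotent_def, rule exI[of _ "vector [0, 0, 1 / r]"], simp add: eval_simps)

lemma has_idempotent_eval6:
  "\<not> holds has_idempotent T08"
  "\<not> holds has_idempotent (T10 k)"
  "\<not> holds has_idempotent (T11 k)"
  "\<not> holds has_idempotent T13"
  "\<not> holds has_idempotent T14"
  "\<not> holds has_idempotent T15"
  "\<not> holds has_idempotent T16"
  by (auto simp: has_idempotent_def eval_simps)

lemma has_idempotent_eval7: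
  "holds has_idempotent (T17 r)"
  "holds has_idempotent T18"
  unfolding has_idempotent_def by (rule exI[of _ e2], simp add: eval_simps)+

lemma unique_idempotent_eval1:
  "\<not> holds unique_idempotent T20"
  "\<not> holds unique_idempotent T21"
  "\<not> holds unique_idempotent T22"
  unfolding unique_idempotent_def
  by (rule notI, drule spec[of _ e1], drule spec[of _ e2], simp add: T_vector_simps)+

lemma unique_idempotent_eval2:
  "holds unique_idempotent T23"
  "holds unique_idempotent T24"
  "holds unique_idempotent T25"
  "holds unique_idempotent T26"
  "holds unique_idempotent T27"
  by (auto simp: unique_idempotent_def eval_simps)

lemma cube_reduced_eval1:
  "holds cube_reduced T06"
  "holds cube_reduced T14"
  "holds cube_reduced (T17 r)"
  "holds cube_reduced T24"
  "holds cube_reduced T25"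
  "holds cube_reduced T27"
  "holds cube_reduced T28"
  by (auto simp: cube_reduced_def eval_simps)

lemma cube_reduced_eval2:
  "\<not> holds cube_reduced T05"
  unfolding cube_reduced_def by (rule notI, drule spec[of _ e1], simp add: T_vector_simps)+

lemma cube_reduced_eval3:
  "\<not> holds cube_reduced T15"
  unfolding cube_reduced_def by (rule notI, drule spec[of _ "vector [1, 0, 1]"], simp add: T_vector_simps)+

lemma cube_reduced_eval4:
  "\<not> holds cube_reduced T18"
  unfolding cube_reduced_def by (rule notI, drule spec[of _ e3], simp add: T_vector_simps)+

lemma cube_reduced_eval5:
  "\<not> holds cube_reduced T23"
  "\<not> holds cube_reduced T26"
  unfolding cube_reduced_def by (rule notI, drule spec[of _ e2], simp add: T_vector_simps)+

lemma cube_reduced_eval6: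
  "\<not> holds cube_reduced T29"
  unfolding cube_reduced_def by (rule notI, drule spec[of _ "vector [1, 1, 0]"], simp add: T_vector_simps)+

lemma cube_reduced_eval7:
  "\<not> holds cube_reduced T30"
  unfolding cube_reduced_def by (rule notI, drule spec[of _ e1], simp add: T_vector_simps)+

lemma square_zero_annihilates_eval1:
  "holds square_zero_annihilates T02"
  "holds square_zero_annihilates T20"
  "holds square_zero_annihilates T22"
  "holds square_zero_annihilates T26"
  "holds square_zero_annihilates T27"
  "holds square_zero_annihilates T30"
  by (auto simp: square_zero_annihilates_def eval_simps)

lemma square_zero_annihilates_eval2:
  "holds square_zero_annihilates (T12 0)"
  by (auto simp: square_zero_annihilates_def eval_simps)

lemma square_zero_annihilates_eval3:
  "holds square_zero_annihilates (T03 r) \<longleftrightarrow> r = 0"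
  proof
  assume "holds square_zero_annihilates (T03 r)"
  then show "r = 0" unfolding square_zero_annihilates_def
    by (drule_tac spec[of _ e1]) (drule_tac spec[of _ e2], simp add: T_vector_simps)
qed (simp add: square_zero_annihilates_def eval_simps)

lemma square_zero_annihilates_eval4:
  "\<not> holds square_zero_annihilates T29"
  unfolding square_zero_annihilates_def
  by (rule notI, drule spec[of _ e1], drule spec[of _ e2], simp add: T_vector_simps)+

lemma square_zero_annihilates_eval5:
  "\<not> holds square_zero_annihilates T21"
  unfolding square_zero_annihilates_def
  by (rule notI, drule spec[of _ e3], drule spec[of _ e1], simp add: T_vector_simps)+

lemma square_zero_annihilates_eval6:
  "\<not> holds square_zero_annihilates T25"
  unfolding square_zero_annihilates_def
  by (rule notI, drule spec[of _ e2], drule spec[of _ e1], simp add: T_vector_simps)+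

lemma square_zero_annihilates_eval7:
  "\<not> holds square_zero_annihilates T13"
  unfolding square_zero_annihilates_def
  \<comment> \<open>The square of \<open>e1 + i e3\<close> is \<open>e2 - e2\<close>, while its
    product with \<open>e1\<close> is \<open>e2\<close>.\<close>
  by (rule notI, drule spec[of _ "vector [1, 0, \<i>]"], drule spec[of _ e1], simp add: T_vector_simps)+

lemma square_commutes_eval1:
  "holds square_commutes T02"
  "holds square_commutes (T03 r)"
  by (auto simp: square_commutes_def eval_simps)

lemma square_commutes_eval2:
  "\<not> holds square_commutes (T04 r)"
  unfolding square_commutes_def by (rule notI, drule spec[of _ e2], simp add: T_vector_simps)+

lemma square_central_eval1:
  "holds square_central (T10 k) \<longleftrightarrow> k = 0"
  proof
  assume "holds square_central (T10 k)"
  then show "k = 0" unfolding square_central_def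
    by (drule_tac spec[of _ e3]) (drule_tac spec[of _ e3], simp add: T_vector_simps)
qed (simp add: square_central_def eval_simps)

lemma square_central_eval2:
  "\<not> holds square_central T16"
  unfolding square_central_def
  by (rule notI, drule spec[of _ e3], drule spec[of _ e3], simp add: T_vector_simps)+

lemma square_eigenvector_eval1:
  "holds square_eigenvector (T10 k)"
  unfolding square_eigenvector_def forall_vector_3
  by (intro allI, rename_tac x1 x2 x3, rule_tac x = "k * x3" in exI, simp add: T_vector_simps)

lemma square_eigenvector_eval2:
  "holds square_eigenvector T16"
  unfolding square_eigenvector_def forall_vector_3
  by (intro allI, rename_tac x1 x2 x3, rule_tac x = x3 in exI, simp add: T_vector_simps)

lemma square_eigenvector_eval3:
  "\<not> holds square_eigenvector (T11 k)"
  unfolding square_eigenvector_def by (rule notI, drule spec[of _ e3], force simp: T_vector_simps)+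

lemma derived_square_zero_eval1:
  "holds derived_square_zero (T09 k r)"
  "holds derived_square_zero (T10 k)"
  "holds derived_square_zero (T11 k)"
  "holds derived_square_zero T14"
  "holds derived_square_zero T15"
  "holds derived_square_zero T16"
  "holds derived_square_zero (T17 r)"
  "holds derived_square_zero T18"
  "holds derived_square_zero (T19 r)"
  by (auto simp: derived_square_zero_def eval_simps algebra_simps)

lemma derived_square_zero_eval2:
  "\<not> holds derived_square_zero (T12 r)"
  "\<not> holds derived_square_zero T13"
  unfolding derived_square_zero_def
  by (rule notI, drule spec[of _ e1], drule spec[of _ e3], drule spec[of _ e1], drule spec[of _ e3],
      simp add: T_vector_simps)+

lemma bracket_eigenvector_eval1:
  "holds bracket_eigenvector (T09 k r)"
  unfolding bracket_eigenvector_def forall_vector_3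
  by (intro allI, rename_tac x1 x2 x3 y1 y2 y3 z1 z2 z3, rule_tac x = "r * x3" in exI, simp add: T_vector_simps algebra_simps)

lemma bracket_eigenvector_eval2:
  "holds bracket_eigenvector (T10 k)"
  "holds bracket_eigenvector (T11 k)"
  "holds bracket_eigenvector T16"
  "holds bracket_eigenvector T18"
  unfolding bracket_eigenvector_def forall_vector_3
  by (intro allI exI[of _ 0], simp add: T_vector_simps algebra_simps)+

lemma bracket_eigenvector_eval3:
  "holds bracket_eigenvector (T17 r)"
  unfolding bracket_eigenvector_def forall_vector_3
  by (intro allI, rename_tac x1 x2 x3 y1 y2 y3 z1 z2 z3, rule_tac x = "r * x3" in exI, simp add: T_vector_simps algebra_simps)

lemma bracket_eigenvector_eval4:
  "holds bracket_eigenvector (T19 r)"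
  unfolding bracket_eigenvector_def forall_vector_3
  by (intro allI, rename_tac x1 x2 x3 y1 y2 y3 z1 z2 z3, rule_tac x = "r * x3" in exI, simp add: T_vector_simps algebra_simps)

lemma bracket_eigenvector_eval5:
  "\<not> holds bracket_eigenvector T14"
  "\<not> holds bracket_eigenvector T15"
  unfolding bracket_eigenvector_def
  by (rule notI, drule spec[of _ e3], drule spec[of _ e1], drule spec[of _ e3], force simp: T_vector_simps)+

lemma central_square_eval1:
  "\<not> holds central_square (T09 k r)"
  "\<not> holds central_square (T10 k)"
  "\<not> holds central_square (T11 k)"
  "\<not> holds central_square T16"
  "\<not> holds central_square (T19 r)"
  unfolding central_square_def exists_vector_3
  by (rule notI, elim exE conjE, frule spec[of _ e1], drule spec[of _ e3], force simp: T_vector_simps)+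

lemma central_square_eval2:
  "holds central_square (T17 r)"
  "holds central_square T18"
  unfolding central_square_def by (rule exI[of _ e2], simp add: eval_simps)+

lemma central_product_eval1:
  "holds central_product (T09 k r) \<longleftrightarrow> k = 0 \<and> r \<noteq> 0"
  proof
  assume "holds central_product (T09 k r)"
  then obtain z w where c: "\<And>y. T_bracket (T09 k r) z y = 0" and p: "T_mult (T09 k r) z w \<noteq> 0"
    unfolding central_product_def by blast
  show "k = 0 \<and> r \<noteq> 0"
    using p c[of e1] c[of e3]
    by (cases z rule: vector3_cases; cases w rule: vector3_cases) (auto simp: T_vector_simps)
next
  assume "k = 0 \<and> r \<noteq> 0"
  then show "holds central_product (T09 k r)" unfolding central_product_def
    by (intro exI[of _ e2] exI[of _ e3]) (simp add: eval_simps)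
qed

lemma central_product_eval2:
  "\<not> holds central_product (T19 r)"
  unfolding central_product_def exists_vector_3
  by (rule notI, elim exE conjE, frule spec[of _ e1], drule spec[of _ e3], auto simp: T_vector_simps)

lemmas invariant_evals =
  abelian_eval1 abelian_eval2 abelian_eval3 class_two_eval1
  class_two_eval2 class_two_eval3 metabelian_eval1 metabelian_eval2
  bracket_in_span_eval1 bracket_in_span_eval2 has_centre_eval1 has_centre_eval2
  has_centre_eval3 zero_product_eval1 zero_product_eval2 zero_product_eval3
  zero_product_eval4 zero_product_eval5 unital_eval1 unital_eval2
  unital_eval3 unital_eval4 unital_eval5 has_idempotent_eval1
  has_idempotent_eval2 has_idempotent_eval3 has_idempotent_eval4 has_idempotent_eval5
  has_idempotent_eval6 has_idempotent_eval7 unique_idempotent_eval1 unique_idempotent_eval2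
  cube_reduced_eval1 cube_reduced_eval2 cube_reduced_eval3 cube_reduced_eval4
  cube_reduced_eval5 cube_reduced_eval6 cube_reduced_eval7 square_zero_annihilates_eval1
  square_zero_annihilates_eval2 square_zero_annihilates_eval3 square_zero_annihilates_eval4 square_zero_annihilates_eval5
  square_zero_annihilates_eval6 square_zero_annihilates_eval7 square_commutes_eval1 square_commutes_eval2
  square_central_eval1 square_central_eval2 square_eigenvector_eval1 square_eigenvector_eval2
  square_eigenvector_eval3 derived_square_zero_eval1 derived_square_zero_eval2 bracket_eigenvector_eval1
  bracket_eigenvector_eval2 bracket_eigenvector_eval3 bracket_eigenvector_eval4 bracket_eigenvector_eval5
  central_square_eval1 central_square_eval2 central_product_eval1 central_product_eval2

section \<open>Parameters within the families\<close>

abbreviation (input) T_isomorphic :: "tpa_name \<Rightarrow> tpa_name \<Rightarrow> bool" where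
  "T_isomorphic s t \<equiv> tpa_isomorphic (*s) (T_mult s) (T_bracket s) (*s) (T_mult t) (T_bracket t)"

definition T_hom :: "tpa_name \<Rightarrow> tpa_name \<Rightarrow> (vec3 \<Rightarrow> vec3) \<Rightarrow>
    complex \<Rightarrow> complex \<Rightarrow> complex \<Rightarrow> complex \<Rightarrow> complex \<Rightarrow> complex \<Rightarrow> complex \<Rightarrow> complex \<Rightarrow> complex \<Rightarrow> bool" where
  "T_hom s t f a1 a2 a3 b1 b2 b3 c1 c2 c3 \<longleftrightarrow>
     (\<forall>p q r. f (vector [p, q, r]) =
        vector [p * a1 + q * b1 + r * c1, p * a2 + q * b2 + r * c2, p * a3 + q * b3 + r * c3]) \<and>
     (\<forall>p q r. f (vector [p, q, r]) = 0 \<longrightarrow> p = 0 \<and> q = 0 \<and> r = 0) \<and>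
     (\<forall>x y. f (T_mult s x y) = T_mult t (f x) (f y)) \<and>
     (\<forall>x y. f (T_bracket s x y) = T_bracket t (f x) (f y))"

lemma T_isomorphic_hom:
  assumes "T_isomorphic s t"
  obtains f a1 a2 a3 b1 b2 b3 c1 c2 c3 where "T_hom s t f a1 a2 a3 b1 b2 b3 c1 c2 c3"
proof -
  obtain f :: "vec3 \<Rightarrow> vec3" where f: "Vector_Spaces.linear (*s) (*s) f" "bij f"
    "\<And>x y. f (T_mult s x y) = T_mult t (f x) (f y)" "\<And>x y. f (T_bracket s x y) = T_bracket t (f x) (f y)"
    using assms unfolding tpa_isomorphic_def by blast
  obtain a1 a2 a3 where a: "f e1 = vector [a1, a2, a3]" by (rule vector3_cases)
  obtain b1 b2 b3 where b: "f e2 = vector [b1, b2, b3]" by (rule vector3_cases)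
  obtain c1 c2 c3 where c: "f e3 = vector [c1, c2, c3]" by (rule vector3_cases)
  have fv: "f (vector [p, q, r]) =
      vector [p * a1 + q * b1 + r * c1, p * a2 + q * b2 + r * c2, p * a3 + q * b3 + r * c3]" for p q r
  proof -
    have "vector [p, q, r] = p *s e1 + q *s e2 + r *s e3" by (simp add: axis_vector vector3_arith)
    then have "f (vector [p, q, r]) = p *s f e1 + q *s f e2 + r *s f e3"
      using f(1) unfolding Vector_Spaces.linear_iff by metis
    then show ?thesis by (simp only: a b c vector3_arith)
  qed
  have f0: "f 0 = 0"
    using f(1) unfolding Vector_Spaces.linear_iff by (metis vec.scale_zero_left)
  have "p = 0 \<and> q = 0 \<and> r = 0" if "f (vector [p, q, r]) = 0" for p q r
  proof -
    have "vector [p, q, r] = (0 :: vec3)"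
      using that f0 f(2) by (metis bij_def injD)
    then show ?thesis by (simp add: vector3_arith)
  qed
  then have "T_hom s t f a1 a2 a3 b1 b2 b3 c1 c2 c3"
    unfolding T_hom_def using f(3,4) fv by blast
  then show thesis by (rule that)
qed

lemma T_homD:
  assumes "T_hom s t f a1 a2 a3 b1 b2 b3 c1 c2 c3"
  shows "f (vector [p, q, r]) =
      vector [p * a1 + q * b1 + r * c1, p * a2 + q * b2 + r * c2, p * a3 + q * b3 + r * c3]"
    and "p * a1 + q * b1 + r * c1 = 0 \<Longrightarrow> p * a2 + q * b2 + r * c2 = 0 \<Longrightarrow> p * a3 + q * b3 + r * c3 = 0 \<Longrightarrow>
      p = 0 \<and> q = 0 \<and> r = 0"
    and "f (T_mult s x y) = T_mult t (f x) (f y)"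
    and "f (T_bracket s x y) = T_bracket t (f x) (f y)"
proof -
  show v: "f (vector [p, q, r]) =
      vector [p * a1 + q * b1 + r * c1, p * a2 + q * b2 + r * c2, p * a3 + q * b3 + r * c3]" for p q r
    using assms unfolding T_hom_def by blast
  show "p = 0 \<and> q = 0 \<and> r = 0"
    if "p * a1 + q * b1 + r * c1 = 0" "p * a2 + q * b2 + r * c2 = 0" "p * a3 + q * b3 + r * c3 = 0"
  proof -
    have "f (vector [p, q, r]) = 0" using v[of p q r] that by (simp add: vector3_arith)
    then show ?thesis using assms unfolding T_hom_def by blast
  qed
qed (use assms in \<open>unfold T_hom_def, blast\<close>)+

text \<open>For nonzero parameters, \<open>e1\<close> and \<open>e2\<close> span the isotropic lines
  of the product modulo the centre. An isomorphism fixes or exchanges these lines, and the exchange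
  changes the sign of the bracket but not of the product.\<close>

lemma T03_isomorphic_imp:
  assumes "T_isomorphic (T03 \<beta>) (T03 \<beta>')"
  shows "\<beta> = \<beta>' \<or> \<beta> = - \<beta>'"
proof (rule T_isomorphic_hom[OF assms])
  fix f a1 a2 a3 b1 b2 b3 c1 c2 c3
  assume H: "T_hom (T03 \<beta>) (T03 \<beta>') f a1 a2 a3 b1 b2 b3 c1 c2 c3"
  let ?e1 = "vector [1, 0, 0] :: vec3" and ?e2 = "vector [0, 1, 0] :: vec3"
  note ev = T_homD(1)[OF H] T_vector_simps
  have c: "c1 = 0" "c2 = 0" "c3 = a1 * b2 - a2 * b1"
    using T_homD(4)[OF H, of ?e1 ?e2] by (simp_all add: ev)
  have c3: "c3 \<noteq> 0" using T_homD(2)[OF H, of 0 0 1] c by auto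
  have "\<beta>' * (a1 * a2) = 0" "\<beta>' * (b1 * b2) = 0" "\<beta>' * (a1 * b2 + a2 * b1) = \<beta> * c3"
    using T_homD(3)[OF H, of ?e1 ?e1] T_homD(3)[OF H, of ?e2 ?e2] T_homD(3)[OF H, of ?e1 ?e2]
    by (auto simp: ev)
  then consider "\<beta>' = 0" "\<beta> * c3 = 0" | "a1 * b2 = 0" "\<beta>' * (a2 * b1) = \<beta> * c3" | "a2 * b1 = 0" "\<beta>' * (a1 * b2) = \<beta> * c3"
    by auto
  then show ?thesis
  proof cases
    case 1
    then show ?thesis using c3 by simp
  next
    case 2
    then have "(\<beta> + \<beta>') * c3 = 0" using c(3) by algebra
    then show ?thesis using c3 by (simp add: add_eq_0_iff2)
  next
    case 3
    then have "(\<beta> - \<beta>') * c3 = 0" using c(3) by algebra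
    then show ?thesis using c3 by simp
  qed
qed

lemma T04_isomorphic_imp:
  assumes "T_isomorphic (T04 \<beta>) (T04 \<beta>')"
  shows "\<beta> = \<beta>'"
proof (rule T_isomorphic_hom[OF assms])
  fix f a1 a2 a3 b1 b2 b3 c1 c2 c3
  assume H: "T_hom (T04 \<beta>) (T04 \<beta>') f a1 a2 a3 b1 b2 b3 c1 c2 c3"
  let ?e1 = "vector [1, 0, 0] :: vec3" and ?e2 = "vector [0, 1, 0] :: vec3"
  note ev = T_homD(1)[OF H] T_vector_simps
  have c: "c1 = 0" "c2 = 0" "c3 = a1 * b2 - a2 * b1"
    using T_homD(4)[OF H, of ?e1 ?e2] by (simp_all add: ev)
  have c3: "c3 \<noteq> 0" using T_homD(2)[OF H, of 0 0 1] c by auto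
  have "a1 = b2 * b2" "a2 = 0"
    using T_homD(3)[OF H, of ?e2 ?e2] by (auto simp: ev)
  moreover have "\<beta>' * (a1 * b2 + a2 * b1) = \<beta> * c3"
    using T_homD(3)[OF H, of ?e1 ?e2] by (auto simp: ev)
  ultimately show ?thesis using c c3 by auto
qed

lemma T07_isomorphic_imp:
  assumes "T_isomorphic (T07 \<beta>) (T07 \<beta>')"
  shows "\<beta> = \<beta>'"
proof (rule T_isomorphic_hom[OF assms])
  fix f a1 a2 a3 b1 b2 b3 c1 c2 c3
  assume H: "T_hom (T07 \<beta>) (T07 \<beta>') f a1 a2 a3 b1 b2 b3 c1 c2 c3"
  let ?e1 = "vector [1, 0, 0] :: vec3" and ?e3 = "vector [0, 0, 1] :: vec3"
  note ev = T_homD(1)[OF H] T_vector_simps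
  have a3: "a3 = 0" and a: "a1 = c3 * a1" "a2 = c3 * a2"
    using T_homD(4)[OF H, of ?e1 ?e3] by (auto simp: ev)
  have nz: "a1 \<noteq> 0 \<or> a2 \<noteq> 0" using T_homD(2)[OF H, of 1 0 0] a3 by auto
  then have c3: "c3 = 1" using a by auto
  have "\<beta>' * (a1 * c3) = \<beta> * a1" "\<beta>' * (a2 * c3) = \<beta> * a2"
    using T_homD(3)[OF H, of ?e1 ?e3] a3 by (auto simp: ev)
  then show ?thesis using c3 nz by auto
qed

text \<open>The map preserves the plane of \<open>e1\<close> and \<open>e2\<close>, because this plane is the centralizer of the
  derived algebra, and intertwines the two actions of \<open>e3\<close> on it up to the factor \<open>c3\<close>.\<close>

lemma solvable_hom:
  assumes H: "T_hom s t f a1 a2 a3 b1 b2 b3 c1 c2 c3"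
    and s: "T_bracket s = T_bracket (T09 \<alpha> 0)" and t: "T_bracket t = T_bracket (T09 \<alpha>' 0)"
  shows "a3 = 0" "b3 = 0"
    "b1 = 0 \<and> a1 \<noteq> 0 \<and> b2 \<noteq> 0 \<and> c3 = 1 \<and> \<alpha>' = \<alpha> \<or> b1 \<noteq> 0 \<and> a1 \<noteq> 0 \<and> c3 = \<alpha> \<and> \<alpha> \<noteq> 0 \<and> \<alpha>' = 1 / \<alpha>"
proof -
  let ?e1 = "vector [1, 0, 0] :: vec3" and ?e2 = "vector [0, 1, 0] :: vec3" and ?e3 = "vector [0, 0, 1] :: vec3"
  note ev = T_homD(1)[OF H] T_vector_simps
  have B12: "T_bracket t (f ?e1) (f ?e2) = f (vector [0, 0, 0])"
    and B13: "T_bracket t (f ?e1) (f ?e3) = f (vector [1, 1, 0])"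
    and B23: "T_bracket t (f ?e2) (f ?e3) = f (vector [0, \<alpha>, 0])"
    by (simp_all flip: T_homD(4)[OF H] add: s T_vector_simps)
  have e12: "a1 * b3 - a3 * b1 = 0" "a1 * b3 - a3 * b1 + \<alpha>' * (a2 * b3 - a3 * b2) = 0"
    using B12 unfolding t ev mult_zero_left mult_1_left add_0_left add_0_right by blast+
  have e13: "a1 * c3 - a3 * c1 = a1 + b1" "a1 * c3 - a3 * c1 + \<alpha>' * (a2 * c3 - a3 * c2) = a2 + b2"
      "0 = a3 + b3"
    using B13 unfolding t ev mult_zero_left mult_1_left add_0_left add_0_right by blast+
  have e23: "b1 * c3 - b3 * c1 = \<alpha> * b1" "b1 * c3 - b3 * c1 + \<alpha>' * (b2 * c3 - b3 * c2) = \<alpha> * b2"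
      "0 = \<alpha> * b3"
    using B23 unfolding t ev mult_zero_left mult_1_left add_0_left add_0_right by blast+
  have nz: "p = 0 \<and> q = 0" if "p * a1 + q * b1 = 0" "p * a2 + q * b2 = 0" "p * a3 + q * b3 = 0" for p q
    using T_homD(2)[OF H, of p q 0] that by simp
  have a3': "a3 = - b3" using e13(3) by algebra
  show b3: "b3 = 0"
  proof (rule ccontr)
    assume b3: "b3 \<noteq> 0"
    then have "\<alpha> = 0" using e23(3) by simp
    have "b3 * (a1 + b1) = 0" "b3 * (\<alpha>' * (a2 + b2)) = 0" using e12 unfolding a3' by algebra+
    then have z: "a1 + b1 = 0" "\<alpha>' * (a2 + b2) = 0" using b3 by auto
    have "a2 + b2 = (a1 + b1) * c3 + (\<alpha>' * (a2 + b2)) * c3"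
      using e13(1,2) e23(1,2) \<open>\<alpha> = 0\<close> unfolding a3' by algebra
    then have "a2 + b2 = 0" using z by simp
    then show False using nz[of 1 1] z(1) a3' by simp
  qed
  show a3: "a3 = 0" using b3 a3' by simp
  have e: "c3 * a1 = a1 + b1" "c3 * (a1 + \<alpha>' * a2) = a2 + b2" "c3 * b1 = \<alpha> * b1" "c3 * (b1 + \<alpha>' * b2) = \<alpha> * b2"
    using e13(1,2) e23(1,2) unfolding a3 b3 by (simp_all add: algebra_simps)
  have det: "a1 * b2 - a2 * b1 \<noteq> 0"
  proof
    assume d: "a1 * b2 - a2 * b1 = 0"
    have 1: "b2 = 0 \<and> - a2 = 0" by (rule nz) (use d a3 b3 in \<open>simp_all add: algebra_simps\<close>)
    have 2: "b1 = 0 \<and> - a1 = 0" by (rule nz) (use d a3 b3 in \<open>simp_all add: algebra_simps\<close>)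
    show False using nz[of 1 0] 1 2 a3 by simp
  qed
  show "b1 = 0 \<and> a1 \<noteq> 0 \<and> b2 \<noteq> 0 \<and> c3 = 1 \<and> \<alpha>' = \<alpha> \<or> b1 \<noteq> 0 \<and> a1 \<noteq> 0 \<and> c3 = \<alpha> \<and> \<alpha> \<noteq> 0 \<and> \<alpha>' = 1 / \<alpha>"
  \<comment> \<open>Either the eigenvalues correspond in order, or they are exchanged. In the second
    case \<open>c3\<close> is \<alpha>, and it multiplies the target eigenvalues 1 and
    \<open>\<alpha>'\<close> to \<alpha> and 1.\<close>
  proof (cases "b1 = 0")
    case True
    then have "a1 \<noteq> 0" "b2 \<noteq> 0" using det by auto
    then show ?thesis using e True by auto
  next
    case False
    then have c3: "c3 = \<alpha>" using e(3) by simp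
    have a1: "a1 \<noteq> 0" using e(1) False by auto
    have "\<alpha> \<noteq> 0"
    proof
      assume "\<alpha> = 0"
      then have "a1 + b1 = 0" "a2 + b2 = 0" using e(1,2) c3 by simp_all
      then have "a1 * b2 - a2 * b1 = 0" by algebra
      then show False using det by simp
    qed
    have b1: "b1 = (\<alpha> - 1) * a1" "b1 = (1 - \<alpha>') * b2"
    proof -
      show "b1 = (\<alpha> - 1) * a1" using e(1) c3 by algebra
      have "\<alpha> * b1 = \<alpha> * ((1 - \<alpha>') * b2)" using e(4) c3 by algebra
      then show "b1 = (1 - \<alpha>') * b2" using \<open>\<alpha> \<noteq> 0\<close> by simp
    qed
    have "b1 * ((\<alpha> * \<alpha>' - 1) * (a1 * b2 - a2 * b1)) = 0"
      using b1 e(2) c3 by algebra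
    then have "\<alpha> * \<alpha>' = 1" using False det by simp
    then have "\<alpha>' = 1 / \<alpha>" using \<open>\<alpha> \<noteq> 0\<close> by (simp add: field_simps)
    then show ?thesis using False a1 c3 \<open>\<alpha> \<noteq> 0\<close> by blast
  qed
qed

lemma T_bracket_T09:
  "T_bracket (T09 \<alpha> \<beta>) = T_bracket (T09 \<alpha> 0)" "T_bracket (T10 \<alpha>) = T_bracket (T09 \<alpha> 0)"
  "T_bracket (T11 \<alpha>) = T_bracket (T09 \<alpha> 0)" "T_bracket (T12 \<beta>) = T_bracket (T09 2 0)"
  by (simp_all add: T_bracket_def)

lemma T_bracket_T09_zero:
  "T_bracket (T17 \<beta>) = T_bracket (T09 0 0)" "T_bracket (T19 \<gamma>) = T_bracket (T09 0 0)"
  by (rule ext, rule ext, rename_tac x y, case_tac x rule: vector3_cases, case_tac y rule: vector3_cases,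
      simp add: T_vector_simps)+

lemma T09_isomorphic_imp:
  assumes "T_isomorphic (T09 \<alpha> \<beta>) (T09 \<alpha>' \<beta>')"
  shows "\<alpha>' = \<alpha> \<and> \<beta>' = \<beta> \<or> \<alpha> \<noteq> 0 \<and> \<alpha>' = 1 / \<alpha> \<and> \<beta>' = \<beta> / \<alpha>"
proof (rule T_isomorphic_hom[OF assms])
  fix f a1 a2 a3 b1 b2 b3 c1 c2 c3
  assume H: "T_hom (T09 \<alpha> \<beta>) (T09 \<alpha>' \<beta>') f a1 a2 a3 b1 b2 b3 c1 c2 c3"
  note S = solvable_hom[OF H T_bracket_T09(1) T_bracket_T09(1)]
  have "\<beta>' * (a1 * c3) = \<beta> * a1"
    using T_homD(3)[OF H, of "vector [1, 0, 0]" "vector [0, 0, 1]"] S(1)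
    by (auto simp: T_homD(1)[OF H] T_vector_simps)
  then show ?thesis using S(3) by (auto simp: field_simps)
qed

text \<open>\<open>e2\<close> is the square of \<open>e3\<close>, so its image is a multiple of
  \<open>e2\<close>; this excludes the exchange of eigenvalues that \<open>T09\<close> and
  \<open>T11\<close> allow.\<close>

lemma T10_isomorphic_imp:
  assumes "T_isomorphic (T10 \<alpha>) (T10 \<alpha>')"
  shows "\<alpha>' = \<alpha>"
proof (rule T_isomorphic_hom[OF assms])
  fix f a1 a2 a3 b1 b2 b3 c1 c2 c3
  assume H: "T_hom (T10 \<alpha>) (T10 \<alpha>') f a1 a2 a3 b1 b2 b3 c1 c2 c3"
  have "b1 = 0"
    using T_homD(3)[OF H, of "vector [0, 0, 1]" "vector [0, 0, 1]"]
    by (simp add: T_homD(1)[OF H] T_vector_simps)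
  then show ?thesis using solvable_hom(3)[OF H T_bracket_T09(2) T_bracket_T09(2)] by auto
qed

lemma T11_isomorphic_imp:
  assumes "T_isomorphic (T11 \<alpha>) (T11 \<alpha>')"
  shows "\<alpha>' = \<alpha> \<or> \<alpha> \<noteq> 0 \<and> \<alpha>' = 1 / \<alpha>"
proof (rule T_isomorphic_hom[OF assms])
  fix f a1 a2 a3 b1 b2 b3 c1 c2 c3
  assume H: "T_hom (T11 \<alpha>) (T11 \<alpha>') f a1 a2 a3 b1 b2 b3 c1 c2 c3"
  show ?thesis using solvable_hom(3)[OF H T_bracket_T09(3) T_bracket_T09(3)] by auto
qed

text \<open>Both algebras have \<alpha> = 2, so the exchange of eigenvalues, which inverts \<alpha>,
  is impossible. For \<open>T17\<close> and \<open>T19\<close> the value 0 has the same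
  effect.\<close>

lemma T12_isomorphic_imp:
  assumes "T_isomorphic (T12 \<beta>) (T12 \<beta>')"
  shows "\<beta>' = \<beta>"
proof (rule T_isomorphic_hom[OF assms])
  fix f a1 a2 a3 b1 b2 b3 c1 c2 c3
  assume H: "T_hom (T12 \<beta>) (T12 \<beta>') f a1 a2 a3 b1 b2 b3 c1 c2 c3"
  note S = solvable_hom[OF H T_bracket_T09(4) T_bracket_T09(4)]
  have "\<beta>' * (a1 * c3) = \<beta> * a1"
    using T_homD(3)[OF H, of "vector [1, 0, 0]" "vector [0, 0, 1]"] S(1,2)
      T_homD(3)[OF H, of "vector [0, 1, 0]" "vector [0, 0, 1]"]
    by (auto simp: T_homD(1)[OF H] T_vector_simps)
  then show ?thesis using S(3) by auto
qed

lemma T17_isomorphic_imp: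
  assumes "T_isomorphic (T17 \<beta>) (T17 \<beta>')"
  shows "\<beta>' = \<beta>"
proof (rule T_isomorphic_hom[OF assms])
  fix f a1 a2 a3 b1 b2 b3 c1 c2 c3
  assume H: "T_hom (T17 \<beta>) (T17 \<beta>') f a1 a2 a3 b1 b2 b3 c1 c2 c3"
  note S = solvable_hom[OF H T_bracket_T09_zero(1) T_bracket_T09_zero(1)]
  have "\<beta>' * (a1 * c3) = \<beta> * a1"
    using T_homD(3)[OF H, of "vector [1, 0, 0]" "vector [0, 0, 1]"] S(1)
    by (auto simp: T_homD(1)[OF H] T_vector_simps)
  then show ?thesis using S(3) by auto
qed

lemma T19_isomorphic_imp:
  assumes "T_isomorphic (T19 \<gamma>) (T19 \<gamma>')"
  shows "\<gamma>' = \<gamma>"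
proof (rule T_isomorphic_hom[OF assms])
  fix f a1 a2 a3 b1 b2 b3 c1 c2 c3
  assume H: "T_hom (T19 \<gamma>) (T19 \<gamma>') f a1 a2 a3 b1 b2 b3 c1 c2 c3"
  note S = solvable_hom[OF H T_bracket_T09_zero(2) T_bracket_T09_zero(2)]
  have "\<gamma>' * (a1 * c3) = \<gamma> * a1 + \<gamma> * b1"
    using T_homD(3)[OF H, of "vector [1, 0, 0]" "vector [0, 0, 1]"] S(1)
    by (auto simp: T_homD(1)[OF H] T_vector_simps)
  then show ?thesis using S(3) by auto
qed

section \<open>Separating the families\<close>

primrec family :: "tpa_name \<Rightarrow> nat" where
  "family T01 = 1" | "family T02 = 2" | "family (T03 _) = 3" | "family (T04 _) = 4" | "family T05 = 5"
| "family T06 = 6" | "family (T07 _) = 7" | "family T08 = 8" | "family (T09 _ _) = 9" | "family (T10 _) = 10"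
| "family (T11 _) = 11" | "family (T12 _) = 12" | "family T13 = 13" | "family T14 = 14" | "family T15 = 15"
| "family T16 = 16" | "family (T17 _) = 17" | "family T18 = 18" | "family (T19 _) = 19" | "family T20 = 20"
| "family T21 = 21" | "family T22 = 22" | "family T23 = 23" | "family T24 = 24" | "family T25 = 25"
| "family T26 = 26" | "family T27 = 27" | "family T28 = 28" | "family T29 = 29" | "family T30 = 30"

text \<open>The right-hand side mentions only properties of the two operations, so their invariance
  yields equal family numbers by rewriting, in place of one argument for each pair of
  families.\<close>

lemma family_decision:
  assumes "t \<in> listed"
  shows "family t =
    (if holds abelian t then
       if holds unital t then
         if \<not> holds unique_idempotent t then if holds square_zero_annihilates t then 20 else 21
         else if holds cube_reduced t then 24 else 23
       else if holds has_idempotent t then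
         if \<not> holds unique_idempotent t then 22 else if \<not> holds square_zero_annihilates t then 25
         else if holds cube_reduced t then 27 else 26
       else if holds cube_reduced t then 28 else if holds square_zero_annihilates t then 30 else 29
     else if holds class_two t then
       if holds has_idempotent t then if holds cube_reduced t then 6 else 5
       else if \<not> holds square_commutes t then 4
       else if \<not> holds zero_product t \<and> holds square_zero_annihilates t then 2 else 3
     else if \<not> holds metabelian t then 1
     else if holds bracket_in_span t then
       if holds zero_product t \<or> holds has_idempotent t then 7 else 8
     else if \<not> holds derived_square_zero t then
       if holds has_idempotent t \<or> holds square_zero_annihilates t then 12 else 13
     else if \<not> holds bracket_eigenvector t then if holds cube_reduced t then 14 else 15
     else if holds central_square t then if holds cube_reduced t then 17 else 18
     else if holds has_idempotent t then
       if holds central_product t \<or> \<not> holds has_centre t then 9 else 19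
     else if holds zero_product t then 9
     else if \<not> holds square_eigenvector t then 11
     else if holds has_centre t \<and> \<not> holds square_central t then 16 else 10)"
proof (cases "\<exists>\<beta>. t = T12 \<beta> \<or> t = T19 \<beta>")
  case True
  then consider "t = T12 0" | \<beta> where "t = T12 \<beta>" "\<beta> \<noteq> 0" | \<gamma> where "t = T19 \<gamma>" "\<gamma> \<noteq> 0"
    using assms by (auto simp: listed_def)
  then show ?thesis
    by cases (simp_all add: invariant_evals)
next
  case False
  then show ?thesis
    by (cases t; simp add: invariant_evals)
qed

lemma family_eqD:
  assumes "family s = family t"
  shows "s = t \<or> (\<exists>\<beta> \<beta>'. s = T03 \<beta> \<and> t = T03 \<beta>') \<or> (\<exists>\<beta> \<beta>'. s = T04 \<beta> \<and> t = T04 \<beta>') \<or>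
    (\<exists>\<beta> \<beta>'. s = T07 \<beta> \<and> t = T07 \<beta>') \<or> (\<exists>\<alpha> \<beta> \<alpha>' \<beta>'. s = T09 \<alpha> \<beta> \<and> t = T09 \<alpha>' \<beta>') \<or>
    (\<exists>\<alpha> \<alpha>'. s = T10 \<alpha> \<and> t = T10 \<alpha>') \<or> (\<exists>\<alpha> \<alpha>'. s = T11 \<alpha> \<and> t = T11 \<alpha>') \<or>
    (\<exists>\<beta> \<beta>'. s = T12 \<beta> \<and> t = T12 \<beta>') \<or> (\<exists>\<beta> \<beta>'. s = T17 \<beta> \<and> t = T17 \<beta>') \<or>
    (\<exists>\<gamma> \<gamma>'. s = T19 \<gamma> \<and> t = T19 \<gamma>')"
  using assms by (cases s; cases t; simp)

theorem T_isomorphic_imp_same_class: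
  assumes iso: "T_isomorphic s t" and "s \<in> listed" "t \<in> listed"
  shows "same_class s t"
proof -
  have "family s = family t"
    using isomorphic_invariant[OF iso] by (simp only: family_decision[OF assms(2)] family_decision[OF assms(3)])
  moreover have "same_class (T03 \<beta>) (T03 \<beta>')" if "T_isomorphic (T03 \<beta>) (T03 \<beta>')" for \<beta> \<beta>'
    using T03_isomorphic_imp[OF that] by (rule same_class.intros(2))
  moreover have "same_class (T09 \<alpha> \<beta>) (T09 \<alpha>' \<beta>')" if "T_isomorphic (T09 \<alpha> \<beta>) (T09 \<alpha>' \<beta>')" for \<alpha> \<beta> \<alpha>' \<beta>'
    using T09_isomorphic_imp[OF that] same_class.intros(1,3) by metis
  moreover have "same_class (T11 \<alpha>) (T11 \<alpha>')" if "T_isomorphic (T11 \<alpha>) (T11 \<alpha>')" for \<alpha> \<alpha>'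
    using T11_isomorphic_imp[OF that] same_class.intros(1,4) by metis
  ultimately show ?thesis
    using iso by (elim family_eqD[elim_format] disjE exE conjE)
      (auto intro: same_class.intros(1) dest: T04_isomorphic_imp T07_isomorphic_imp T10_isomorphic_imp
        T12_isomorphic_imp T17_isomorphic_imp T19_isomorphic_imp)
qed

section \<open>The classification\<close>

lemma T_tpa3: "tpa3 (*s) (T_mult t) (T_bracket t)"
proof -
  have "space3 ((*s) :: complex \<Rightarrow> vec3 \<Rightarrow> vec3)"
    by unfold_locales (subst vec_dim_card, simp)
  then show ?thesis
    using T_tpa by (simp add: tpa3_def)
qed

lemma T_isomorphic_refl: "T_isomorphic t t"
  unfolding tpa_isomorphic_def
  by (rule exI[of _ "\<lambda>x. x"]) (auto simp: Vector_Spaces.linear_iff vec.vector_space_axioms intro: bij_id[unfolded id_def])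

lemma T_isomorphic_tableI:
  fixes p1 :: complex
  assumes det: "det3 p1 p2 p3 q1 q2 q3 r1 r2 r3 \<noteq> 0"
  defines "c1 \<equiv> vector [p1, p2, p3]" and "c2 \<equiv> vector [q1, q2, q3]" and "c3 \<equiv> vector [r1, r2, r3]"
  defines "g \<equiv> \<lambda>v :: vec3. v $ 1 *s c1 + v $ 2 *s c2 + v $ 3 *s c3"
  assumes "T_mult s c1 c1 = g (T_mult t e1 e1)" "T_mult s c1 c2 = g (T_mult t e1 e2)"
      "T_mult s c1 c3 = g (T_mult t e1 e3)" "T_mult s c2 c2 = g (T_mult t e2 e2)"
      "T_mult s c2 c3 = g (T_mult t e2 e3)" "T_mult s c3 c3 = g (T_mult t e3 e3)"
    and "T_bracket s c1 c2 = g (T_bracket t e1 e2)" "T_bracket s c1 c3 = g (T_bracket t e1 e3)"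
      "T_bracket s c2 c3 = g (T_bracket t e2 e3)"
  shows "T_isomorphic s t"
proof -
  interpret tpa3 "(*s)" "T_mult s" "T_bracket s" by (rule T_tpa3)
  have comb: "comb (vector [1, 0, 0]) (vector [0, 1, 0]) (vector [0, 0, 1]) p q r = vector [p, q, r]" for p q r
    by (simp add: comb_def vector3_arith)
  have F: "frame (vector [1, 0, 0]) (vector [0, 1, 0]) (vector [0, 0, 1])"
    by (simp add: frame_def comb vector3_arith)
  show ?thesis
    by (rule isomorphic_changeI[OF F det, unfolded comb, folded c1_def c2_def c3_def, unfolded comb_def])
      (fact assms[unfolded g_def])+
qed

lemma same_class_imp_T_isomorphic:
  assumes "same_class s t"
  shows "T_isomorphic s t"
  using assms
proof cases
  case 1
  then show ?thesis by (simp add: T_isomorphic_refl)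
next
  case (2 \<beta> \<beta>')
  then consider "\<beta>' = \<beta>" | "\<beta>' = - \<beta>" by auto
  then show ?thesis
  proof cases
    case 1
    then show ?thesis using 2 by (simp add: T_isomorphic_refl)
  next
    case 2
    show ?thesis unfolding \<open>s = T03 \<beta>\<close> \<open>t = T03 \<beta>'\<close>
      \<comment> \<open>Exchanging \<open>e1\<close> and \<open>e2\<close> reverses the sign of
        their bracket, so \<open>e3\<close> is negated.\<close>
      by (rule T_isomorphic_tableI[of 0 1 0 1 0 0 0 0 "- 1"])
        (simp_all add: 2 det3_def T_vector_simps)
  qed
next
  case (3 \<alpha> \<beta>)
  show ?thesis
  proof (cases "\<alpha> = 1")
    case True
    then show ?thesis using 3 by (simp add: T_isomorphic_refl)
  next
    case False
    define u where "u = 1 - \<alpha>"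
    have u: "\<alpha> = 1 - u" "u \<noteq> 0" "u \<noteq> 1" using False \<open>\<alpha> \<noteq> 0\<close> by (auto simp: u_def)
    show ?thesis unfolding \<open>s = T09 \<alpha> \<beta>\<close> \<open>t = T09 (1 / \<alpha>) (\<beta> / \<alpha>)\<close> u(1)
      \<comment> \<open>Dividing \<open>e3\<close> by \<alpha> exchanges the eigenvalues. The second
        vector is the eigenvector \<open>e1 + e2 / u\<close> for the old eigenvalue 1; the first is
        \<open>e2\<close> plus the multiple of it that yields
        \<open>[e1, e3] = e1 + e2\<close>.\<close>
      by (rule T_isomorphic_tableI[of "(1 - u) / u" "1 + (1 - u) / (u * u)" 0 1 "1 / u" 0 0 0 "1 / (1 - u)"])
        (use u(2,3) in \<open>simp_all add: det3_def T_vector_simps field_simps\<close>)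
  qed
next
  case (4 \<alpha>)
  show ?thesis unfolding \<open>s = T11 \<alpha>\<close> \<open>t = T11 (1 / \<alpha>)\<close>
    \<comment> \<open>After \<open>e3\<close> is divided by \<alpha> the table forces the rest:
      \<open>e1\<close> is the square of \<open>e3\<close>, and \<open>e2\<close> is
      \<open>[e1, e3] - e1\<close>.\<close>
    by (rule T_isomorphic_tableI[of "1 / (\<alpha> * \<alpha>)" 0 0 "(1 - \<alpha>) / (\<alpha> * \<alpha> * \<alpha>)" "1 / (\<alpha> * \<alpha> * \<alpha>)" 0 0 0 "1 / \<alpha>"])
      (use \<open>\<alpha> \<noteq> 0\<close> in \<open>simp_all add: det3_def T_vector_simps field_simps\<close>)
qed

text \<open>One isomorphism composed with the inverse of the other connects the two tables; this
  reduces uniqueness for an arbitrary algebra to the comparison of tables.\<close>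

lemma tpa_isomorphic_cancel:
  fixes scale :: "complex \<Rightarrow> 'a::ab_group_add \<Rightarrow> 'a"
  assumes "tpa_isomorphic scale m b (*s) (T_mult t) (T_bracket t)"
    and "tpa_isomorphic scale m b (*s) (T_mult s) (T_bracket s)"
  shows "T_isomorphic t s"
proof -
  obtain f :: "'a \<Rightarrow> vec3" where f: "Vector_Spaces.linear scale (*s) f" "bij f"
    "\<And>x y. f (m x y) = T_mult t (f x) (f y)" "\<And>x y. f (b x y) = T_bracket t (f x) (f y)"
    using assms(1) unfolding tpa_isomorphic_def by blast
  obtain g :: "'a \<Rightarrow> vec3" where g: "Vector_Spaces.linear scale (*s) g" "bij g"
    "\<And>x y. g (m x y) = T_mult s (g x) (g y)" "\<And>x y. g (b x y) = T_bracket s (g x) (g y)"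
    using assms(2) unfolding tpa_isomorphic_def by blast
  define h where "h = g \<circ> inv f"
  have hf: "h (f x) = g x" for x
    using f(2) by (simp add: h_def bij_is_inj)
  have surj: "\<exists>x. v = f x" for v
    using f(2) by (meson bij_pointE)
  have "h (u + v) = h u + h v" "h (k *s u) = k *s h u" "h (T_mult t u v) = T_mult s (h u) (h v)"
    "h (T_bracket t u v) = T_bracket s (h u) (h v)" for u v k
  proof -
    obtain x y where u: "u = f x" and v: "v = f y" using surj by blast
    show "h (u + v) = h u + h v" "h (k *s u) = k *s h u" "h (T_mult t u v) = T_mult s (h u) (h v)"
      "h (T_bracket t u v) = T_bracket s (h u) (h v)"
      using f(1,3,4) g(1,3,4) unfolding u v Vector_Spaces.linear_iff by (metis hf)+
  qed
  moreover have "bij h" unfolding h_def using f(2) g(2) by (intro bij_comp bij_imp_bij_inv)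
  ultimately show ?thesis
    unfolding tpa_isomorphic_def Vector_Spaces.linear_iff using vec.vector_space_axioms by blast
qed

theorem theoremA:
  shows
    "(\<forall>t\<in>listed. transposed_poisson_algebra (*s) (T_mult t) (T_bracket t)) \<and>
     (\<forall>(scale :: complex \<Rightarrow> 'a::ab_group_add \<Rightarrow> 'a) mul bracket.
        transposed_poisson_algebra scale mul bracket \<longrightarrow>
        vector_space.dim scale (UNIV :: 'a set) = 3 \<longrightarrow>
        \<not> ((\<forall>x y. mul x y = 0) \<and> (\<forall>x y. bracket x y = 0)) \<longrightarrow>
        (\<exists>t\<in>listed.
           tpa_isomorphic scale mul bracket (*s) (T_mult t) (T_bracket t) \<and>
           (\<forall>s\<in>listed.
              tpa_isomorphic scale mul bracket (*s) (T_mult s) (T_bracket s)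
              \<longrightarrow> same_class t s))) \<and>
     (\<forall>s\<in>listed. \<forall>t\<in>listed.
        tpa_isomorphic (*s) (T_mult s) (T_bracket s) (*s) (T_mult t) (T_bracket t)
        \<longleftrightarrow> same_class s t)"
proof (intro conjI ballI allI impI)
  show "transposed_poisson_algebra (*s) (T_mult t) (T_bracket t)" for t
    by (rule T_tpa)
  show "T_isomorphic s t \<longleftrightarrow> same_class s t" if "s \<in> listed" "t \<in> listed" for s t
    using that T_isomorphic_imp_same_class same_class_imp_T_isomorphic by blast
next
  fix scale :: "complex \<Rightarrow> 'a \<Rightarrow> 'a" and mul bracket
  assume tpa: "transposed_poisson_algebra scale mul bracket"
    and dim: "vector_space.dim scale (UNIV :: 'a set) = 3"
    and nz: "\<not> ((\<forall>x y. mul x y = 0) \<and> (\<forall>x y. bracket x y = 0))"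
  interpret transposed_poisson_algebra scale mul bracket by (rule tpa)
  interpret tpa3 scale mul bracket by unfold_locales (rule dim)
  obtain t where "t \<in> listed" "tpa_isomorphic scale mul bracket (*s) (T_mult t) (T_bracket t)"
    using classification[OF nz] by blast
  then show "\<exists>t\<in>listed. tpa_isomorphic scale mul bracket (*s) (T_mult t) (T_bracket t) \<and>
      (\<forall>s\<in>listed. tpa_isomorphic scale mul bracket (*s) (T_mult s) (T_bracket s) \<longrightarrow> same_class t s)"
    using T_isomorphic_imp_same_class tpa_isomorphic_cancel by blast
qed

end
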